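(* Let $E$ be a subspatial product system over a unital $C^*$-algebra $\mathcal B$ with reference unit $\omega$, let $\mathcal U=\mathcal U_\omega$ be the maximal continuous set of units containing $\omega$, and let $\sim$ be the equivalence relation on $\mathcal U$ given by $x\sim y$ iff $\langle x-y,x-y\rangle=0$ (difference in the module $\mathcal U$). Then for all $x,y\in\mathcal U$: $$x\sim y\iff x=y^\beta\ \text{ for some }\beta\in\mathcal B.$$
   Context: $\mathcal B$ is a unital $C^*$-algebra with unit $1$. A Hilbert $\mathcal B$-$\mathcal B$ module is a right Hilbert $\mathcal B$-module (inner product $\mathcal B$-valued, linear in the second variable) with a unital left action of $\mathcal B$ by adjointable operators. A product system over $\mathcal B$ is a family $E=(E_t)_{t\ge0}$ of Hilbert $\mathcal B$-$\mathcal B$ modules with $E_0\cong\mathcal B$ and (associative) bilinear unitary isomorphisms $\varphi_{t,s}:E_t\otimes E_s\to E_{t+s}$, where $\otimes$ is the inner tensor product over $\mathcal B$ with $\langle u\otimes v,u_1\otimes v_1\rangle=\langle v,\langle u,u_1\rangle v_1\rangle$; one identifies $E_t\otimes E_s$ with $E_{t+s}$. A unit on $E$ is a family $u=(u_t)_{t\ge0}$, $u_t\in E_t$, with $u_0=1$ and $u_t\otimes u_s=u_{t+s}$. It is unital if $\langle u_t,u_t\rangle=1$ for all $t$, central if $bu_t=u_tb$ for all $b\in\mathcal B$, $t\ge0$. For units $u,v$ put $\mathcal K^{u,v}_t(b)=\langle u_t,bv_t\rangle$; these are bounded linear operators on $\mathcal B$ forming a semigroup in $t$. A set $S$ of units is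 continuous if for all $\xi,\eta\in S$ the semigroup $\mathcal K_t^{\xi,\eta}$ is uniformly continuous (continuous in the norm of $L(\mathcal B)$); then $\mathcal L^{\xi,\eta}=\frac{d}{dt}\mathcal K^{\xi,\eta}_t|_{t=0}\in L(\mathcal B)$ and $\mathcal K^{\xi,\eta}_t=\exp(t\mathcal L^{\xi,\eta})$. A unit $u$ is continuous if $\{u\}$ is continuous. For a continuous unit $\omega$, $\mathcal U_\omega$ is the set of all continuous units $x$ on $E$ such that $\{x,\omega\}$ is a continuous set; it is the maximal continuous set of units containing $\omega$. For $x^1,\dots,x^n\in\mathcal U_\omega$ and $\varkappa_j\in\mathcal B$ with $\sum_j\varkappa_j=1$, $\varkappa_1x^1\boxplus\dots\boxplus\varkappa_nx^n$ denotes the unit $\zeta$ with $\zeta_t=\lim_{m\to\infty}\big(\sum_j\varkappa_jx^j_{t/m}\big)^{\otimes m}$ (norm limit), and $x^1\varkappa_1\boxplus\dots\boxplus x^n\varkappa_n$ the unit obtained from $\sum_jx^j_{t/m}\varkappa_j$ in the same way. For $x\in\mathcal U_\omega$, $\beta\in\mathcal B$, $x^\beta$ is the unit with $x^\beta_t=\lim_{m\to\infty}\big(x_{t/m}e^{\beta t/m}\big)^{\otimes m}$. It is known that these limits exist and the units belong to $\mathcal U_\omega$. $\mathcal U_\omega$ is a $\mathcal B$-$\mathcal B$ module with $x+y=x\boxplus y\boxplus(-\omega)$, $b\cdot x=bx\boxplus(1-b)\omega$, $x\cdot b=xb\boxplus\omega(1-b)$ and neutral element $\omega$. For $\xi\in\mathcal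 U_\omega$, $a,c\in\mathcal B$: $\mathcal L^{x+y,\xi}=\mathcal L^{x,\xi}+\mathcal L^{y,\xi}-\mathcal L^{\omega,\xi}$, $\mathcal L^{x\cdot a,\xi}(c)=a^*\mathcal L^{x,\xi}(c)+(1-a)^*\mathcal L^{\omega,\xi}(c)$, $\mathcal L^{a\cdot x,\xi}(c)=\mathcal L^{x,\xi}(a^*c)+\mathcal L^{\omega,\xi}((1-a^* )c)$, $\mathcal L^{x^\beta,\xi}(c)=\mathcal L^{x,\xi}(c)+\beta^*c$, $\mathcal L^{x^\beta,x^\beta}(c)=\mathcal L^{x,x}(c)+\beta^*c+c\beta$. The semi-inner product on $\mathcal U_\omega$ is $\langle x,y\rangle=(\mathcal L^{x,y}-\mathcal L^{x,\omega}-\mathcal L^{\omega,y}+\mathcal L^{\omega,\omega})(1)$. A product system is spatial if it contains a central unital unit; it is subspatial if it can be embedded (by fiberwise isometric bilinear maps compatible with the product structure, which we regard as inclusions) into a spatial one. Convention: the reference unit $\omega$ is a continuous unit on $E$; if $E$ is spatial, $\omega$ is taken to be central. *)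

theory Defs
  imports "HOL-Analysis.Analysis" "HOL-Algebra.Ring"
begin

section \<open>Unital C*-algebras\<close>

class cstar_algebra = real_normed_algebra_1 + banach +
  fixes scaleC :: "complex \<Rightarrow> 'a \<Rightarrow> 'a"
    and adj :: "'a \<Rightarrow> 'a"
  assumes scaleC_add_right: "scaleC c (a + b) = scaleC c a + scaleC c b"
    and scaleC_add_left: "scaleC (c + d) a = scaleC c a + scaleC d a"
    and scaleC_scaleC: "scaleC c (scaleC d a) = scaleC (c * d) a"
    and scaleC_of_real: "scaleC (of_real r) a = r *\<^sub>R a"
    and scaleC_mult_left: "scaleC c a * b = scaleC c (a * b)"
    and scaleC_mult_right: "a * scaleC c b = scaleC c (a * b)"
    and norm_scaleC: "norm (scaleC c a) = cmod c * norm a"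
    and adj_add: "adj (a + b) = adj a + adj b"
    and adj_scaleC: "adj (scaleC c a) = scaleC (cnj c) (adj a)"
    and adj_mult: "adj (a * b) = adj b * adj a"
    and adj_adj: "adj (adj a) = a"
    and norm_adj_mult_self: "norm (adj a * a) = (norm a)\<^sup>2"

definition cstar_nonneg :: "'b::cstar_algebra \<Rightarrow> bool" where
  "cstar_nonneg a \<longleftrightarrow> (\<exists>b. a = adj b * b)"


section \<open>Hilbert bimodules\<close>

text \<open>
  As in \<^theory>\<open>HOL-Algebra.Ring\<close> and its module record, the additive group is the
  additive part of a \<open>ring\<close> record; the fields \<open>mult\<close> and \<open>one\<close> are never used.
\<close>

record ('e, 'b) bimodule = "'e ring" +
  lact :: "'b \<Rightarrow> 'e \<Rightarrow> 'e"
  ract :: "'e \<Rightarrow> 'b \<Rightarrow> 'e"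
  ip :: "'e \<Rightarrow> 'e \<Rightarrow> 'b"

text \<open>
  Truncated to \<open>0\<close> off the carrier only because \<open>Metric_space\<close> wants a
  function that is symmetric on the whole type.
\<close>

definition bimod_dist :: "('e, 'b::cstar_algebra, 'm) bimodule_scheme \<Rightarrow> 'e \<Rightarrow> 'e \<Rightarrow> real" where
  "bimod_dist M x y =
     (if x \<in> carrier M \<and> y \<in> carrier M
      then sqrt (norm (ip M (x \<ominus>\<^bsub>M\<^esub> y) (x \<ominus>\<^bsub>M\<^esub> y))) else 0)"

definition bimod_topology :: "('e, 'b::cstar_algebra, 'm) bimodule_scheme \<Rightarrow> 'e topology" where
  "bimod_topology M = Metric_space.mtopology (carrier M) (bimod_dist M)"

definition bimod_lim :: "('e, 'b::cstar_algebra, 'm) bimodule_scheme \<Rightarrow> (nat \<Rightarrow> 'e) \<Rightarrow> 'e" where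
  "bimod_lim M X = (THE x. limitin (bimod_topology M) X x sequentially)"

text \<open>
  The complex vector space structure is the one induced by the unital right
  action, \<open>c x = x (c 1)\<close>; hence the axiom \<open>lact_scaleC\<close>, which says that the left
  action \<open>\<B> \<rightarrow> L(E)\<close> is complex linear.
\<close>

locale hilbert_bimodule = abelian_group M
  for M :: "('e, 'b::cstar_algebra, 'm) bimodule_scheme" (structure) +
  assumes ract_closed: "x \<in> carrier M \<Longrightarrow> ract M x b \<in> carrier M"
    and ract_add_left: "\<lbrakk>x \<in> carrier M; y \<in> carrier M\<rbrakk> \<Longrightarrow> ract M (x \<oplus> y) b = ract M x b \<oplus> ract M y b"
    and ract_add_right: "x \<in> carrier M \<Longrightarrow> ract M x (a + b) = ract M x a \<oplus> ract M x b"
    and ract_mult: "x \<in> carrier M \<Longrightarrow> ract M x (a * b) = ract M (ract M x a) b"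
    and ract_one: "x \<in> carrier M \<Longrightarrow> ract M x 1 = x"
    and ip_add_right: "\<lbrakk>x \<in> carrier M; y \<in> carrier M; z \<in> carrier M\<rbrakk>
          \<Longrightarrow> ip M x (y \<oplus> z) = ip M x y + ip M x z"
    and ip_ract_right: "\<lbrakk>x \<in> carrier M; y \<in> carrier M\<rbrakk> \<Longrightarrow> ip M x (ract M y b) = ip M x y * b"
    and ip_adj: "\<lbrakk>x \<in> carrier M; y \<in> carrier M\<rbrakk> \<Longrightarrow> adj (ip M x y) = ip M y x"
    and ip_nonneg: "x \<in> carrier M \<Longrightarrow> cstar_nonneg (ip M x x)"
    and ip_definite: "\<lbrakk>x \<in> carrier M; ip M x x = 0\<rbrakk> \<Longrightarrow> x = \<zero>"
    and complete: "Metric_space.mcomplete (carrier M) (bimod_dist M)"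
    and lact_closed: "x \<in> carrier M \<Longrightarrow> lact M b x \<in> carrier M"
    and lact_add_right: "\<lbrakk>x \<in> carrier M; y \<in> carrier M\<rbrakk> \<Longrightarrow> lact M b (x \<oplus> y) = lact M b x \<oplus> lact M b y"
    and lact_add_left: "x \<in> carrier M \<Longrightarrow> lact M (a + b) x = lact M a x \<oplus> lact M b x"
    and lact_mult: "x \<in> carrier M \<Longrightarrow> lact M (a * b) x = lact M a (lact M b x)"
    and lact_one: "x \<in> carrier M \<Longrightarrow> lact M 1 x = x"
    and lact_scaleC: "x \<in> carrier M \<Longrightarrow> lact M (scaleC c b) x = ract M (lact M b x) (scaleC c 1)"
    and lact_ract: "x \<in> carrier M \<Longrightarrow> lact M a (ract M x b) = ract M (lact M a x) b"
    and lact_adjoint: "\<lbrakk>x \<in> carrier M; y \<in> carrier M\<rbrakk> \<Longrightarrow> ip M x (lact M b y) = ip M (lact M (adj b) x) y"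

definition standard_bimodule :: "('b::cstar_algebra, 'b) bimodule" where
  "standard_bimodule =
     \<lparr>carrier = UNIV, monoid.mult = (*), one = 1, ring.zero = 0, add = (+),
      lact = (*), ract = (*), ip = (\<lambda>a b. adj a * b)\<rparr>"

definition bilinear_isometry ::
  "('e, 'b::cstar_algebra) bimodule \<Rightarrow> ('f, 'b) bimodule \<Rightarrow> ('e \<Rightarrow> 'f) \<Rightarrow> bool" where
  "bilinear_isometry M N f \<longleftrightarrow>
     (\<forall>x\<in>carrier M. f x \<in> carrier N) \<and>
     (\<forall>x\<in>carrier M. \<forall>y\<in>carrier M. f (x \<oplus>\<^bsub>M\<^esub> y) = f x \<oplus>\<^bsub>N\<^esub> f y) \<and>
     (\<forall>x\<in>carrier M. \<forall>b. f (lact M b x) = lact N b (f x) \<and> f (ract M x b) = ract N (f x) b) \<and>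
     (\<forall>x\<in>carrier M. \<forall>y\<in>carrier M. ip N (f x) (f y) = ip M x y)"

definition bilinear_unitary ::
  "('e, 'b::cstar_algebra) bimodule \<Rightarrow> ('f, 'b) bimodule \<Rightarrow> ('e \<Rightarrow> 'f) \<Rightarrow> bool" where
  "bilinear_unitary M N f \<longleftrightarrow> bilinear_isometry M N f \<and> f ` carrier M = carrier N"

text \<open>
  \<open>(T, p)\<close> is an inner tensor product of \<open>M\<close> and \<open>N\<close> over \<open>\<B>\<close>, with \<open>p u v\<close> in the
  role of \<open>u \<otimes> v\<close>. The construction by separation and completion of the
  algebraic tensor product has these properties and they determine it up to a
  unique bilinear unitary; so a bilinear unitary \<open>\<phi>: M \<otimes> N \<rightarrow> T\<close> is the same thing
  as a map \<open>p u v = \<phi> (u \<otimes> v)\<close> such that \<open>(T, p)\<close> is an inner tensor product.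
\<close>

definition inner_tensor_product ::
  "('e, 'b::cstar_algebra) bimodule \<Rightarrow> ('f, 'b) bimodule \<Rightarrow> ('g, 'b) bimodule
     \<Rightarrow> ('e \<Rightarrow> 'f \<Rightarrow> 'g) \<Rightarrow> bool" where
  "inner_tensor_product M N T p \<longleftrightarrow>
     hilbert_bimodule T \<and>
     (\<forall>u\<in>carrier M. \<forall>v\<in>carrier N. p u v \<in> carrier T) \<and>
     (\<forall>u\<in>carrier M. \<forall>u'\<in>carrier M. \<forall>v\<in>carrier N. p (u \<oplus>\<^bsub>M\<^esub> u') v = p u v \<oplus>\<^bsub>T\<^esub> p u' v) \<and>
     (\<forall>u\<in>carrier M. \<forall>v\<in>carrier N. \<forall>v'\<in>carrier N. p u (v \<oplus>\<^bsub>N\<^esub> v') = p u v \<oplus>\<^bsub>T\<^esub> p u v') \<and>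
     (\<forall>u\<in>carrier M. \<forall>v\<in>carrier N. \<forall>b. p (ract M u b) v = p u (lact N b v)) \<and>
     (\<forall>u\<in>carrier M. \<forall>v\<in>carrier N. \<forall>b. lact T b (p u v) = p (lact M b u) v) \<and>
     (\<forall>u\<in>carrier M. \<forall>v\<in>carrier N. \<forall>b. ract T (p u v) b = p u (ract N v b)) \<and>
     (\<forall>u\<in>carrier M. \<forall>u'\<in>carrier M. \<forall>v\<in>carrier N. \<forall>v'\<in>carrier N.
        ip T (p u v) (p u' v') = ip N v (lact N (ip M u u') v')) \<and>
     bimod_topology T closure_of
       {\<Oplus>\<^bsub>T\<^esub>i\<in>{..<n}. p (u i) (v i) | (n::nat) u v.
          u \<in> {..<n} \<rightarrow> carrier M \<and> v \<in> {..<n} \<rightarrow> carrier N} = carrier T"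


section \<open>Product systems and units\<close>

text \<open>
  Only indices \<open>t \<ge> 0\<close> are meaningful. All fibres live on subsets of one type
  (e.g. a disjoint union), each with its own operations. \<open>tens E s t\<close> is
  \<open>\<phi>\<^bsub>s,t\<^esub>\<close> on elementary tensors and \<open>unit_iso E\<close> the isomorphism \<open>\<B> \<cong> E\<^bsub>0\<^esub>\<close>.
\<close>

record ('e, 'b) psystem =
  fib :: "real \<Rightarrow> ('e, 'b) bimodule"
  tens :: "real \<Rightarrow> real \<Rightarrow> 'e \<Rightarrow> 'e \<Rightarrow> 'e"
  unit_iso :: "'b \<Rightarrow> 'e"

text \<open>
  That \<open>1 \<otimes> x = x = x \<otimes> 1\<close> need not be demanded: it follows from associativity as
  soon as there is a unit, because \<open>u\<^bsub>0\<^esub> = 1\<close> gives \<open>1 \<otimes> 1 = 1\<close>.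
\<close>

definition product_system :: "('e, 'b::cstar_algebra) psystem \<Rightarrow> bool" where
  "product_system E \<longleftrightarrow>
     (\<forall>t\<ge>0. hilbert_bimodule (fib E t)) \<and>
     bilinear_unitary standard_bimodule (fib E 0) (unit_iso E) \<and>
     (\<forall>s\<ge>0. \<forall>t\<ge>0. inner_tensor_product (fib E s) (fib E t) (fib E (s + t)) (tens E s t)) \<and>
     (\<forall>r\<ge>0. \<forall>s\<ge>0. \<forall>t\<ge>0. \<forall>u\<in>carrier (fib E r). \<forall>v\<in>carrier (fib E s). \<forall>w\<in>carrier (fib E t).
        tens E (r + s) t (tens E r s u v) w = tens E r (s + t) u (tens E s t v w))"

text \<open>
  Units are extensional functions on \<open>{0..}\<close>, so that they are equal as soon as
  they agree for all \<open>t \<ge> 0\<close>.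
\<close>

definition units_of_ps :: "('e, 'b::cstar_algebra) psystem \<Rightarrow> (real \<Rightarrow> 'e) set" where
  "units_of_ps E =
     {u \<in> (\<Pi>\<^sub>E t\<in>{0..}. carrier (fib E t)).
        u 0 = unit_iso E 1 \<and> (\<forall>s\<ge>0. \<forall>t\<ge>0. tens E s t (u s) (u t) = u (s + t))}"

definition unital_unit :: "('e, 'b::cstar_algebra) psystem \<Rightarrow> (real \<Rightarrow> 'e) \<Rightarrow> bool" where
  "unital_unit E u \<longleftrightarrow> u \<in> units_of_ps E \<and> (\<forall>t\<ge>0. ip (fib E t) (u t) (u t) = 1)"

definition central_unit :: "('e, 'b::cstar_algebra) psystem \<Rightarrow> (real \<Rightarrow> 'e) \<Rightarrow> bool" where
  "central_unit E u \<longleftrightarrow>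
     u \<in> units_of_ps E \<and> (\<forall>t\<ge>0. \<forall>b. lact (fib E t) b (u t) = ract (fib E t) (u t) b)"

definition spatial :: "('e, 'b::cstar_algebra) psystem \<Rightarrow> bool" where
  "spatial E \<longleftrightarrow> (\<exists>u. central_unit E u \<and> unital_unit E u)"

definition ps_embedding ::
  "('e, 'b::cstar_algebra) psystem \<Rightarrow> ('f, 'b) psystem \<Rightarrow> (real \<Rightarrow> 'e \<Rightarrow> 'f) \<Rightarrow> bool" where
  "ps_embedding E F \<iota> \<longleftrightarrow>
     (\<forall>t\<ge>0. bilinear_isometry (fib E t) (fib F t) (\<iota> t)) \<and>
     (\<forall>s\<ge>0. \<forall>t\<ge>0. \<forall>u\<in>carrier (fib E s). \<forall>v\<in>carrier (fib E t).
        \<iota> (s + t) (tens E s t u v) = tens F s t (\<iota> s u) (\<iota> t v))"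

text \<open>
  HOL cannot quantify over types inside a formula, so the type carrying the
  spatial product system is a parameter. As a hypothesis of a theorem that is
  polymorphic in \<open>'f\<close>, \<open>subspatial TYPE('f) E\<close> puts no restriction on that type.
\<close>

definition subspatial :: "'f itself \<Rightarrow> ('e, 'b::cstar_algebra) psystem \<Rightarrow> bool" where
  "subspatial _ E \<longleftrightarrow>
     (\<exists>(F :: ('f, 'b) psystem) \<iota>. product_system F \<and> spatial F \<and> ps_embedding E F \<iota>)"


section \<open>Continuous units and generators\<close>

text \<open>
  \<open>L(\<B>)\<close> is represented by the type of bounded real linear maps with the operator norm;
  the maps below are in fact complex linear.
\<close>

definition \<K> ::
  "('e, 'b::cstar_algebra) psystem \<Rightarrow> (real \<Rightarrow> 'e) \<Rightarrow> (real \<Rightarrow> 'e) \<Rightarrow> real \<Rightarrow> 'b \<Rightarrow>\<^sub>L 'b" where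
  "\<K> E u v t = Blinfun (\<lambda>b. ip (fib E t) (u t) (lact (fib E t) b (v t)))"

definition continuous_set :: "('e, 'b::cstar_algebra) psystem \<Rightarrow> (real \<Rightarrow> 'e) set \<Rightarrow> bool" where
  "continuous_set E S \<longleftrightarrow>
     S \<subseteq> units_of_ps E \<and> (\<forall>\<xi>\<in>S. \<forall>\<eta>\<in>S. continuous_on {0..} (\<K> E \<xi> \<eta>))"

definition continuous_unit :: "('e, 'b::cstar_algebra) psystem \<Rightarrow> (real \<Rightarrow> 'e) \<Rightarrow> bool" where
  "continuous_unit E u \<longleftrightarrow> continuous_set E {u}"

definition \<L> ::
  "('e, 'b::cstar_algebra) psystem \<Rightarrow> (real \<Rightarrow> 'e) \<Rightarrow> (real \<Rightarrow> 'e) \<Rightarrow> 'b \<Rightarrow>\<^sub>L 'b" where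
  "\<L> E \<xi> \<eta> = vector_derivative (\<K> E \<xi> \<eta>) (at 0 within {0..})"

definition \<U> :: "('e, 'b::cstar_algebra) psystem \<Rightarrow> (real \<Rightarrow> 'e) \<Rightarrow> (real \<Rightarrow> 'e) set" where
  "\<U> E \<omega> = {x. continuous_unit E x \<and> continuous_set E {x, \<omega>}}"


section \<open>The bimodule of units\<close>

primrec tens_power :: "('e, 'b::cstar_algebra) psystem \<Rightarrow> real \<Rightarrow> 'e \<Rightarrow> nat \<Rightarrow> 'e" where
  "tens_power E s a 0 = unit_iso E 1"
| "tens_power E s a (Suc m) = tens E (real m * s) s (tens_power E s a m) a"

definition limit_unit ::
  "('e, 'b::cstar_algebra) psystem \<Rightarrow> (real \<Rightarrow> 'e) \<Rightarrow> real \<Rightarrow> 'e" where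
  "limit_unit E a =
     (\<lambda>t\<in>{0..}. bimod_lim (fib E t) (\<lambda>m. tens_power E (t / real m) (a (t / real m)) m))"

text \<open>
  \<open>box_left E [(k\<^sub>1, x\<^sub>1), \<dots>, (k\<^sub>n, x\<^sub>n)]\<close> and \<open>box_right E [(x\<^sub>1, k\<^sub>1), \<dots>, (x\<^sub>n, k\<^sub>n)]\<close> are
  the units written \<open>k\<^sub>1 x\<^sub>1 \<boxplus> \<dots> \<boxplus> k\<^sub>n x\<^sub>n\<close> and \<open>x\<^sub>1 k\<^sub>1 \<boxplus> \<dots> \<boxplus> x\<^sub>n k\<^sub>n\<close>; meant for
  coefficients with sum \<open>1\<close>.
\<close>

definition box_left ::
  "('e, 'b::cstar_algebra) psystem \<Rightarrow> ('b \<times> (real \<Rightarrow> 'e)) list \<Rightarrow> real \<Rightarrow> 'e" where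
  "box_left E ps =
     limit_unit E (\<lambda>s. \<Oplus>\<^bsub>fib E s\<^esub>j\<in>{..<length ps}. lact (fib E s) (fst (ps ! j)) (snd (ps ! j) s))"

definition box_right ::
  "('e, 'b::cstar_algebra) psystem \<Rightarrow> ((real \<Rightarrow> 'e) \<times> 'b) list \<Rightarrow> real \<Rightarrow> 'e" where
  "box_right E ps =
     limit_unit E (\<lambda>s. \<Oplus>\<^bsub>fib E s\<^esub>j\<in>{..<length ps}. ract (fib E s) (fst (ps ! j) s) (snd (ps ! j)))"

definition exp_unit ::
  "('e, 'b::cstar_algebra) psystem \<Rightarrow> (real \<Rightarrow> 'e) \<Rightarrow> 'b \<Rightarrow> real \<Rightarrow> 'e" where
  "exp_unit E x \<beta> = limit_unit E (\<lambda>s. ract (fib E s) (x s) (exp (s *\<^sub>R \<beta>)))"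

text \<open>The field \<open>ip\<close> is here only a semi-inner product.\<close>

definition unit_bimodule ::
  "('e, 'b::cstar_algebra) psystem \<Rightarrow> (real \<Rightarrow> 'e) \<Rightarrow> (real \<Rightarrow> 'e, 'b) bimodule" where
  "unit_bimodule E \<omega> =
     \<lparr>carrier = \<U> E \<omega>, monoid.mult = undefined, one = undefined,
      ring.zero = \<omega>,
      add = (\<lambda>x y. box_left E [(1, x), (1, y), (-1, \<omega>)]),
      lact = (\<lambda>b x. box_left E [(b, x), (1 - b, \<omega>)]),
      ract = (\<lambda>x b. box_right E [(x, b), (\<omega>, 1 - b)]),
      ip = (\<lambda>x y. blinfun_apply (\<L> E x y - \<L> E x \<omega> - \<L> E \<omega> y + \<L> E \<omega> \<omega>) 1)\<rparr>"

definition unit_equiv ::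
  "('e, 'b::cstar_algebra) psystem \<Rightarrow> (real \<Rightarrow> 'e) \<Rightarrow> (real \<Rightarrow> 'e) \<Rightarrow> (real \<Rightarrow> 'e) \<Rightarrow> bool" where
  "unit_equiv E \<omega> x y \<longleftrightarrow>
     ip (unit_bimodule E \<omega>) (x \<ominus>\<^bsub>unit_bimodule E \<omega>\<^esub> y) (x \<ominus>\<^bsub>unit_bimodule E \<omega>\<^esub> y) = 0"

end

theory Submission
  imports Defs
begin

text \<open>
  The unit \<open>x - y\<close> has \<open>\<langle>x - y, x - y\<rangle> = (\<L>\<^sup>x\<^sup>x - \<L>\<^sup>x\<^sup>y - \<L>\<^sup>y\<^sup>x + \<L>\<^sup>y\<^sup>y)(1)\<close>, which is the derivative at
  \<open>t = 0\<close> of \<open>\<langle>x\<^sub>t - y\<^sub>t, x\<^sub>t - y\<^sub>t\<rangle>\<close>. If it vanishes, the Cauchy-Schwarz inequality in \<open>E\<^sub>t\<close> for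
  \<open>x\<^sub>t - y\<^sub>t\<close> and the commutators \<open>a u\<^sub>t - u\<^sub>t a\<close>, with \<open>u = x\<close> and \<open>u = y\<close>, shows that
  \<open>\<L>\<^sup>x\<^sup>u - \<L>\<^sup>y\<^sup>u\<close> is left multiplication by an element of \<open>\<B>\<close>. Hence the generators \<open>\<L>\<close> of \<open>x\<close> agree
  with those of \<open>y\<^sup>\<beta>\<close>, where \<open>\<beta> = (\<L>\<^sup>y\<^sup>x - \<L>\<^sup>y\<^sup>y)(1)\<close>, and units with the same generators are equal.

  The limits of the products \<open>a\<^sub>t\<^sub>/\<^sub>m \<otimes> \<dots> \<otimes> a\<^sub>t\<^sub>/\<^sub>m\<close> exist because all the operators
  \<open>b \<mapsto> \<langle>a\<^sub>s, b (a\<^sub>q \<otimes> \<dots> \<otimes> a\<^sub>q\<^sub>')\<rangle>\<close>, for partitions \<open>s = q + \<dots> + q'\<close>, have one first order expansion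
  \<open>id + s L + o(s)\<close>. A product along a partition is then close to the product along any refinement.
\<close>

section \<open>Positivity in C*-algebras\<close>

text \<open>Two facts about Hilbert modules rest on an order of the algebra: Cauchy-Schwarz and the
  bound of the left action by \<open>norm b\<close>. The order must be closed under sums and limits,
  which is not evident for elements \<open>adj b * b\<close>. Positivity is therefore a norm
  condition, and that \<open>adj b * b\<close> satisfies it is shown by square roots and an
  iteration.

  Vectors are compared through operators: the norm of u - v is controlled by the operators of the
  pairs (u, u), (u, v) and (v, v). This is why a product is tested against a product along a
  refinement, why all these operators must share one \<open>L\<close>, and why two units are equal
  as soon as three generators agree. An error o(s) per factor adds up to o(1) over a partition,
  however many factors there are.

  The commutator enters because its square is O(t): together with o(t) for the square of x - y it
  makes the mixed inner product o(t), so that its derivative at 0 vanishes. The unit u itself, whose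
  square is only O(1), would give no more than o(sqrt t).\<close>

lemma adj_scaleR: "adj (r *\<^sub>R a) = r *\<^sub>R adj (a::'b::cstar_algebra)"
  by (metis adj_scaleC complex_cnj_complex_of_real scaleC_of_real)

lemma adj_zero [simp]: "adj (0::'b::cstar_algebra) = 0"
  using adj_scaleR[of 0 0] by simp

lemma adj_minus: "adj (- a) = - adj (a::'b::cstar_algebra)"
  using adj_scaleR[of "-1" a] by simp

lemma adj_diff: "adj (a - b) = adj a - adj (b::'b::cstar_algebra)"
  using adj_add[of a "-b"] by (simp add: adj_minus)

lemma adj_one [simp]: "adj (1::'b::cstar_algebra) = 1"
  by (metis adj_adj adj_mult mult_1_right)

lemma adj_of_real [simp]: "adj (of_real r) = (of_real r::'b::cstar_algebra)"
  by (simp add: of_real_def adj_scaleR)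

lemma adj_power: "adj (a ^ n) = adj (a::'b::cstar_algebra) ^ n"
  by (induction n) (simp_all add: adj_mult power_commutes)

lemma norm_adj [simp]: "norm (adj a) = norm (a::'b::cstar_algebra)"
proof -
  have le: "norm b \<le> norm (adj b)" for b :: 'b
  proof (cases "b = 0")
    case False
    have "(norm b)\<^sup>2 \<le> norm (adj b) * norm b"
      by (metis norm_adj_mult_self norm_mult_ineq)
    then show ?thesis
      using False by (simp add: power2_eq_square)
  qed simp
  show ?thesis
    using le[of a] le[of "adj a"] by (simp add: adj_adj)
qed

lemma bounded_linear_adj: "bounded_linear (adj :: 'b::cstar_algebra \<Rightarrow> 'b)"
  by (rule bounded_linear_intro[where K = 1]) (auto simp: adj_add adj_scaleR)

lemmas tendsto_adj [tendsto_intros] = bounded_linear.tendsto[OF bounded_linear_adj]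

lemma scaleC_one_left [simp]: "scaleC 1 a = (a::'b::cstar_algebra)"
  using scaleC_of_real[of 1 a] by simp

lemma scaleC_diff_right: "scaleC c (a - b) = scaleC c a - scaleC c (b::'b::cstar_algebra)"
  by (metis add_diff_cancel_right' diff_add_cancel scaleC_add_right)

lemma scaleC_minus_one [simp]: "scaleC (- 1) a = - (a::'b::cstar_algebra)"
  by (metis of_real_1 of_real_minus scaleC_of_real scaleR_minus1_left)

lemma scaleC_minus_left: "scaleC (- c) a = - scaleC c (a::'b::cstar_algebra)"
  by (metis mult_minus1 scaleC_minus_one scaleC_scaleC)

lemma of_real_mult_commute: "of_real r * a = a * (of_real r :: 'a::real_algebra_1)"
  by (simp add: of_real_def)

section \<open>Norms of powers, and square roots by a contraction\<close>

lemma norm_selfadjoint_power2: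
  assumes "adj (h::'b::cstar_algebra) = h"
  shows "norm (h * h) = (norm h)\<^sup>2"
  using norm_adj_mult_self[of h] assms by simp

text \<open>The C*-identity, iterated. Dyadic exponents suffice to read off a norm from the growth
  of powers, as a spectral radius formula would.\<close>

lemma norm_selfadjoint_pow_pow2:
  assumes "adj (h::'b::cstar_algebra) = h"
  shows "norm (h ^ (2 ^ n)) = norm h ^ (2 ^ n)"
proof (induction n)
  case (Suc n)
  have "norm (h ^ (2 ^ Suc n)) = norm (h ^ (2 ^ n) * h ^ (2 ^ n))"
    by (simp add: power_add[symmetric] mult_2)
  also have "\<dots> = (norm (h ^ (2 ^ n)))\<^sup>2"
    by (rule norm_selfadjoint_power2) (simp add: adj_power assms)
  also have "\<dots> = norm h ^ (2 ^ Suc n)"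
    by (simp add: Suc power2_eq_square power_add[symmetric] mult_2)
  finally show ?case .
qed simp

text \<open>For commuting self-adjoint parts the mixed terms of \<open>adj u * u\<close> cancel. The
  next arguments choose \<open>k\<close> and \<open>l\<close> as square roots that make the right
  hand side a scalar.\<close>

lemma norm_cartesian:
  fixes k l :: "'b::cstar_algebra"
  assumes "adj k = k" "adj l = l" "k * l = l * k"
  shows "(norm (k + scaleC \<i> l))\<^sup>2 = norm (k * k + l * l)"
proof -
  have "adj (k + scaleC \<i> l) * (k + scaleC \<i> l) = (k - scaleC \<i> l) * (k + scaleC \<i> l)"
    by (simp add: adj_add adj_scaleC assms scaleC_minus_left)
  also have "\<dots> = k * k + l * l"
    by (simp add: algebra_simps scaleC_mult_left scaleC_mult_right scaleC_scaleC scaleC_diff_right assms(3))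
  finally show ?thesis by (metis norm_adj_mult_self)
qed

text \<open>\<open>1 - y\<close> is the root, where \<open>y\<close> is the fixed point of the contraction \<open>y \<mapsto> (z + y\<^sup>2)/2\<close>.\<close>

lemma ex_sqrt_one_minus:
  fixes z :: "'b::cstar_algebra"
  assumes "norm z < 1" "adj z = z"
  obtains q where "q * q = 1 - z" "adj q = q" "\<forall>x. x * z = z * x \<longrightarrow> x * q = q * x"
proof -
  \<comment> \<open>All that is wanted of the fixed point is put into a closed set invariant under
    \<open>f\<close>: self-adjointness, commutation with everything that commutes with
    \<open>z\<close>, and the bound that makes \<open>f\<close> contract by the factor
    \<open>norm z\<close>.\<close>
  define S where "S = {y. norm y \<le> norm z} \<inter> {y. adj y = y} \<inter> (\<Inter>x\<in>{x. x * z = z * x}. {y. x * y = y * x})"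
  define f where "f y = (1/2) *\<^sub>R (z + y * y)" for y :: 'b
  have cont_adj: "continuous_on UNIV (adj :: 'b \<Rightarrow> 'b)"
    by (simp add: bounded_linear_adj linear_continuous_on)
  have S: "norm y \<le> norm z" "adj y = y" "x * z = z * x \<Longrightarrow> x * y = y * x" if "y \<in> S" for x y
    using that by (auto simp: S_def)
  have "closed S"
    unfolding S_def
    by (intro closed_Int closed_INT ballI closed_Collect_le closed_Collect_eq continuous_intros cont_adj)
  moreover have "z \<in> S"
    using assms by (auto simp: S_def)
  moreover have "f ` S \<subseteq> S"
  proof clarify
    fix y assume y: "y \<in> S"
    have "norm (z + y * y) \<le> norm z + norm y * norm y"
      by (intro norm_triangle_le add_left_mono norm_mult_ineq)
    moreover have "norm y * norm y \<le> norm z * 1"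
      using S(1)[OF y] assms by (intro mult_mono) auto
    ultimately have "norm (f y) \<le> norm z"
      by (simp add: f_def)
    moreover have "adj (f y) = f y"
      using assms by (simp add: f_def S(2)[OF y] adj_scaleR adj_add adj_mult)
    moreover have "x * f y = f y * x" if "x * z = z * x" for x
    proof -
      have "x * (y * y) = y * y * x" using S(3)[OF y that] by (metis mult.assoc)
      then show ?thesis using that by (simp add: f_def distrib_left distrib_right)
    qed
    ultimately show "f y \<in> S" by (simp add: S_def)
  qed
  moreover have "dist (f y) (f y') \<le> norm z * dist y y'" if "y \<in> S" "y' \<in> S" for y y'
  proof -
    have "f y - f y' = (1/2) *\<^sub>R (y * (y - y') + (y - y') * y')"
      by (simp add: f_def algebra_simps)
    then have "norm (f y - f y') = 1/2 * norm (y * (y - y') + (y - y') * y')"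
      by simp
    also have "\<dots> \<le> 1/2 * (norm y * norm (y - y') + norm (y - y') * norm y')"
      by (intro mult_left_mono norm_triangle_le add_mono norm_mult_ineq) simp
    also have "\<dots> \<le> 1/2 * (norm z * norm (y - y') + norm (y - y') * norm z)"
      using that by (intro mult_left_mono add_mono mult_right_mono S) auto
    finally show ?thesis by (simp add: dist_norm)
  qed
  ultimately have "\<exists>!y. y \<in> S \<and> f y = y"
    using Banach_fix[of S "norm z" f] assms complete_eq_closed by (metis empty_iff norm_ge_zero)
  then obtain y where y: "y \<in> S" "f y = y" by blast
  have "2 *\<^sub>R y = z + y * y"
    using arg_cong[OF y(2), of "\<lambda>u. 2 *\<^sub>R u"] by (simp add: f_def)
  then have "(1 - y) * (1 - y) = 1 - z"
    by (simp add: algebra_simps scaleR_2)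
  moreover have "adj (1 - y) = 1 - y"
    by (simp add: S(2)[OF y(1)] adj_diff)
  moreover have "x * (1 - y) = (1 - y) * x" if "x * z = z * x" for x
    using S(3)[OF y(1) that] by (simp add: algebra_simps)
  ultimately show ?thesis using that by blast
qed

section \<open>The cone of positive elements\<close>

text \<open>For self-adjoint \<open>a\<close> the condition says that the spectrum lies in [0, 2r].
  In this form sums are immediate, since the radii add.\<close>

definition pos :: "'b::cstar_algebra \<Rightarrow> bool" where
  "pos a \<longleftrightarrow> adj a = a \<and> (\<exists>r\<ge>0. norm (of_real r - a) \<le> r)"

lemma pos_of_real: "0 \<le> r \<Longrightarrow> pos (of_real r)"
  unfolding pos_def by (metis adj_of_real cancel_comm_monoid_add_class.diff_cancel norm_zero)

lemma pos_add:
  assumes "pos a" "pos b"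
  shows "pos (a + b)"
proof -
  obtain r s where "0 \<le> r" "norm (of_real r - a) \<le> r" "0 \<le> s" "norm (of_real s - b) \<le> s"
    using assms by (auto simp: pos_def)
  then have "norm (of_real (r + s) - (a + b)) \<le> r + s"
    using norm_triangle_mono[of "of_real r - a" r "of_real s - b" s] by (simp add: algebra_simps)
  with \<open>0 \<le> r\<close> \<open>0 \<le> s\<close> show ?thesis
    using assms by (auto simp: pos_def adj_add intro!: exI[of _ "r + s"])
qed

lemma pos_scaleR:
  assumes "pos a" "0 \<le> c"
  shows "pos (c *\<^sub>R a)"
proof -
  obtain r where "0 \<le> r" "norm (of_real r - a) \<le> r"
    using assms by (auto simp: pos_def)
  then have "norm (c *\<^sub>R (of_real r - a)) \<le> c * r"
    using assms by (simp add: mult_left_mono)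
  moreover have "c *\<^sub>R (of_real r - a) = of_real (c * r) - c *\<^sub>R a"
    by (simp add: scaleR_conv_of_real algebra_simps)
  ultimately show ?thesis
    using assms \<open>0 \<le> r\<close> by (auto simp: pos_def adj_scaleR intro!: exI[of _ "c * r"])
qed

text \<open>Write a + e = (r + e)(1 - z); then norm z is at most r / (r + e). The shift by
  \<open>e\<close> makes this strictly less than 1.\<close>

lemma ex_sqrt_pos:
  assumes "pos (a::'b::cstar_algebra)" "0 < e"
  obtains k where "k * k = a + of_real e" "adj k = k" "\<forall>x. x * a = a * x \<longrightarrow> x * k = k * x"
proof -
  obtain r where r: "0 \<le> r" "norm (of_real r - a) \<le> r" and a: "adj a = a"
    using assms by (auto simp: pos_def)
  define z where "z = (1 / (r + e)) *\<^sub>R (of_real r - a)"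
  have re: "0 < r + e" using r assms by simp
  have "norm z = norm (of_real r - a) / (r + e)"
    using re by (simp add: z_def)
  also have "\<dots> < 1" using r re assms by simp
  finally have "norm z < 1" .
  moreover have "adj z = z" by (simp add: z_def adj_scaleR adj_diff a)
  ultimately obtain q where q: "q * q = 1 - z" "adj q = q" "\<forall>x. x * z = z * x \<longrightarrow> x * q = q * x"
    using ex_sqrt_one_minus by blast
  have "(r + e) *\<^sub>R (1 - z) = a + of_real e"
    using re by (simp add: z_def scaleR_diff_right) (simp add: of_real_def scaleR_left_distrib)
  then have "(sqrt (r + e) *\<^sub>R q) * (sqrt (r + e) *\<^sub>R q) = a + of_real e"
    using re q(1) by simp
  moreover have "x * (sqrt (r + e) *\<^sub>R q) = (sqrt (r + e) *\<^sub>R q) * x" if "x * a = a * x" for x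
  proof -
    have "x * z = z * x"
      using that by (simp add: z_def right_diff_distrib left_diff_distrib of_real_mult_commute[symmetric])
    then have "x * q = q * x" using q(3) by blast
    then show ?thesis by simp
  qed
  moreover have "adj (sqrt (r + e) *\<^sub>R q) = sqrt (r + e) *\<^sub>R q"
    by (simp add: adj_scaleR q(2))
  ultimately show ?thesis using that by blast
qed

text \<open>Take commuting roots \<open>k\<close> of c + h + e and \<open>l\<close> of c - h + e,
  and u = k + i l. Then \<open>adj u * u\<close> = 2(c + e), while the squares of \<open>u\<close>
  and \<open>adj u\<close> add up to 4h; hence 4 \<open>norm h\<close> is at most 4(c + e).\<close>

lemma norm_le_of_pos_diff_add:
  assumes "pos (of_real c + h)" "pos (of_real c - (h::'b::cstar_algebra))"
  shows "norm h \<le> c"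
proof (rule field_le_epsilon)
  fix e :: real assume e: "0 < e"
  obtain k where k: "k * k = of_real c + h + of_real e" "adj k = k"
      "\<forall>x. x * (of_real c + h) = (of_real c + h) * x \<longrightarrow> x * k = k * x"
    using ex_sqrt_pos[OF assms(1) e] by blast
  obtain l where l: "l * l = of_real c - h + of_real e" "adj l = l"
      "\<forall>x. x * (of_real c - h) = (of_real c - h) * x \<longrightarrow> x * l = l * x"
    using ex_sqrt_pos[OF assms(2) e] by blast
  have "h * k = k * h"
    by (rule k(3)[rule_format]) (simp add: algebra_simps of_real_def)
  then have "k * l = l * k"
    by (intro l(3)[rule_format]) (simp add: algebra_simps of_real_def)
  define u where "u = k + scaleC \<i> l"
  have au: "adj u = k - scaleC \<i> l"
    by (simp add: u_def adj_add adj_scaleC k l scaleC_minus_left)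
  have kl: "k * k + l * l = of_real ((c + e) + (c + e))"
    unfolding k of_real_add l by simp
  have nu: "(norm u)\<^sup>2 = \<bar>(c + e) + (c + e)\<bar>"
    unfolding u_def norm_cartesian[OF k(2) l(2) \<open>k * l = l * k\<close>] kl by (rule norm_of_real)
  \<comment> \<open>Adding the two norm conditions gives |r1 + r2 - 2c| at most r1 + r2, which
    excludes negative \<open>c\<close>; this removes the absolute value in
    \<open>nu\<close>.\<close>
  have c: "0 \<le> c + e"
  proof (rule ccontr)
    assume "\<not> 0 \<le> c + e"
    have *: "x + y - (z + z) = (x - (z + h)) + (y - (z - h))" for x y z :: 'b
      by (simp add: algebra_simps)
    obtain r1 r2 where r: "0 \<le> r1" "norm (of_real r1 - (of_real c + h)) \<le> r1"
        "0 \<le> r2" "norm (of_real r2 - (of_real c - h)) \<le> r2"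
      using assms by (auto simp: pos_def)
    have "norm (of_real (r1 + r2 - (c + c)) :: 'b) = norm ((of_real r1 - (of_real c + h)) + (of_real r2 - (of_real c - h)))"
      by (simp only: of_real_add of_real_diff *)
    also have "\<dots> \<le> r1 + r2" using r norm_triangle_mono by blast
    finally have "r1 + r2 - (c + c) \<le> r1 + r2" by (simp only: norm_of_real)
    then show False using \<open>\<not> 0 \<le> c + e\<close> e by auto
  qed
  have "adj u * adj u + u * u = (2::real) *\<^sub>R (k * k - l * l)"
    unfolding au by (simp add: u_def algebra_simps scaleC_mult_left scaleC_mult_right scaleC_scaleC scaleC_diff_right scaleC_add_right scaleR_2)
  also have "k * k - l * l = 2 *\<^sub>R h"
    by (simp add: k l scaleR_2)
  finally have "4 * norm h = norm (adj u * adj u + u * u)"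
    by simp
  also have "\<dots> \<le> norm u * norm u + norm u * norm u"
    by (metis add_mono norm_adj norm_mult_ineq norm_triangle_le)
  also have "\<dots> = 4 * (c + e)"
    using nu c by (simp add: power2_eq_square)
  finally show "norm h \<le> c + e" by simp
qed

text \<open>After scaling to norm less than 1, u = sqrt(1 - z) + i l with l * l = z satisfies
  \<open>adj u * u\<close> = 1. Its real part sqrt(1 - z) thus has norm at most 1, and so has its
  square 1 - z.\<close>

lemma pos_square:
  assumes "adj (k::'b::cstar_algebra) = k"
  shows "pos (k * k)"
proof -
  define r where "r = (norm k)\<^sup>2 + 1"
  have r: "0 < r" by (simp add: r_def add_nonneg_pos)
  define z where "z = (1 / r) *\<^sub>R (k * k)"
  have "norm z = (norm k)\<^sup>2 / r"
    using r by (simp add: z_def norm_selfadjoint_power2[OF assms])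
  also have "\<dots> < 1" by (simp add: r_def add_nonneg_pos)
  finally have "norm z < 1" .
  moreover have "adj z = z" by (simp add: z_def adj_scaleR adj_mult assms)
  ultimately obtain q where q: "q * q = 1 - z" "adj q = q" "\<forall>x. x * z = z * x \<longrightarrow> x * q = q * x"
    using ex_sqrt_one_minus by blast
  define l where "l = (1 / sqrt r) *\<^sub>R k"
  have ll: "l * l = z" "adj l = l" using r by (auto simp: l_def z_def adj_scaleR assms)
  have "l * q = q * l" by (rule q(3)[rule_format]) (simp add: ll(1)[symmetric] mult.assoc)
  define u where "u = q + scaleC \<i> l"
  have au: "adj u = q - scaleC \<i> l"
    by (simp add: u_def adj_add adj_scaleC q ll scaleC_minus_left)
  have "(norm u)\<^sup>2 = 1"
    using norm_cartesian[OF q(2) ll(2)] \<open>l * q = q * l\<close> by (simp add: u_def q ll)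
  then have nu: "norm u = 1" by (simp add: power2_eq_1_iff) (metis norm_ge_zero neg_0_le_iff_le not_one_le_zero)
  have "2 * norm q = norm (adj u + u)"
    unfolding au by (simp add: u_def flip: scaleR_2)
  also have "\<dots> \<le> 2" using norm_triangle_ineq[of "adj u" u] nu by simp
  finally have "norm q \<le> 1" by simp
  then have "norm (1 - z) \<le> 1"
    using norm_selfadjoint_power2[OF q(2)] q(1) by (simp add: power_le_one)
  moreover have "of_real r - k * k = r *\<^sub>R (1 - z)"
    using r by (simp add: z_def of_real_def scaleR_diff_right)
  ultimately have "norm (of_real r - k * k) \<le> r"
    using r by (simp add: mult_left_le)
  then show ?thesis
    using r assms by (auto simp: pos_def adj_mult intro!: exI[of _ r])
qed

text \<open>With h = s - a both s + h and s - h = a are positive. The radius in \<open>pos\<close>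
  may thus be any bound of the norm, the same for a whole bounded family.\<close>

lemma norm_diff_le_of_pos:
  assumes "pos a" "norm a \<le> s"
  shows "norm (of_real s - (a::'b::cstar_algebra)) \<le> s"
proof (rule norm_le_of_pos_diff_add)
  have "pos (of_real (s - norm a) + (of_real (norm a) - a))"
  proof (rule pos_add)
    show "pos (of_real (norm a) - a)"
      using assms by (auto simp: pos_def adj_diff intro!: exI[of _ "norm a"])
    show "pos (of_real (s - norm a))" using assms by (intro pos_of_real) simp
  qed
  then have "pos (of_real s - a)" by simp
  moreover have "0 \<le> s" using assms norm_ge_zero order_trans by blast
  ultimately show "pos (of_real s + (of_real s - a))"
    by (intro pos_add pos_of_real)
  show "pos (of_real s - (of_real s - a))" using assms by simp
qed

lemma pos_iff_norm:
  assumes "norm a \<le> s"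
  shows "pos (a::'b::cstar_algebra) \<longleftrightarrow> adj a = a \<and> norm (of_real s - a) \<le> s"
proof -
  have "0 \<le> s" using assms norm_ge_zero order_trans by blast
  then show ?thesis using assms norm_diff_le_of_pos[of a s] by (auto simp: pos_def)
qed

lemma pos_of_real_minus:
  assumes "adj a = a" "norm (a::'b::cstar_algebra) \<le> s"
  shows "pos (of_real s - a)"
  using assms norm_ge_zero[of a] by (auto simp: pos_def adj_diff intro!: exI[of _ s] simp del: norm_ge_zero)

text \<open>One radius \<open>s\<close> serves all e < 1, and with a fixed radius the two conditions
  of \<open>pos\<close> are closed. This discards the shifts that square roots introduce.\<close>

lemma pos_limit:
  assumes "\<And>e. 0 < e \<Longrightarrow> pos (a + e *\<^sub>R (b::'b::cstar_algebra))"
  shows "pos a"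
proof -
  define s where "s = norm a + norm b"
  have lim: "((\<lambda>e. a + e *\<^sub>R b) \<longlongrightarrow> a + 0 *\<^sub>R b) (at_right 0)"
    by (intro tendsto_intros)
  have ev: "\<forall>\<^sub>F e::real in at_right 0. 0 < e \<and> e < 1"
    using eventually_at_right_real[of 0 "1::real"] by simp
  have *: "adj (a + e *\<^sub>R b) = a + e *\<^sub>R b \<and> norm (of_real s - (a + e *\<^sub>R b)) \<le> s" if "0 < e" "e < 1" for e
  proof -
    have "norm (a + e *\<^sub>R b) \<le> norm a + e * norm b"
      by (rule norm_triangle_le) (use that in auto)
    also have "\<dots> \<le> s" using that by (simp add: s_def mult_left_le_one_le)
    finally show ?thesis using assms[OF that(1)] pos_iff_norm by blast
  qed
  have "((\<lambda>e. adj (a + e *\<^sub>R b)) \<longlongrightarrow> adj (a + 0 *\<^sub>R b)) (at_right 0)"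
    by (intro tendsto_intros lim)
  moreover have "((\<lambda>e. adj (a + e *\<^sub>R b)) \<longlongrightarrow> a + 0 *\<^sub>R b) (at_right 0)"
    by (rule Lim_transform_eventually[OF lim]) (rule eventually_mono[OF ev], use * in auto)
  ultimately have "adj a = a"
    using tendsto_unique[OF trivial_limit_at_right_real] by fastforce
  moreover have "norm (of_real s - (a + 0 *\<^sub>R b)) \<le> s"
    by (rule tendsto_upperbound[OF tendsto_norm[OF tendsto_diff[OF tendsto_const lim]] _ trivial_limit_at_right_real])
      (rule eventually_mono[OF ev], use * in auto)
  moreover have "0 \<le> s" by (simp add: s_def)
  ultimately show ?thesis by (auto simp: pos_def)
qed

lemma norm_mono_pos:
  assumes "pos a" "pos (b - (a::'b::cstar_algebra))"
  shows "norm a \<le> norm b"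
proof (rule norm_le_of_pos_diff_add)
  show "pos (of_real (norm b) + a)"
    by (intro pos_add pos_of_real assms norm_ge_zero)
  have "adj b = b" using pos_add[OF assms] by (simp add: pos_def)
  then have "pos ((of_real (norm b) - b) + (b - a))"
    by (intro pos_add assms pos_of_real_minus) auto
  then show "pos (of_real (norm b) - a)" by simp
qed

section \<open>Positivity of \<open>adj b * b\<close>\<close>

text \<open>
  The spectra of \<open>c\<^sup>* c\<close> and \<open>c c\<^sup>*\<close> agree off \<open>0\<close>; the growth of the powers
  \<open>(s + c c\<^sup>*)\<^sup>n\<close>, which differ from \<open>s\<^sup>n\<close> by \<open>c q(c\<^sup>* c) c\<^sup>*\<close> for a polynomial \<open>q\<close>,
  gives what is needed of this without spectral theory.
\<close>

lemma power_add_mult_swap: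
  fixes c d :: "'b::cstar_algebra"
  shows "(of_real s + c * d) ^ n =
    of_real s ^ n + c * (\<Sum>i<n. of_real s ^ (n - Suc i) * (of_real s + d * c) ^ i) * d"
proof (induction n)
  case (Suc n)
  let ?S = "\<lambda>n. (\<Sum>i<n. of_real s ^ (n - Suc i) * (of_real s + d * c) ^ i)"
  have comm: "of_real r * x = x * of_real r" for r and x :: 'b
    by (rule of_real_mult_commute)
  have pw: "(of_real s + c * d) * c = c * (of_real s + d * c)"
    by (simp add: algebra_simps comm)
  have pwn: "(of_real s + c * d) ^ n * c = c * (of_real s + d * c) ^ n" for n
  proof (induction n)
    case (Suc n)
    show ?case by (metis Suc mult.assoc power_Suc2 pw)
  qed simp
  have S: "?S (Suc n) = of_real s * ?S n + (of_real s + d * c) ^ n"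
  proof -
    have "(\<Sum>i<n. of_real s ^ (Suc n - Suc i) * (of_real s + d * c) ^ i) =
        (\<Sum>i<n. of_real s * (of_real s ^ (n - Suc i) * (of_real s + d * c) ^ i))"
    proof (intro sum.cong refl)
      fix i assume "i \<in> {..<n}"
      then have "Suc n - Suc i = Suc (n - Suc i)" by auto
      then show "of_real s ^ (Suc n - Suc i) * (of_real s + d * c) ^ i =
         of_real s * (of_real s ^ (n - Suc i) * (of_real s + d * c) ^ i)"
        by (simp add: mult.assoc)
    qed
    then show ?thesis by (simp add: sum_distrib_left)
  qed
  have "(of_real s + c * d) ^ Suc n = (of_real s + c * d) ^ n * of_real s + (of_real s + c * d) ^ n * c * d"
    by (simp add: power_Suc2 distrib_left mult.assoc del: power_Suc)
  also have "\<dots> = of_real s * (of_real s ^ n + c * ?S n * d) + c * (of_real s + d * c) ^ n * d"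
    unfolding pwn unfolding Suc.IH comm[of s, symmetric] ..
  also have "\<dots> = of_real s ^ Suc n + c * (of_real s * ?S n + (of_real s + d * c) ^ n) * d"
    by (simp add: distrib_left distrib_right mult.assoc) (simp add: comm[of s] mult.assoc)
  finally show ?case by (simp only: S)
qed simp

text \<open>If B < A, the powers of some ratio x > 1 would grow only linearly in the
  exponent.\<close>

lemma power_bound_linear:
  assumes "0 \<le> (A::real)" "0 \<le> B" "0 \<le> C" and bd: "\<And>n. A ^ (2 ^ n) \<le> B ^ (2 ^ n) + C * 2 ^ n * B ^ (2 ^ n - 1)"
  shows "A \<le> B"
proof (rule ccontr)
  assume "\<not> A \<le> B"
  then have AB: "B < A" by simp
  define x where "x = A / ((A + B) / 2)"
  \<comment> \<open>A number strictly between \<open>B\<close> and \<open>A\<close>: unlike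
    \<open>B\<close> it is positive even when B = 0, so one may divide by it.\<close>
  define D where "D = (A + B) / 2"
  have D: "0 < D" "B < D" "D < A" using AB assms by (auto simp: D_def)
  have x: "1 < x" using D by (simp add: x_def D_def[symmetric])
  have "x ^ (2 ^ n) \<le> 1 + (C / D) * 2 ^ n" for n
  proof -
    have "A ^ (2 ^ n) \<le> D ^ (2 ^ n) + C * 2 ^ n * D ^ (2 ^ n - 1)"
      by (rule order_trans[OF bd]) (intro add_mono mult_left_mono power_mono; use D assms in simp)
    also have "D ^ (2 ^ n - 1) = D ^ (2 ^ n) / D"
      using D by (simp add: power_diff)
    finally have "A ^ (2 ^ n) / D ^ (2 ^ n) \<le> (D ^ (2 ^ n) + C * 2 ^ n * (D ^ (2 ^ n) / D)) / D ^ (2 ^ n)"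
      using D by (intro divide_right_mono) auto
    also have "\<dots> = 1 + (C / D) * 2 ^ n"
      using D by (simp add: field_simps)
    finally show ?thesis by (simp add: x_def D_def power_divide)
  qed
  then have bd: "x ^ (2 ^ n) \<le> 1 + (C / D) * 2 ^ n" for n .
  have "((\<lambda>n. (1 + (C / D) * real n) / x ^ n) \<longlongrightarrow> 0) sequentially"
  proof -
    have "(\<lambda>n. 1 * (inverse x) ^ n + (C / D) * (real n * inverse x ^ n)) \<longlonglongrightarrow> 1 * 0 + (C / D) * 0"
      using x by (intro tendsto_intros LIMSEQ_realpow_zero powser_times_n_limit_0) (auto simp: inverse_less_1_iff)
    then show ?thesis by (simp add: divide_inverse power_inverse algebra_simps)
  qed
  then have "\<forall>\<^sub>F n in sequentially. (1 + (C / D) * real n) / x ^ n < 1"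
    by (rule order_tendstoD) simp
  then obtain N where N: "\<And>n. N \<le> n \<Longrightarrow> (1 + (C / D) * real n) / x ^ n < 1"
    by (auto simp: eventually_sequentially)
  \<comment> \<open>The limit holds along all exponents but is needed at a dyadic one, where
    \<open>bd\<close> speaks.\<close>
  have "N \<le> 2 ^ N" by (simp add: less_imp_le)
  from N[OF this] have "1 + (C / D) * 2 ^ N < x ^ (2 ^ N)"
    using x by (simp add: field_simps)
  with bd[of N] show False by simp
qed

text \<open>The sum in \<open>power_add_mult_swap\<close> has N terms of norm at most B^(N - 1), so
  it costs only a factor linear in N. The \<open>max\<close> accounts for the value 0, which may be
  in one spectrum only.\<close>

lemma norm_add_mult_adj_swap:
  assumes "0 \<le> s"
  shows "norm (of_real s + c * adj c) \<le> max s (norm (of_real s + adj c * (c::'b::cstar_algebra)))"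
    (is "?A \<le> ?B")
proof (rule power_bound_linear[where C = "norm c * norm c"])
  fix n :: nat
  define N where "N = (2::nat) ^ n"
  let ?x = "of_real s + adj c * c"
  have 1: "?A ^ N = norm ((of_real s + c * adj c) ^ N)"
    unfolding N_def by (rule norm_selfadjoint_pow_pow2[symmetric]) (simp add: adj_add adj_mult adj_adj)
  have 2: "norm ((of_real s + c * adj c) ^ N) \<le> norm (of_real s ^ N :: 'b) + norm (c * (\<Sum>i<N. of_real s ^ (N - Suc i) * ?x ^ i) * adj c)"
    by (subst power_add_mult_swap) (rule norm_triangle_ineq)
  have 3: "norm (of_real s ^ N :: 'b) \<le> ?B ^ N"
    unfolding of_real_power[symmetric] norm_of_real power_abs by (rule power_mono) (use assms in auto)
  have 4: "norm (c * (\<Sum>i<N. of_real s ^ (N - Suc i) * ?x ^ i) * adj c)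
      \<le> norm c * norm (\<Sum>i<N. of_real s ^ (N - Suc i) * ?x ^ i) * norm (adj c)"
    by (rule order_trans[OF norm_mult_ineq]) (intro mult_right_mono norm_mult_ineq norm_ge_zero)
  have 5: "norm (\<Sum>i<N. of_real s ^ (N - Suc i) * ?x ^ i) \<le> of_nat (card {..<N}) * ?B ^ (N - 1)"
  proof (rule sum_norm_bound)
    fix i assume i: "i \<in> {..<N}"
    have "norm (of_real s ^ (N - Suc i) * ?x ^ i) \<le> norm (of_real s :: 'b) ^ (N - Suc i) * norm ?x ^ i"
      by (rule order_trans[OF norm_mult_ineq]) (intro mult_mono norm_power_ineq; simp)
    also have "\<dots> \<le> ?B ^ (N - Suc i) * ?B ^ i"
      using assms by (intro mult_mono power_mono) auto
    also have "\<dots> = ?B ^ (N - 1)"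
      using i by (simp flip: power_add)
    finally show "norm (of_real s ^ (N - Suc i) * ?x ^ i) \<le> ?B ^ (N - 1)" .
  qed
  have "norm c * norm (\<Sum>i<N. of_real s ^ (N - Suc i) * ?x ^ i) * norm (adj c)
      \<le> norm c * (of_nat (card {..<N}) * ?B ^ (N - 1)) * norm (adj c)"
    by (intro mult_right_mono mult_left_mono 5 norm_ge_zero)
  with 1 2 3 4 have "?A ^ N \<le> ?B ^ N + norm c * (of_nat (card {..<N}) * ?B ^ (N - 1)) * norm (adj c)"
    by linarith
  then show "?A ^ (2 ^ n) \<le> ?B ^ (2 ^ n) + norm c * norm c * 2 ^ n * ?B ^ (2 ^ n - 1)"
    by (simp add: N_def mult_ac)
qed (use assms in auto)

text \<open>Up to the factor 2 this is the sum of the squares of the self-adjoint elements c +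
  \<open>adj c\<close> and i(c - \<open>adj c\<close>).\<close>

lemma pos_adj_mult_self_add:
  "pos (adj c * c + c * adj (c::'b::cstar_algebra))"
proof -
  let ?p = "c + adj c" and ?q = "scaleC \<i> (c - adj c)"
  have q: "adj ?q = ?q" by (simp add: adj_scaleC adj_diff adj_adj scaleC_minus_left scaleC_diff_right)
  have p: "adj ?p = ?p" by (simp add: adj_add adj_adj)
  have "?p * ?p + ?q * ?q = (2::real) *\<^sub>R (adj c * c + c * adj c)"
    by (simp add: scaleC_mult_left scaleC_mult_right scaleC_scaleC scaleR_2) (simp add: algebra_simps)
  then have "(1/2) *\<^sub>R (?p * ?p + ?q * ?q) = adj c * c + c * adj c"
    by simp
  moreover have "pos ((1/2) *\<^sub>R (?p * ?p + ?q * ?q))"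
    by (intro pos_scaleR pos_add pos_square p q) simp
  ultimately show ?thesis by simp
qed

text \<open>A lower bound for \<open>adj c * c\<close> is missing, its positivity not being
  available yet. Swapping the factors gives 1 - \<open>c * adj c\<close> positive; adding
  \<open>pos_adj_mult_self_add\<close> yields 1 + \<open>adj c * c\<close> positive, which is
  enough.\<close>

lemma norm_le_one_of_pos:
  assumes "pos (1 - adj c * (c::'b::cstar_algebra))"
  shows "norm c \<le> 1"
proof -
  define s where "s = norm (1 - adj c * c) + 1"
  have s: "1 \<le> s" by (simp add: s_def)
  have "norm (of_real s - (1 - adj c * c)) \<le> s"
    by (rule norm_diff_le_of_pos[OF assms]) (simp add: s_def)
  then have "norm (of_real (s - 1) + adj c * c) \<le> s"
    by (simp add: algebra_simps)
  then have "norm (of_real (s - 1) + c * adj c) \<le> s"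
    using norm_add_mult_adj_swap[of "s - 1" c] s by (simp only: max_def) (auto split: if_splits)
  then have "norm (of_real s - (1 - c * adj c)) \<le> s"
    by (simp add: algebra_simps)
  then have "pos (1 - c * adj c)"
    using s by (auto simp: pos_def adj_diff adj_mult adj_adj intro!: exI[of _ s])
  from pos_add[OF pos_adj_mult_self_add[of c] this] have "pos (of_real 1 + adj c * c)"
    by (simp add: algebra_simps)
  then have "norm (adj c * c) \<le> 1"
    using assms by (intro norm_le_of_pos_diff_add) auto
  then show ?thesis by (simp add: norm_adj_mult_self abs_square_le_1)
qed

text \<open>
  The substitution \<open>h \<mapsto> 4h(1 - h)\<close> preserves the set of the \<open>h = b\<^sup>* b\<close> of norm at most \<open>1\<close>
  and quadruples, at least, the distance of the spectrum from \<open>[0, 1]\<close>.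
\<close>

lemma norm_one_minus_adj_mult_self:
  assumes "norm (b::'b::cstar_algebra) \<le> 1"
  shows "norm (1 - adj b * b) \<le> 1 + 1 / 4 ^ n"
  using assms
proof (induction n arbitrary: b)
  case 0
  have "norm (adj b * b) \<le> 1" using 0 by (simp add: norm_adj_mult_self power_le_one)
  then show ?case using norm_triangle_ineq4[of 1 "adj b * b"] by simp
next
  case (Suc n)
  have *: "norm (1 - adj b * b) \<le> 1 + 1 / 4 ^ Suc n" if b: "norm b < 1" for b :: 'b
  proof -
    define h where "h = adj b * b"
    have h: "adj h = h" by (simp add: h_def adj_mult adj_adj)
    have "norm h < 1" using b by (simp add: h_def norm_adj_mult_self power_less_one_iff abs_square_less_1)
    then obtain q where q: "q * q = 1 - h" "adj q = q" "\<forall>x. x * h = h * x \<longrightarrow> x * q = q * x"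
      using ex_sqrt_one_minus h by blast
    have hq: "h * q = q * h" using q(3) by blast
    \<comment> \<open>Chosen so that \<open>adj c * c\<close> = 4h(1 - h), of the same form as
      \<open>h\<close>. Since 1 - 4h(1 - h) is the square of 1 - 2h, the induction hypothesis
      applies to \<open>c\<close>.\<close>
    define c where "c = 2 *\<^sub>R (b * q)"
    have "adj c * c = 4 *\<^sub>R (q * (h * q))"
      by (simp add: c_def adj_scaleR adj_mult q h_def mult.assoc)
    also have "\<dots> = 4 *\<^sub>R (h * (1 - h))"
      by (metis hq mult.assoc q(1))
    finally have cc: "adj c * c = 4 *\<^sub>R (h * (1 - h))" .
    have sq: "1 - adj c * c = (1 - 2 *\<^sub>R h) * (1 - 2 *\<^sub>R h)"
      unfolding cc by (simp add: algebra_simps) (simp add: scaleR_2[symmetric])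
    have sa: "adj (1 - 2 *\<^sub>R h) = 1 - 2 *\<^sub>R h" by (simp add: adj_diff adj_scaleR h)
    have "pos (1 - adj c * c)"
      unfolding sq by (rule pos_square[OF sa])
    then have "norm c \<le> 1" by (rule norm_le_one_of_pos)
    then have "norm (1 - adj c * c) \<le> 1 + 1 / 4 ^ n" by (rule Suc.IH)
    then have n2: "(norm (1 - 2 *\<^sub>R h))\<^sup>2 \<le> 1 + 1 / 4 ^ n"
      unfolding sq norm_selfadjoint_power2[OF sa] .
    have "norm (2 *\<^sub>R (1 - h)) \<le> norm (1 - 2 *\<^sub>R h) + norm (1::'b)"
      by (rule order_trans[OF _ norm_triangle_ineq]) (simp add: algebra_simps scaleR_2)
    then have nh: "2 * norm (1 - h) - 1 \<le> norm (1 - 2 *\<^sub>R h)"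
      by simp
    show ?thesis
    proof (cases "1 \<le> norm (1 - h)")
      case True
      define d where "d = norm (1 - h) - 1"
      have "(1 + 2 * d)\<^sup>2 \<le> (norm (1 - 2 *\<^sub>R h))\<^sup>2"
        using True nh by (intro power_mono) (auto simp: d_def)
      then have "1 + 4 * d + 4 * d\<^sup>2 \<le> 1 + 1 / 4 ^ n"
        using n2 by (simp add: power2_eq_square algebra_simps)
      then have "4 * d \<le> 1 / 4 ^ n"
        using zero_le_power2[of d] by linarith
      then show ?thesis by (simp add: d_def h_def)
    next
      case False
      have "(0::real) \<le> 1 / 4 ^ Suc n" by simp
      then show ?thesis using False unfolding h_def by linarith
    qed
  qed
  \<comment> \<open>The root of 1 - h needs norm b < 1; the boundary case follows by scaling
    \<open>b\<close> with r -> 1.\<close>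
  have lim: "((\<lambda>r. norm (1 - adj (r *\<^sub>R b) * (r *\<^sub>R b))) \<longlongrightarrow> norm (1 - adj (1 *\<^sub>R b) * (1 *\<^sub>R b))) (at_left 1)"
    by (intro tendsto_intros)
  have "norm (1 - adj (1 *\<^sub>R b) * (1 *\<^sub>R b)) \<le> 1 + 1 / 4 ^ Suc n"
  proof (rule tendsto_upperbound[OF lim])
    have "\<forall>\<^sub>F r::real in at_left 1. 0 < r \<and> r < 1"
      using eventually_at_left_real[of 0 "1::real"] by simp
    then show "\<forall>\<^sub>F r in at_left 1. norm (1 - adj (r *\<^sub>R b) * (r *\<^sub>R b)) \<le> 1 + 1 / 4 ^ Suc n"
    proof (rule eventually_mono)
      fix r :: real assume r: "0 < r \<and> r < 1"
      then have "norm (r *\<^sub>R b) \<le> r * 1"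
        using Suc.prems by (simp add: mult_left_le)
      with r have "norm (r *\<^sub>R b) < 1" by linarith
      then show "norm (1 - adj (r *\<^sub>R b) * (r *\<^sub>R b)) \<le> 1 + 1 / 4 ^ Suc n"
        by (rule *)
    qed
  qed simp
  then show ?case by simp
qed

text \<open>The defect 4^(-n) vanishes in the limit. This connects \<open>cstar_nonneg\<close>, the
  positivity of the module axioms, with \<open>pos\<close>.\<close>

lemma pos_adj_mult_self: "pos (adj b * (b::'b::cstar_algebra))"
proof -
  define r where "r = norm b + 1"
  have r: "0 < r" by (simp add: r_def add_nonneg_pos)
  define c where "c = (1 / r) *\<^sub>R b"
  have c: "norm c \<le> 1" using r by (simp add: c_def) (simp add: r_def)
  have lim: "(\<lambda>n. 1 + 1 / 4 ^ n :: real) \<longlonglongrightarrow> 1 + 0"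
    using LIMSEQ_inverse_realpow_zero[of 4] by (intro tendsto_add) (auto simp: inverse_eq_divide)
  have "norm (1 - adj c * c) \<le> 1 + 0"
    by (rule LIMSEQ_le_const[OF lim]) (use norm_one_minus_adj_mult_self[OF c] in blast)
  then have "pos (adj c * c)"
    by (auto simp: pos_def adj_mult adj_adj intro!: exI[of _ 1])
  then have "pos (r\<^sup>2 *\<^sub>R (adj c * c))" by (rule pos_scaleR) simp
  then show ?thesis using r by (simp add: c_def adj_scaleR power2_eq_square)
qed

text \<open>With k a self-adjoint root of p + e, the conjugate of p + e by \<open>c\<close> is
  \<open>adj (k * c) * (k * c)\<close>.\<close>

lemma pos_conjugate:
  assumes "pos p"
  shows "pos (adj c * p * (c::'b::cstar_algebra))"
proof (rule pos_limit[where b = "adj c * c"])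
  fix e :: real assume e: "0 < e"
  obtain k where k: "k * k = p + of_real e" "adj k = k"
    using ex_sqrt_pos[OF assms e] by blast
  have "pos (adj (k * c) * (k * c))" by (rule pos_adj_mult_self)
  also have "adj (k * c) * (k * c) = adj c * (k * k) * c"
    by (simp add: adj_mult k(2) mult.assoc)
  also have "\<dots> = adj c * p * c + e *\<^sub>R (adj c * c)"
    unfolding k by (simp add: distrib_left distrib_right of_real_def)
  finally show "pos (adj c * p * c + e *\<^sub>R (adj c * c))" .
qed

section \<open>Hilbert bimodules\<close>

definition mod_norm :: "('e, 'b::cstar_algebra, 'm) bimodule_scheme \<Rightarrow> 'e \<Rightarrow> real" where
  "mod_norm M x = sqrt (norm (ip M x x))"

text \<open>The operator \<K> for single vectors instead of units; this is needed because products
  along partitions do not form units.\<close>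

definition kap :: "('e, 'b::cstar_algebra, 'm) bimodule_scheme \<Rightarrow> 'e \<Rightarrow> 'e \<Rightarrow> 'b \<Rightarrow>\<^sub>L 'b" where
  "kap M u v = Blinfun (\<lambda>b. ip M u (lact M b v))"

lemma mod_norm_nonneg [simp]: "0 \<le> mod_norm M x"
  by (simp add: mod_norm_def)

lemma mod_norm_power2: "(mod_norm M x)\<^sup>2 = norm (ip M x x)"
  by (simp add: mod_norm_def)

context hilbert_bimodule
begin

lemma ip_add_left:
  assumes "x \<in> carrier M" "y \<in> carrier M" "z \<in> carrier M"
  shows "ip M (x \<oplus> y) z = ip M x z + ip M y z"
  using assms by (simp add: ip_adj[symmetric, of z] ip_add_right adj_add)

lemma ip_zero_right [simp]: "x \<in> carrier M \<Longrightarrow> ip M x \<zero> = 0"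
  using ip_add_right[of x \<zero> \<zero>] by simp

lemma ip_zero_left [simp]: "x \<in> carrier M \<Longrightarrow> ip M \<zero> x = 0"
  using ip_add_left[of \<zero> \<zero> x] by simp

lemma ip_uminus_right:
  "\<lbrakk>x \<in> carrier M; y \<in> carrier M\<rbrakk> \<Longrightarrow> ip M x (\<ominus> y) = - ip M x y"
  using ip_add_right[of x y "\<ominus> y"] by (simp add: r_neg add_eq_0_iff)

lemma ip_uminus_left:
  "\<lbrakk>x \<in> carrier M; y \<in> carrier M\<rbrakk> \<Longrightarrow> ip M (\<ominus> x) y = - ip M x y"
  using ip_add_left[of x "\<ominus> x" y] by (simp add: r_neg add_eq_0_iff)

lemma ip_diff_right:
  "\<lbrakk>x \<in> carrier M; y \<in> carrier M; z \<in> carrier M\<rbrakk> \<Longrightarrow> ip M x (y \<ominus> z) = ip M x y - ip M x z"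
  by (simp add: minus_eq ip_add_right ip_uminus_right)

lemma ip_diff_left:
  "\<lbrakk>x \<in> carrier M; y \<in> carrier M; z \<in> carrier M\<rbrakk> \<Longrightarrow> ip M (x \<ominus> y) z = ip M x z - ip M y z"
  by (simp add: minus_eq ip_add_left ip_uminus_left)

lemma ip_ract_left:
  assumes "x \<in> carrier M" "y \<in> carrier M"
  shows "ip M (ract M x b) y = adj b * ip M x y"
  using assms by (simp add: ip_adj[symmetric, of y] ip_ract_right ract_closed adj_mult)

lemma ip_lact_left:
  "\<lbrakk>x \<in> carrier M; y \<in> carrier M\<rbrakk> \<Longrightarrow> ip M (lact M b x) y = ip M x (lact M (adj b) y)"
  by (simp add: lact_adjoint adj_adj)

lemma ip_lact_add:
  "\<lbrakk>x \<in> carrier M; y \<in> carrier M\<rbrakk> \<Longrightarrow> ip M x (lact M (a + b) y) = ip M x (lact M a y) + ip M x (lact M b y)"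
  by (simp add: lact_add_left ip_add_right lact_closed)

lemma ip_lact_scaleR:
  assumes "x \<in> carrier M" "y \<in> carrier M"
  shows "ip M x (lact M (r *\<^sub>R b) y) = r *\<^sub>R ip M x (lact M b y)"
proof -
  have "lact M (r *\<^sub>R b) y = ract M (lact M b y) (scaleC (of_real r) 1)"
    using lact_scaleC[OF assms(2), of "of_real r" b] by (simp add: scaleC_of_real)
  then show ?thesis
    using assms by (simp add: ip_ract_right lact_closed scaleC_of_real)
qed

lemma pos_ip: "x \<in> carrier M \<Longrightarrow> pos (ip M x x)"
  using ip_nonneg[of x] pos_adj_mult_self by (auto simp: cstar_nonneg_def)

text \<open>Since <x, x> need not be invertible, it is replaced by a scalar s > 0 above its norm:
  for z = y - x c with c = <x, y> / s, the positive element <z, z> +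
  \<open>adj c * (s - <x, x>) * c\<close> equals <y, y> - \<open>adj a * a\<close> / s. Then s tends
  to the norm of <x, x>.\<close>

lemma norm_ip_le:
  assumes x: "x \<in> carrier M" and y: "y \<in> carrier M"
  shows "norm (ip M x y) \<le> mod_norm M x * mod_norm M y"
proof -
  define a where "a = ip M x y"
  have *: "(norm a)\<^sup>2 \<le> s * norm (ip M y y)" if s: "0 < s" "norm (ip M x x) \<le> s" for s
  proof -
    define c where "c = (1 / s) *\<^sub>R a"
    define z where "z = y \<ominus> ract M x c"
    have xc: "ract M x c \<in> carrier M" using x by (rule ract_closed)
    have yx: "ip M y x = adj a" using x y by (simp add: a_def ip_adj)
    have "ip M z z = ip M y y - adj a * c - (adj c * a - adj c * ip M x x * c)"
      using x y xc by (simp add: z_def ip_diff_left ip_diff_right ip_ract_left ip_ract_right yx a_def mult.assoc left_diff_distrib)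
    then have zz: "ip M z z = ip M y y - (1 / s) *\<^sub>R (adj a * a) - (1 / s) *\<^sub>R (adj a * a)
        + adj c * ip M x x * c"
      by (simp add: c_def adj_scaleR)
    have "s *\<^sub>R (adj c * c) = (1 / s) *\<^sub>R (adj a * a)"
      using s by (simp add: c_def adj_scaleR)
    then have "adj c * (of_real s - ip M x x) * c = (1 / s) *\<^sub>R (adj a * a) - adj c * ip M x x * c"
      by (simp add: algebra_simps of_real_def)
    then have "ip M z z + adj c * (of_real s - ip M x x) * c = ip M y y - (1 / s) *\<^sub>R (adj a * a)"
      by (simp add: zz)
    moreover have "pos (ip M z z + adj c * (of_real s - ip M x x) * c)"
      using x y xc s by (intro pos_add pos_conjugate pos_of_real_minus pos_ip) (auto simp: z_def ip_adj)
    ultimately have "pos (ip M y y - (1 / s) *\<^sub>R (adj a * a))"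
      by simp
    then have "norm ((1 / s) *\<^sub>R (adj a * a)) \<le> norm (ip M y y)"
      using s by (intro norm_mono_pos pos_scaleR pos_adj_mult_self) auto
    then show ?thesis
      using s by (simp add: norm_adj_mult_self field_simps)
  qed
  have "(norm a)\<^sup>2 \<le> norm (ip M x x) * norm (ip M y y)"
  proof (rule tendsto_lowerbound)
    show "((\<lambda>e. (norm (ip M x x) + e) * norm (ip M y y)) \<longlongrightarrow> norm (ip M x x) * norm (ip M y y)) (at_right 0)"
      by (auto intro!: tendsto_eq_intros)
    show "\<forall>\<^sub>F e in at_right 0. (norm a)\<^sup>2 \<le> (norm (ip M x x) + e) * norm (ip M y y)"
      using eventually_at_right_less[of "0::real"]
      by (rule eventually_mono) (intro *, simp_all add: add_nonneg_pos)
  qed simp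
  then have "(norm a)\<^sup>2 \<le> (mod_norm M x * mod_norm M y)\<^sup>2"
    by (simp add: power_mult_distrib mod_norm_power2)
  then show ?thesis
    unfolding a_def by (rule power2_le_imp_le) simp
qed

lemma mod_norm_eq_0: "x \<in> carrier M \<Longrightarrow> mod_norm M x = 0 \<longleftrightarrow> x = \<zero>"
  using ip_definite by (auto simp: mod_norm_def)

lemma mod_norm_add:
  assumes "x \<in> carrier M" "y \<in> carrier M"
  shows "mod_norm M (x \<oplus> y) \<le> mod_norm M x + mod_norm M y"
proof (rule power2_le_imp_le)
  have "norm (ip M (x \<oplus> y) (x \<oplus> y)) = norm (ip M x x + ip M x y + (ip M y x + ip M y y))"
    using assms by (simp add: ip_add_left ip_add_right algebra_simps)
  also have "\<dots> \<le> norm (ip M x x) + norm (ip M x y) + (norm (ip M y x) + norm (ip M y y))"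
    by (intro norm_triangle_le add_mono norm_triangle_ineq)
  also have "\<dots> \<le> (mod_norm M x)\<^sup>2 + mod_norm M x * mod_norm M y + (mod_norm M y * mod_norm M x + (mod_norm M y)\<^sup>2)"
    using assms by (intro add_mono norm_ip_le) (auto simp: mod_norm_power2)
  finally show "(mod_norm M (x \<oplus> y))\<^sup>2 \<le> (mod_norm M x + mod_norm M y)\<^sup>2"
    unfolding mod_norm_power2[of M "x \<oplus> y"] by (simp add: power2_eq_square algebra_simps)
qed simp

lemma mod_norm_uminus: "x \<in> carrier M \<Longrightarrow> mod_norm M (\<ominus> x) = mod_norm M x"
  by (simp add: mod_norm_def ip_uminus_right ip_uminus_left)

lemma minus_swap: "\<lbrakk>x \<in> carrier M; y \<in> carrier M\<rbrakk> \<Longrightarrow> \<ominus> (x \<ominus> y) = y \<ominus> x"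
  by (simp add: minus_eq minus_add a_comm)

lemma mod_norm_minus_commute:
  "\<lbrakk>x \<in> carrier M; y \<in> carrier M\<rbrakk> \<Longrightarrow> mod_norm M (x \<ominus> y) = mod_norm M (y \<ominus> x)"
  using mod_norm_uminus[of "x \<ominus> y"] minus_swap[of x y] by simp

lemma minus_plus_minus:
  "\<lbrakk>x \<in> carrier M; y \<in> carrier M; z \<in> carrier M\<rbrakk> \<Longrightarrow> (x \<ominus> y) \<oplus> (y \<ominus> z) = x \<ominus> z"
  by (simp add: minus_eq a_assoc r_neg1)

lemma mod_norm_triangle:
  "\<lbrakk>x \<in> carrier M; y \<in> carrier M; z \<in> carrier M\<rbrakk>
    \<Longrightarrow> mod_norm M (x \<ominus> z) \<le> mod_norm M (x \<ominus> y) + mod_norm M (y \<ominus> z)"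
  using mod_norm_add[of "x \<ominus> y" "y \<ominus> z"] by (simp add: minus_plus_minus)

lemma mod_norm_le_minus_add:
  "\<lbrakk>x \<in> carrier M; y \<in> carrier M\<rbrakk> \<Longrightarrow> mod_norm M x \<le> mod_norm M (x \<ominus> y) + mod_norm M y"
  using mod_norm_triangle[of x y \<zero>] minus_equality[of \<zero> \<zero>] by (simp add: minus_eq)

lemma minus_eq_zero_iff: "\<lbrakk>x \<in> carrier M; y \<in> carrier M\<rbrakk> \<Longrightarrow> x \<ominus> y = \<zero> \<longleftrightarrow> x = y"
  using minus_plus_minus[of x y \<zero>] by (auto simp: minus_eq r_neg)

lemma bimod_dist_eq:
  "\<lbrakk>x \<in> carrier M; y \<in> carrier M\<rbrakk> \<Longrightarrow> bimod_dist M x y = mod_norm M (x \<ominus> y)"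
  by (simp add: bimod_dist_def mod_norm_def)

sublocale metric: Metric_space "carrier M" "bimod_dist M"
proof
  fix x y
  show "0 \<le> bimod_dist M x y" by (simp add: bimod_dist_def)
  show "bimod_dist M x y = bimod_dist M y x"
    using mod_norm_minus_commute[of x y] by (auto simp: bimod_dist_def mod_norm_def)
  assume xy: "x \<in> carrier M" "y \<in> carrier M"
  then show "bimod_dist M x y = 0 \<longleftrightarrow> x = y"
    by (simp add: bimod_dist_eq mod_norm_eq_0 minus_eq_zero_iff)
  fix z assume "z \<in> carrier M"
  with xy show "bimod_dist M x z \<le> bimod_dist M x y + bimod_dist M y z"
    by (simp add: bimod_dist_eq mod_norm_triangle)
qed

lemma bimod_lim_eq:
  assumes "\<forall>\<^sub>F n in sequentially. X n \<in> carrier M" "x \<in> carrier M"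
    and "(\<lambda>n. mod_norm M (X n \<ominus> x)) \<longlonglongrightarrow> 0"
  shows "bimod_lim M X = x"
proof -
  have "limitin metric.mtopology X x sequentially"
    unfolding metric.limitin_metric
  proof (intro conjI allI impI)
    fix e :: real assume "0 < e"
    with assms(3) have "\<forall>\<^sub>F n in sequentially. mod_norm M (X n \<ominus> x) < e"
      by (rule order_tendstoD(2))
    with assms(1) show "\<forall>\<^sub>F n in sequentially. X n \<in> carrier M \<and> bimod_dist M (X n) x < e"
      by eventually_elim (simp add: bimod_dist_eq assms(2))
  qed (rule assms)
  then show ?thesis
    unfolding bimod_lim_def bimod_topology_def
    by (intro the_equality) (auto dest: metric.limitin_metric_unique)
qed

lemma mod_norm_complete:
  assumes "\<And>n. X n \<in> carrier M"
    and "\<And>e. 0 < e \<Longrightarrow> \<exists>N. \<forall>m\<ge>N. \<forall>n\<ge>N. mod_norm M (X m \<ominus> X n) < e"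
  obtains x where "x \<in> carrier M" "(\<lambda>n. mod_norm M (X n \<ominus> x)) \<longlonglongrightarrow> 0"
proof -
  have "metric.MCauchy X"
    unfolding metric.MCauchy_def using assms by (fastforce simp: bimod_dist_eq)
  then obtain x where x: "limitin metric.mtopology X x sequentially"
    using complete unfolding metric.mcomplete_def by blast
  then have xc: "x \<in> carrier M" by (rule metric.limitin_mspace)
  have "(\<lambda>n. mod_norm M (X n \<ominus> x)) \<longlonglongrightarrow> 0"
  proof (rule tendstoI)
    fix e :: real assume "0 < e"
    then have "\<forall>\<^sub>F n in sequentially. X n \<in> carrier M \<and> bimod_dist M (X n) x < e"
      using x unfolding metric.limitin_metric by blast
    then show "\<forall>\<^sub>F n in sequentially. dist (mod_norm M (X n \<ominus> x)) 0 < e"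
      by eventually_elim (auto simp: bimod_dist_eq xc)
  qed
  with xc show ?thesis using that by blast
qed

text \<open>With \<open>k\<close> a self-adjoint root of (norm b)^2 - \<open>adj b * b\<close> + e
  one has <b x, b x> + <k x, k x> = ((norm b)^2 + e) <x, x>, and the second summand is
  positive.\<close>

lemma mod_norm_lact:
  assumes "x \<in> carrier M"
  shows "mod_norm M (lact M b x) \<le> norm b * mod_norm M x"
proof -
  have eq: "ip M (lact M c x) (lact M c x) = ip M x (lact M (adj c * c) x)" for c
    using assms by (simp add: ip_lact_left lact_closed lact_mult)
  have *: "norm (ip M (lact M b x) (lact M b x)) \<le> ((norm b)\<^sup>2 + e) * norm (ip M x x)" if e: "0 < e" for e
  proof -
    have "pos (of_real ((norm b)\<^sup>2) - adj b * b)"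
      by (intro pos_of_real_minus) (auto simp: adj_mult adj_adj norm_adj_mult_self)
    then obtain k where k: "k * k = of_real ((norm b)\<^sup>2) - adj b * b + of_real e" "adj k = k"
      using e by (rule ex_sqrt_pos)
    have sum: "k * k + adj b * b = ((norm b)\<^sup>2 + e) *\<^sub>R 1"
      by (simp add: k of_real_def scaleR_left_distrib)
    have "ip M (lact M k x) (lact M k x) + ip M (lact M b x) (lact M b x) = ip M x (lact M (((norm b)\<^sup>2 + e) *\<^sub>R 1) x)"
      unfolding eq k(2) sum[symmetric] using assms by (simp add: ip_lact_add)
    also have "\<dots> = ((norm b)\<^sup>2 + e) *\<^sub>R ip M x x"
      using assms by (simp only: ip_lact_scaleR lact_one)
    finally have "pos (((norm b)\<^sup>2 + e) *\<^sub>R ip M x x - ip M (lact M b x) (lact M b x))"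
      using pos_ip[OF lact_closed[OF assms], of k] by (simp add: eq_diff_eq[symmetric])
    then have "norm (ip M (lact M b x) (lact M b x)) \<le> norm (((norm b)\<^sup>2 + e) *\<^sub>R ip M x x)"
      by (intro norm_mono_pos pos_ip lact_closed assms)
    then show ?thesis using e by simp
  qed
  have "norm (ip M (lact M b x) (lact M b x)) \<le> (norm b)\<^sup>2 * norm (ip M x x)"
  proof (rule tendsto_lowerbound)
    show "((\<lambda>e. ((norm b)\<^sup>2 + e) * norm (ip M x x)) \<longlongrightarrow> (norm b)\<^sup>2 * norm (ip M x x)) (at_right 0)"
      by (auto intro!: tendsto_eq_intros)
    show "\<forall>\<^sub>F e in at_right 0. norm (ip M (lact M b x) (lact M b x)) \<le> ((norm b)\<^sup>2 + e) * norm (ip M x x)"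
      using eventually_at_right_less[of "0::real"] by (rule eventually_mono) (rule *)
  qed simp
  then have "(mod_norm M (lact M b x))\<^sup>2 \<le> (norm b * mod_norm M x)\<^sup>2"
    by (simp add: power_mult_distrib mod_norm_power2)
  then show ?thesis by (rule power2_le_imp_le) simp
qed

lemma norm_ip_lact_le:
  assumes "u \<in> carrier M" "v \<in> carrier M"
  shows "norm (ip M u (lact M b v)) \<le> mod_norm M u * mod_norm M v * norm b"
proof -
  have "norm (ip M u (lact M b v)) \<le> mod_norm M u * mod_norm M (lact M b v)"
    using assms by (intro norm_ip_le lact_closed)
  also have "\<dots> \<le> mod_norm M u * (norm b * mod_norm M v)"
    using assms by (intro mult_left_mono mod_norm_lact) auto
  finally show ?thesis by (simp add: mult_ac)
qed

lemma kap_apply: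
  assumes "u \<in> carrier M" "v \<in> carrier M"
  shows "kap M u v b = ip M u (lact M b v)"
proof -
  have "bounded_linear (\<lambda>b. ip M u (lact M b v))"
    using assms norm_ip_lact_le
    by (intro bounded_linear_intro[where K = "mod_norm M u * mod_norm M v"])
      (auto simp: ip_lact_add ip_lact_scaleR mult_ac)
  then show ?thesis by (simp add: kap_def bounded_linear_Blinfun_apply)
qed

lemma kap_apply_one: "\<lbrakk>u \<in> carrier M; v \<in> carrier M\<rbrakk> \<Longrightarrow> kap M u v 1 = ip M u v"
  by (simp add: kap_apply lact_one)

lemma norm_kap_le: "\<lbrakk>u \<in> carrier M; v \<in> carrier M\<rbrakk> \<Longrightarrow> norm (kap M u v) \<le> mod_norm M u * mod_norm M v"
  by (intro norm_blinfun_bound) (auto simp: kap_apply norm_ip_lact_le)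

lemma kap_add_left:
  "\<lbrakk>u \<in> carrier M; u' \<in> carrier M; v \<in> carrier M\<rbrakk> \<Longrightarrow> kap M (u \<oplus> u') v = kap M u v + kap M u' v"
  by (intro blinfun_eqI) (simp add: kap_apply ip_add_left lact_closed plus_blinfun.rep_eq)

lemma kap_add_right:
  "\<lbrakk>u \<in> carrier M; v \<in> carrier M; v' \<in> carrier M\<rbrakk> \<Longrightarrow> kap M u (v \<oplus> v') = kap M u v + kap M u v'"
  by (intro blinfun_eqI) (simp add: kap_apply ip_add_right lact_closed lact_add_right plus_blinfun.rep_eq)

lemma lact_zero_right: "lact M b \<zero> = \<zero>"
  using lact_add_right[of \<zero> \<zero> b] by (simp add: lact_closed)

lemma lact_minus_right: 
  "\<lbrakk>x \<in> carrier M; y \<in> carrier M\<rbrakk> \<Longrightarrow> lact M b (x \<ominus> y) = lact M b x \<ominus> lact M b y"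
proof -
  assume xy: "x \<in> carrier M" "y \<in> carrier M"
  have "lact M b y \<oplus> lact M b (\<ominus> y) = \<zero>"
    using xy lact_add_right[of y "\<ominus> y" b] by (simp add: lact_zero_right r_neg)
  then have "lact M b (\<ominus> y) = \<ominus> lact M b y"
    using xy by (intro minus_equality[symmetric]) (auto simp: a_comm lact_closed)
  then show ?thesis using xy by (simp add: minus_eq lact_add_right)
qed

lemma kap_diff_left:
  "\<lbrakk>u \<in> carrier M; u' \<in> carrier M; v \<in> carrier M\<rbrakk> \<Longrightarrow> kap M (u \<ominus> u') v = kap M u v - kap M u' v"
  by (intro blinfun_eqI) (simp add: kap_apply ip_diff_left lact_closed minus_blinfun.rep_eq)

lemma kap_diff_right:
  "\<lbrakk>u \<in> carrier M; v \<in> carrier M; v' \<in> carrier M\<rbrakk> \<Longrightarrow> kap M u (v \<ominus> v') = kap M u v - kap M u v'"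
  by (intro blinfun_eqI) (simp add: kap_apply ip_diff_right lact_closed lact_minus_right minus_blinfun.rep_eq)

lemma kap_lact_of_real_left:
  assumes "u \<in> carrier M" "v \<in> carrier M"
  shows "kap M (lact M (of_real r) u) v = r *\<^sub>R kap M u v"
proof (rule blinfun_eqI)
  fix b
  have "ip M u (lact M (of_real r) (lact M b v)) = r *\<^sub>R ip M u (lact M 1 (lact M b v))"
    unfolding of_real_def using assms by (intro ip_lact_scaleR lact_closed)
  then show "kap M (lact M (of_real r) u) v b = (r *\<^sub>R kap M u v) b"
    using assms by (simp add: kap_apply lact_closed ip_lact_left lact_one scaleR_blinfun.rep_eq)
qed

lemma kap_lact_of_real_right:
  assumes "u \<in> carrier M" "v \<in> carrier M"
  shows "kap M u (lact M (of_real r) v) = r *\<^sub>R kap M u v"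
proof (rule blinfun_eqI)
  fix b
  have "lact M b (lact M (of_real r) v) = lact M (r *\<^sub>R b) v"
    using assms by (simp add: lact_mult[symmetric] of_real_def)
  then show "kap M u (lact M (of_real r) v) b = (r *\<^sub>R kap M u v) b"
    using assms by (simp add: kap_apply lact_closed ip_lact_scaleR scaleR_blinfun.rep_eq)
qed

lemma kap_ract_left:
  "\<lbrakk>u \<in> carrier M; v \<in> carrier M\<rbrakk> \<Longrightarrow> kap M (ract M u c) v = blinfun_mult_right (adj c) o\<^sub>L kap M u v"
  by (intro blinfun_eqI) (simp add: kap_apply ip_ract_left ract_closed lact_closed)

lemma kap_ract_right:
  "\<lbrakk>u \<in> carrier M; v \<in> carrier M\<rbrakk> \<Longrightarrow> kap M u (ract M v c) = blinfun_mult_left c o\<^sub>L kap M u v"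
  by (intro blinfun_eqI) (simp add: kap_apply ip_ract_right ract_closed lact_closed lact_ract)

text \<open>The passage from operators to vectors on which all convergence and uniqueness rests.
  Three operators suffice, because <v, u> is the adjoint of <u, v>.\<close>

lemma mod_norm_minus_power2_le:
  assumes "u \<in> carrier M" "v \<in> carrier M"
  shows "(mod_norm M (u \<ominus> v))\<^sup>2 \<le> norm (kap M u u - kap M u v) + norm (kap M v v - kap M u v)"
proof -
  have "ip M (u \<ominus> v) (u \<ominus> v) = (kap M u u - kap M u v) 1 + adj ((kap M v v - kap M u v) 1)"
    using assms by (simp add: ip_diff_left ip_diff_right minus_blinfun.rep_eq kap_apply_one adj_diff ip_adj)
  then have "(mod_norm M (u \<ominus> v))\<^sup>2 \<le> norm ((kap M u u - kap M u v) 1) + norm ((kap M v v - kap M u v) 1)"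
    unfolding mod_norm_power2 by (metis norm_adj norm_triangle_ineq)
  also have "\<dots> \<le> norm (kap M u u - kap M u v) * norm (1::'b) + norm (kap M v v - kap M u v) * norm (1::'b)"
    by (intro add_mono norm_blinfun)
  finally show ?thesis by simp
qed

lemma tendsto_kap:
  assumes "\<And>n. U n \<in> carrier M" "u \<in> carrier M" "\<And>n. V n \<in> carrier M" "v \<in> carrier M"
    and "(\<lambda>n. mod_norm M (U n \<ominus> u)) \<longlonglongrightarrow> 0" "(\<lambda>n. mod_norm M (V n \<ominus> v)) \<longlonglongrightarrow> 0"
  shows "(\<lambda>n. kap M (U n) (V n)) \<longlonglongrightarrow> kap M u v"
proof -
  have "(\<lambda>n. kap M (U n) (V n) - kap M u v) \<longlonglongrightarrow> 0"
  proof (rule Lim_null_comparison)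
    show "\<forall>\<^sub>F n in sequentially. norm (kap M (U n) (V n) - kap M u v) \<le>
        mod_norm M (U n \<ominus> u) * (mod_norm M (V n \<ominus> v) + mod_norm M v) + mod_norm M u * mod_norm M (V n \<ominus> v)"
    proof (intro always_eventually allI)
      fix n
      have "kap M (U n) (V n) - kap M u v = kap M (U n \<ominus> u) (V n) + kap M u (V n \<ominus> v)"
        using assms by (simp add: kap_diff_left kap_diff_right)
      then have "norm (kap M (U n) (V n) - kap M u v) \<le>
          mod_norm M (U n \<ominus> u) * mod_norm M (V n) + mod_norm M u * mod_norm M (V n \<ominus> v)"
        using assms by (simp add: norm_kap_le norm_triangle_le add_mono)
      also have "\<dots> \<le> mod_norm M (U n \<ominus> u) * (mod_norm M (V n \<ominus> v) + mod_norm M v)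
          + mod_norm M u * mod_norm M (V n \<ominus> v)"
        using assms by (intro add_right_mono mult_left_mono mod_norm_le_minus_add) auto
      finally show "norm (kap M (U n) (V n) - kap M u v) \<le> \<dots>" .
    qed
    show "(\<lambda>n. mod_norm M (U n \<ominus> u) * (mod_norm M (V n \<ominus> v) + mod_norm M v) + mod_norm M u * mod_norm M (V n \<ominus> v)) \<longlonglongrightarrow> 0"
      using assms(5,6) by (auto intro!: tendsto_eq_intros)
  qed
  then show ?thesis by (simp add: LIM_zero_iff)
qed

end

section \<open>First order expansions at \<open>0\<close>\<close>

text \<open>
  The relation \<open>Q s X\<close> stands for a family of operators \<open>X\<close> at time \<open>s\<close>; the expansion
  \<open>X = id + s L + o(s)\<close> is uniform over that family.
\<close>

definition expansion :: "('a::real_normed_vector \<Rightarrow>\<^sub>L 'a) \<Rightarrow> (real \<Rightarrow> ('a \<Rightarrow>\<^sub>L 'a) \<Rightarrow> bool) \<Rightarrow> bool" where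
  "expansion L Q \<longleftrightarrow>
     (\<forall>e>0. \<exists>d>0. \<forall>s X. 0 \<le> s \<longrightarrow> s \<le> d \<longrightarrow> Q s X \<longrightarrow> norm (X - id_blinfun - s *\<^sub>R L) \<le> e * s)"

lemma expansionD:
  assumes "expansion L Q" "0 < e"
  obtains d where "0 < d" "\<And>s X. \<lbrakk>0 \<le> s; s \<le> d; Q s X\<rbrakk> \<Longrightarrow> norm (X - id_blinfun - s *\<^sub>R L) \<le> e * s"
  using assms unfolding expansion_def by meson

lemma expansion_mono:
  assumes "expansion L Q" "\<And>s X. \<lbrakk>0 \<le> s; Q' s X\<rbrakk> \<Longrightarrow> Q s X"
  shows "expansion L Q'"
  using assms unfolding expansion_def by meson

text \<open>Coefficients with sum 1 are exactly what keeps the constant term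
  \<open>id_blinfun\<close>.\<close>

lemma expansion_linear3:
  fixes r1 r2 r3 :: real
  assumes "expansion L1 Q1" "expansion L2 Q2" "expansion L3 Q3" and r: "r1 + r2 + r3 = 1"
  shows "expansion (r1 *\<^sub>R L1 + r2 *\<^sub>R L2 + r3 *\<^sub>R L3)
    (\<lambda>s X. \<exists>X1 X2 X3. Q1 s X1 \<and> Q2 s X2 \<and> Q3 s X3 \<and> X = r1 *\<^sub>R X1 + r2 *\<^sub>R X2 + r3 *\<^sub>R X3)"
  unfolding expansion_def
proof (intro allI impI)
  fix e :: real assume e: "0 < e"
  define R where "R = \<bar>r1\<bar> + \<bar>r2\<bar> + \<bar>r3\<bar>"
  have R: "0 < R" using r by (auto simp: R_def)
  define e' where "e' = e / R"
  have e': "0 < e'" using e R by (simp add: e'_def)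
  obtain d1 where d1: "0 < d1" "\<And>s X. \<lbrakk>0 \<le> s; s \<le> d1; Q1 s X\<rbrakk> \<Longrightarrow> norm (X - id_blinfun - s *\<^sub>R L1) \<le> e' * s"
    using expansionD[OF assms(1) e'] by blast
  obtain d2 where d2: "0 < d2" "\<And>s X. \<lbrakk>0 \<le> s; s \<le> d2; Q2 s X\<rbrakk> \<Longrightarrow> norm (X - id_blinfun - s *\<^sub>R L2) \<le> e' * s"
    using expansionD[OF assms(2) e'] by blast
  obtain d3 where d3: "0 < d3" "\<And>s X. \<lbrakk>0 \<le> s; s \<le> d3; Q3 s X\<rbrakk> \<Longrightarrow> norm (X - id_blinfun - s *\<^sub>R L3) \<le> e' * s"
    using expansionD[OF assms(3) e'] by blast
  show "\<exists>d>0. \<forall>s X. 0 \<le> s \<longrightarrow> s \<le> d \<longrightarrow>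
      (\<exists>X1 X2 X3. Q1 s X1 \<and> Q2 s X2 \<and> Q3 s X3 \<and> X = r1 *\<^sub>R X1 + r2 *\<^sub>R X2 + r3 *\<^sub>R X3) \<longrightarrow>
      norm (X - id_blinfun - s *\<^sub>R (r1 *\<^sub>R L1 + r2 *\<^sub>R L2 + r3 *\<^sub>R L3)) \<le> e * s"
  proof (rule exI[of _ "min d1 (min d2 d3)"], intro conjI allI impI)
    fix s X
    assume s: "0 \<le> s" "s \<le> min d1 (min d2 d3)"
      and "\<exists>X1 X2 X3. Q1 s X1 \<and> Q2 s X2 \<and> Q3 s X3 \<and> X = r1 *\<^sub>R X1 + r2 *\<^sub>R X2 + r3 *\<^sub>R X3"
    then obtain X1 X2 X3 where X: "Q1 s X1" "Q2 s X2" "Q3 s X3" "X = r1 *\<^sub>R X1 + r2 *\<^sub>R X2 + r3 *\<^sub>R X3"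
      by blast
    have id: "(id_blinfun :: 'a \<Rightarrow>\<^sub>L 'a) = r1 *\<^sub>R id_blinfun + r2 *\<^sub>R id_blinfun + r3 *\<^sub>R id_blinfun"
      by (simp add: r flip: scaleR_left_distrib)
    have "X - id_blinfun - s *\<^sub>R (r1 *\<^sub>R L1 + r2 *\<^sub>R L2 + r3 *\<^sub>R L3) =
        X - (r1 *\<^sub>R id_blinfun + r2 *\<^sub>R id_blinfun + r3 *\<^sub>R id_blinfun) - s *\<^sub>R (r1 *\<^sub>R L1 + r2 *\<^sub>R L2 + r3 *\<^sub>R L3)"
      by (simp only: id[symmetric])
    also have "\<dots> =
        r1 *\<^sub>R (X1 - id_blinfun - s *\<^sub>R L1) + r2 *\<^sub>R (X2 - id_blinfun - s *\<^sub>R L2) + r3 *\<^sub>R (X3 - id_blinfun - s *\<^sub>R L3)"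
      unfolding X(4) by (simp add: scaleR_right_diff_distrib scaleR_right_distrib mult.commute[of s])
    also have "norm \<dots> \<le> \<bar>r1\<bar> * norm (X1 - id_blinfun - s *\<^sub>R L1) + \<bar>r2\<bar> * norm (X2 - id_blinfun - s *\<^sub>R L2)
        + \<bar>r3\<bar> * norm (X3 - id_blinfun - s *\<^sub>R L3)"
      by (intro norm_triangle_le add_mono) auto
    also have "\<dots> \<le> \<bar>r1\<bar> * (e' * s) + \<bar>r2\<bar> * (e' * s) + \<bar>r3\<bar> * (e' * s)"
      using s X by (intro add_mono mult_left_mono d1 d2 d3) auto
    also have "\<dots> = (R * e') * s" by (simp add: R_def algebra_simps)
    also have "R * e' = e" using R by (simp add: e'_def)
    finally show "norm (X - id_blinfun - s *\<^sub>R (r1 *\<^sub>R L1 + r2 *\<^sub>R L2 + r3 *\<^sub>R L3)) \<le> e * s" .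
  qed (use d1 d2 d3 in auto)
qed

lemma expansion_compose:
  assumes "expansion L Q" "expansion L' Q'"
  shows "expansion (L + L') (\<lambda>s X. \<exists>Y Z. Q s Y \<and> Q' s Z \<and> X = Z o\<^sub>L Y)"
  unfolding expansion_def
proof (intro allI impI)
  fix e :: real assume e: "0 < e"
  define l where "l = norm L"
  define l' where "l' = norm L'"
  have l: "0 \<le> l" "0 \<le> l'" by (auto simp: l_def l'_def)
  \<comment> \<open>The remainders of \<open>Z\<close> and \<open>Y\<close> contribute e' s (2 + l)
    and e' s, where 2 + l bounds \<open>norm Y\<close>.\<close>
  define e' where "e' = min 1 (e / (2 * (3 + l)))"
  have e': "0 < e'" "e' \<le> 1" "e' * (3 + l) \<le> e / 2"
  proof -
    show "0 < e'" "e' \<le> 1" using e l by (auto simp: e'_def)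
    have "e' * (3 + l) \<le> (e / (2 * (3 + l))) * (3 + l)"
      using l by (intro mult_right_mono) (auto simp: e'_def)
    also have "\<dots> = e / 2" using l by (simp add: field_simps)
    finally show "e' * (3 + l) \<le> e / 2" .
  qed
  \<comment> \<open>This controls the quadratic term s L' (Y - id), of norm at most s^2 l' (l +
    1).\<close>
  define d0 where "d0 = min 1 (e / (2 * (l' * (l + 1) + 1)))"
  have pl: "0 < l' * (l + 1) + 1" using l by (simp add: add_nonneg_pos)
  then have d0: "0 < d0" "d0 \<le> 1" using e by (auto simp: d0_def)
  have d0': "d0 * (l' * (l + 1)) \<le> e / 2"
  proof -
    have "d0 * (l' * (l + 1)) \<le> d0 * (l' * (l + 1) + 1)"
      using d0 by (intro mult_left_mono) auto
    also have "\<dots> \<le> (e / (2 * (l' * (l + 1) + 1))) * (l' * (l + 1) + 1)"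
      using pl by (intro mult_right_mono) (auto simp: d0_def)
    also have "\<dots> = e / 2" using pl by (simp add: field_simps)
    finally show ?thesis .
  qed
  obtain d1 where d1: "0 < d1" "\<And>s X. \<lbrakk>0 \<le> s; s \<le> d1; Q s X\<rbrakk> \<Longrightarrow> norm (X - id_blinfun - s *\<^sub>R L) \<le> e' * s"
    using expansionD[OF assms(1) e'(1)] by blast
  obtain d2 where d2: "0 < d2" "\<And>s X. \<lbrakk>0 \<le> s; s \<le> d2; Q' s X\<rbrakk> \<Longrightarrow> norm (X - id_blinfun - s *\<^sub>R L') \<le> e' * s"
    using expansionD[OF assms(2) e'(1)] by blast
  show "\<exists>d>0. \<forall>s X. 0 \<le> s \<longrightarrow> s \<le> d \<longrightarrow> (\<exists>Y Z. Q s Y \<and> Q' s Z \<and> X = Z o\<^sub>L Y) \<longrightarrow>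
      norm (X - id_blinfun - s *\<^sub>R (L + L')) \<le> e * s"
  proof (rule exI[of _ "min d0 (min d1 d2)"], intro conjI allI impI)
    fix s X
    assume s: "0 \<le> s" "s \<le> min d0 (min d1 d2)" and "\<exists>Y Z. Q s Y \<and> Q' s Z \<and> X = Z o\<^sub>L Y"
    then obtain Y Z where YZ: "Q s Y" "Q' s Z" "X = Z o\<^sub>L Y" by blast
    define RY where "RY = Y - id_blinfun - s *\<^sub>R L"
    define RZ where "RZ = Z - id_blinfun - s *\<^sub>R L'"
    have RY: "norm RY \<le> e' * s" unfolding RY_def using s by (intro d1 YZ) auto
    have RZ: "norm RZ \<le> e' * s" unfolding RZ_def using s by (intro d2 YZ) auto
    have YI: "norm (Y - id_blinfun) \<le> s * (l + 1)"
    proof -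
      have "Y - id_blinfun = RY + s *\<^sub>R L" by (simp add: RY_def)
      also have "norm \<dots> \<le> e' * s + s * l"
        using RY s by (intro norm_triangle_le add_mono) (auto simp: l_def)
      also have "\<dots> \<le> s * (l + 1)" using mult_right_mono[OF e'(2) s(1)] by (simp add: algebra_simps)
      finally show ?thesis .
    qed
    have nY: "norm Y \<le> 2 + l"
    proof -
      have "norm Y \<le> norm (Y - id_blinfun) + norm (id_blinfun :: 'a \<Rightarrow>\<^sub>L 'a)"
        using norm_triangle_sub[of Y id_blinfun] by (simp add: add.commute)
      also have "\<dots> \<le> s * (l + 1) + 1"
        by (intro add_mono YI norm_blinfun_id_le)
      also have "\<dots> \<le> 1 * (l + 1) + 1" using s d0 l by (intro add_right_mono mult_right_mono) auto
      finally show ?thesis by simp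
    qed
    have "X - id_blinfun - s *\<^sub>R (L + L') = (RZ o\<^sub>L Y) + RY + s *\<^sub>R (L' o\<^sub>L (Y - id_blinfun))"
      unfolding YZ(3) by (rule blinfun_eqI) (simp add: RY_def RZ_def blinfun.bilinear_simps algebra_simps)
    also have "norm \<dots> \<le> norm RZ * norm Y + norm RY + s * (norm L' * norm (Y - id_blinfun))"
      using s by (intro norm_triangle_le add_mono norm_blinfun_compose) (auto intro!: mult_left_mono norm_blinfun_compose)
    also have "\<dots> \<le> (e' * s) * (2 + l) + e' * s + s * (l' * (s * (l + 1)))"
      using s e' l by (intro add_mono mult_mono RZ RY nY YI mult_left_mono) (auto simp: l'_def)
    also have "\<dots> = s * (e' * (3 + l)) + s * (s * (l' * (l + 1)))"
      by (simp add: algebra_simps)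
    also have "\<dots> \<le> s * (e / 2) + s * (d0 * (l' * (l + 1)))"
      using s e' l by (intro add_mono mult_left_mono mult_right_mono) auto
    also have "\<dots> \<le> s * (e / 2) + s * (e / 2)"
      using s d0' by (intro add_mono mult_left_mono) auto
    finally show "norm (X - id_blinfun - s *\<^sub>R (L + L')) \<le> e * s" by (simp add: algebra_simps)
  qed (use d0 d1 d2 in auto)
qed

lemma expansion_iff_has_vector_derivative:
  assumes "K 0 = id_blinfun"
  shows "expansion L (\<lambda>s X. X = K s) \<longleftrightarrow> (K has_vector_derivative L) (at 0 within {0..})"
proof -
  \<comment> \<open>\<open>expansion\<close> bounds s by \<open>\<le>\<close> d, the library
    characterization of derivatives by <.\<close>
  have strict: "(\<exists>d>0. \<forall>s. 0 \<le> s \<longrightarrow> s \<le> d \<longrightarrow> P s) \<longleftrightarrow> (\<exists>d>0. \<forall>s. 0 \<le> s \<longrightarrow> s < d \<longrightarrow> P s)"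
    for P :: "real \<Rightarrow> bool"
  proof
    assume "\<exists>d>0. \<forall>s. 0 \<le> s \<longrightarrow> s < d \<longrightarrow> P s"
    then obtain d where "0 < d" "\<forall>s. 0 \<le> s \<longrightarrow> s < d \<longrightarrow> P s" by blast
    then show "\<exists>d>0. \<forall>s. 0 \<le> s \<longrightarrow> s \<le> d \<longrightarrow> P s" by (intro exI[of _ "d / 2"]) auto
  qed auto
  have "expansion L (\<lambda>s X. X = K s) \<longleftrightarrow>
      (\<forall>e>0. \<exists>d>0. \<forall>s. 0 \<le> s \<longrightarrow> s \<le> d \<longrightarrow> norm (K s - id_blinfun - s *\<^sub>R L) \<le> e * s)"
    unfolding expansion_def by simp
  also have "\<dots> \<longleftrightarrow> (\<forall>e>0. \<exists>d>0. \<forall>s. 0 \<le> s \<longrightarrow> s < d \<longrightarrow> norm (K s - id_blinfun - s *\<^sub>R L) \<le> e * s)"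
    using strict by simp
  also have "\<dots> \<longleftrightarrow> (K has_vector_derivative L) (at 0 within {0..})"
    unfolding has_vector_derivative_def has_derivative_within_alt
    by (simp add: assms bounded_linear_scaleR_left Ball_def)
  finally show ?thesis .
qed

section \<open>Partitions\<close>

text \<open>Entries may be 0, and \<open>[]\<close> is a partition of 0. So cut points may coincide
  when two partitions are refined.\<close>

definition is_partition :: "real \<Rightarrow> real list \<Rightarrow> bool" where
  "is_partition t p \<longleftrightarrow> (\<forall>x\<in>set p. 0 \<le> x) \<and> sum_list p = t"

lemma is_partition_replicate: "0 \<le> t \<Longrightarrow> is_partition t (replicate (Suc n) (t / real (Suc n)))"
  by (auto simp: is_partition_def sum_list_replicate simp del: replicate.simps of_nat_Suc)

text \<open>The smaller of the two first entries is split off the larger one, which shortens one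
  list. Both groupings \<open>qs\<close> and \<open>qs'\<close> flatten to the same list.\<close>

lemma common_refinement:
  fixes p p' :: "real list"
  assumes "\<forall>x\<in>set p. 0 \<le> x" "\<forall>x\<in>set p'. 0 \<le> x" "sum_list p = sum_list p'"
  shows "\<exists>qs qs'. concat qs = concat qs' \<and> map sum_list qs = p \<and> map sum_list qs' = p' \<and>
    (\<forall>x\<in>set (concat qs). 0 \<le> x)"
  using assms
proof (induction "length p + length p'" arbitrary: p p' rule: less_induct)
  case less
  \<comment> \<open>When one list is exhausted, the entries left in the other are 0 and become empty
    blocks.\<close>
  have empty: "\<exists>qs. concat qs = [] \<and> map sum_list qs = p''"
    if "\<forall>x\<in>set p''. 0 \<le> x" "sum_list p'' = 0" for p'' :: "real list"
  proof (intro exI conjI)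
    show "concat (map (\<lambda>_. []) p'') = []" by simp
    have "\<forall>x\<in>set p''. x = 0" using that sum_list_nonneg_eq_0_iff by blast
    then show "map sum_list (map (\<lambda>_. []) p'') = p''"
      by (induction p'') auto
  qed
  \<comment> \<open>The remainder t' - t stays at the head of the second list; afterwards
    \<open>t\<close> is a block of its own on one side and joins the first block on the
    other.\<close>
  have step: "\<exists>qs qs'. concat qs = concat qs' \<and> map sum_list qs = t # r \<and> map sum_list qs' = t' # r' \<and>
      (\<forall>x\<in>set (concat qs). 0 \<le> x)"
    if "length r + length r' < n" "t \<le> t'" "0 \<le> t" "\<forall>x\<in>set r. 0 \<le> x" "\<forall>x\<in>set r'. 0 \<le> x"
      "t + sum_list r = t' + sum_list r'"
      "\<And>p p' :: real list. \<lbrakk>length p + length p' \<le> n; \<forall>x\<in>set p. 0 \<le> x; \<forall>x\<in>set p'. 0 \<le> x; sum_list p = sum_list p'\<rbrakk>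
        \<Longrightarrow> \<exists>qs qs'. concat qs = concat qs' \<and> map sum_list qs = p \<and> map sum_list qs' = p' \<and>
          (\<forall>x\<in>set (concat qs). 0 \<le> x)" for t t' :: real and r r' n
  proof -
    have "\<exists>qs qs'. concat qs = concat qs' \<and> map sum_list qs = r \<and> map sum_list qs' = (t' - t) # r' \<and>
          (\<forall>x\<in>set (concat qs). 0 \<le> x)"
      by (rule that(7)) (use that in auto)
    then obtain qs qs' where q: "concat qs = concat qs'" "map sum_list qs = r" "map sum_list qs' = (t' - t) # r'"
        "\<forall>x\<in>set (concat qs). 0 \<le> x" by metis
    then obtain q1 qs1 where "qs' = q1 # qs1" "sum_list q1 = t' - t" "map sum_list qs1 = r'" by auto
    with q have "concat ([t] # qs) = concat ((t # q1) # qs1) \<and> map sum_list ([t] # qs) = t # r \<and>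
        map sum_list ((t # q1) # qs1) = t' # r' \<and> (\<forall>x\<in>set (concat ([t] # qs)). 0 \<le> x)"
      using that by simp
    then show ?thesis by (intro exI)
  qed
  show ?case
  proof (cases p)
    case [simp]: Nil
    have "\<exists>qs'. concat qs' = [] \<and> map sum_list qs' = p'"
      using less.prems by (intro empty) simp_all
    then obtain qs' where "concat qs' = []" "map sum_list qs' = p'" by blast
    then show ?thesis by (intro exI[of _ "[]"] exI[of _ qs']) auto
  next
    case [simp]: (Cons t r)
    show ?thesis
    proof (cases p')
      case [simp]: Nil
      have "\<exists>qs. concat qs = [] \<and> map sum_list qs = p"
        using less.prems by (intro empty) simp_all
      then obtain qs where "concat qs = []" "map sum_list qs = p" by blast
      then show ?thesis by (intro exI[of _ qs] exI[of _ "[]"]) auto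
    next
      case [simp]: (Cons t' r')
      define n where "n = length r + length r' + 1"
      have IH: "\<exists>qs qs'. concat qs = concat qs' \<and> map sum_list qs = p \<and> map sum_list qs' = p' \<and>
          (\<forall>x\<in>set (concat qs). 0 \<le> x)"
        if "length p + length p' \<le> n" "\<forall>x\<in>set p. 0 \<le> x" "\<forall>x\<in>set p'. 0 \<le> x" "sum_list p = sum_list p'"
        for p p' :: "real list"
        using that by (intro less.hyps) (auto simp: n_def)
      show ?thesis
      proof (cases "t \<le> t'")
        case True
        then show ?thesis
          unfolding \<open>p = t # r\<close> \<open>p' = t' # r'\<close>
          by (intro step[OF _ _ _ _ _ _ IH]) (use less.prems in \<open>simp_all add: n_def\<close>)
      next
        case False
        with less.prems have "\<exists>qs qs'. concat qs = concat qs' \<and> map sum_list qs = t' # r' \<and>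
          map sum_list qs' = t # r \<and> (\<forall>x\<in>set (concat qs). 0 \<le> x)"
          by (intro step[OF _ _ _ _ _ _ IH]) (simp_all add: n_def)
        then show ?thesis unfolding \<open>p = t # r\<close> \<open>p' = t' # r'\<close> by metis
      qed
    qed
  qed
qed

section \<open>Product systems\<close>

text \<open>The list is multiplied from its end, as in \<open>tens_power\<close>.\<close>

primrec tens_list ::
  "('e, 'b::cstar_algebra) psystem \<Rightarrow> ('i \<Rightarrow> real) \<Rightarrow> ('i \<Rightarrow> 'e) \<Rightarrow> 'i list \<Rightarrow> 'e" where
  "tens_list E d f [] = unit_iso E 1"
| "tens_list E d f (i # is) = tens E (sum_list (map d is)) (d i) (tens_list E d f is) (f i)"

text \<open>The second assumption holds as soon as there is a unit; in the theorem the reference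
  unit supplies it through its value at 0.\<close>

locale unital_product_system =
  fixes E :: "('e, 'b::cstar_algebra) psystem"
  assumes product_system: "product_system E"
    and one_tens_one: "tens E 0 0 (unit_iso E 1) (unit_iso E 1) = unit_iso E 1"
begin

lemma hilbert_bimodule_fib: "0 \<le> t \<Longrightarrow> hilbert_bimodule (fib E t)"
  using product_system by (simp add: product_system_def)

lemma inner_tensor_product_fib:
  "\<lbrakk>0 \<le> s; 0 \<le> t\<rbrakk> \<Longrightarrow> inner_tensor_product (fib E s) (fib E t) (fib E (s + t)) (tens E s t)"
  using product_system by (simp add: product_system_def)

lemma tens_closed:
  "\<lbrakk>0 \<le> s; 0 \<le> t; u \<in> carrier (fib E s); v \<in> carrier (fib E t)\<rbrakk> \<Longrightarrow> tens E s t u v \<in> carrier (fib E (s + t))"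
  using inner_tensor_product_fib[of s t] by (simp add: inner_tensor_product_def)

lemma tens_add_left:
  "\<lbrakk>0 \<le> s; 0 \<le> t; u \<in> carrier (fib E s); u' \<in> carrier (fib E s); v \<in> carrier (fib E t)\<rbrakk> \<Longrightarrow>
    tens E s t (u \<oplus>\<^bsub>fib E s\<^esub> u') v = tens E s t u v \<oplus>\<^bsub>fib E (s + t)\<^esub> tens E s t u' v"
  using inner_tensor_product_fib[of s t] by (simp add: inner_tensor_product_def)

lemma tens_add_right:
  "\<lbrakk>0 \<le> s; 0 \<le> t; u \<in> carrier (fib E s); v \<in> carrier (fib E t); v' \<in> carrier (fib E t)\<rbrakk> \<Longrightarrow>
    tens E s t u (v \<oplus>\<^bsub>fib E t\<^esub> v') = tens E s t u v \<oplus>\<^bsub>fib E (s + t)\<^esub> tens E s t u v'"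
  using inner_tensor_product_fib[of s t] by (simp add: inner_tensor_product_def)

lemma lact_tens:
  "\<lbrakk>0 \<le> s; 0 \<le> t; u \<in> carrier (fib E s); v \<in> carrier (fib E t)\<rbrakk> \<Longrightarrow>
    lact (fib E (s + t)) b (tens E s t u v) = tens E s t (lact (fib E s) b u) v"
  using inner_tensor_product_fib[of s t] by (simp add: inner_tensor_product_def)

lemma ip_tens:
  "\<lbrakk>0 \<le> s; 0 \<le> t; u \<in> carrier (fib E s); u' \<in> carrier (fib E s); v \<in> carrier (fib E t); v' \<in> carrier (fib E t)\<rbrakk> \<Longrightarrow>
    ip (fib E (s + t)) (tens E s t u v) (tens E s t u' v') =
      ip (fib E t) v (lact (fib E t) (ip (fib E s) u u') v')"
  using inner_tensor_product_fib[of s t] by (simp add: inner_tensor_product_def)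

lemma tens_assoc:
  "\<lbrakk>0 \<le> r; 0 \<le> s; 0 \<le> t; u \<in> carrier (fib E r); v \<in> carrier (fib E s); w \<in> carrier (fib E t)\<rbrakk> \<Longrightarrow>
    tens E (r + s) t (tens E r s u v) w = tens E r (s + t) u (tens E s t v w)"
  using product_system unfolding product_system_def by blast

lemma unit_iso_closed: "unit_iso E b \<in> carrier (fib E 0)"
  and lact_unit_iso: "lact (fib E 0) b (unit_iso E c) = unit_iso E (b * c)"
  and ip_unit_iso: "ip (fib E 0) (unit_iso E b) (unit_iso E c) = adj b * c"
  using product_system
  unfolding product_system_def bilinear_unitary_def bilinear_isometry_def
  by (simp_all add: standard_bimodule_def)

lemma kap_unit_iso: "kap (fib E 0) (unit_iso E 1) (unit_iso E 1) = id_blinfun"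
  using hilbert_bimodule.kap_apply[OF hilbert_bimodule_fib unit_iso_closed unit_iso_closed]
  by (intro blinfun_eqI) (simp add: lact_unit_iso ip_unit_iso)

text \<open>
  The maps \<open>x \<mapsto> x \<otimes> 1\<close> and \<open>x \<mapsto> 1 \<otimes> x\<close> are of this kind because \<open>1 \<otimes> 1 = 1\<close>; hence
  the unit laws.
\<close>

lemma idempotent_isometry:
  assumes "hilbert_bimodule M" "x \<in> carrier M"
    and closed: "\<And>y. y \<in> carrier M \<Longrightarrow> f y \<in> carrier M"
    and ip: "\<And>y z. \<lbrakk>y \<in> carrier M; z \<in> carrier M\<rbrakk> \<Longrightarrow> ip M (f y) (f z) = ip M y z"
    and idem: "\<And>y. y \<in> carrier M \<Longrightarrow> f (f y) = f y"
  shows "f x = x"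
proof -
  interpret M: hilbert_bimodule M by fact
  \<comment> \<open>Since f (f x) = f x, <f x, x> = <f (f x), f x> = <f x, f x> = <x, x>.\<close>
  have "ip M (f x) x = ip M x x" "ip M x (f x) = ip M x x" "ip M (f x) (f x) = ip M x x"
    using ip[of "f x" x] ip[of x "f x"] ip[of x x] idem[of x] closed assms(2) by simp_all
  then have "ip M (f x \<ominus>\<^bsub>M\<^esub> x) (f x \<ominus>\<^bsub>M\<^esub> x) = 0"
    using assms(2) closed by (simp add: M.ip_diff_left M.ip_diff_right)
  then show ?thesis
    using M.ip_definite M.minus_eq_zero_iff assms(2) closed by (metis M.minus_closed)
qed

lemma tens_one_right:
  assumes "0 \<le> t" "x \<in> carrier (fib E t)"
  shows "tens E t 0 x (unit_iso E 1) = x"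
proof (rule idempotent_isometry[OF hilbert_bimodule_fib[OF assms(1)] assms(2), of "\<lambda>x. tens E t 0 x (unit_iso E 1)"])
  fix y z assume "y \<in> carrier (fib E t)" "z \<in> carrier (fib E t)"
  then show "ip (fib E t) (tens E t 0 y (unit_iso E 1)) (tens E t 0 z (unit_iso E 1)) = ip (fib E t) y z"
    using ip_tens[of t 0 y z "unit_iso E 1" "unit_iso E 1"] assms unit_iso_closed[of 1]
    by (simp add: lact_unit_iso ip_unit_iso)
next
  fix y assume y: "y \<in> carrier (fib E t)"
  then show "tens E t 0 y (unit_iso E 1) \<in> carrier (fib E t)"
    using tens_closed[of t 0 y "unit_iso E 1"] assms unit_iso_closed[of 1] by simp
  show "tens E t 0 (tens E t 0 y (unit_iso E 1)) (unit_iso E 1) = tens E t 0 y (unit_iso E 1)"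
    using tens_assoc[of t 0 0 y "unit_iso E 1" "unit_iso E 1"] assms y unit_iso_closed[of 1]
    by (simp add: one_tens_one)
qed

lemma tens_one_left:
  assumes "0 \<le> t" "x \<in> carrier (fib E t)"
  shows "tens E 0 t (unit_iso E 1) x = x"
proof (rule idempotent_isometry[OF hilbert_bimodule_fib[OF assms(1)] assms(2), of "tens E 0 t (unit_iso E 1)"])
  fix y z assume "y \<in> carrier (fib E t)" "z \<in> carrier (fib E t)"
  then show "ip (fib E t) (tens E 0 t (unit_iso E 1) y) (tens E 0 t (unit_iso E 1) z) = ip (fib E t) y z"
    using ip_tens[of 0 t "unit_iso E 1" "unit_iso E 1" y z] assms unit_iso_closed[of 1]
      hilbert_bimodule.lact_one[OF hilbert_bimodule_fib[OF assms(1)]]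
    by (simp add: ip_unit_iso)
next
  fix y assume y: "y \<in> carrier (fib E t)"
  then show "tens E 0 t (unit_iso E 1) y \<in> carrier (fib E t)"
    using tens_closed[of 0 t "unit_iso E 1" y] assms unit_iso_closed[of 1] by simp
  show "tens E 0 t (unit_iso E 1) (tens E 0 t (unit_iso E 1) y) = tens E 0 t (unit_iso E 1) y"
    using tens_assoc[of 0 0 t "unit_iso E 1" "unit_iso E 1" y] assms y unit_iso_closed[of 1]
    by (simp add: one_tens_one)
qed

text \<open>The inner product of the left factors acts on the right ones, so the operator of the
  left factors is applied first. Products of vectors thus become compositions of operators.\<close>

lemma kap_tens:
  assumes "0 \<le> s" "0 \<le> t" "u \<in> carrier (fib E s)" "u' \<in> carrier (fib E s)" "v \<in> carrier (fib E t)" "v' \<in> carrier (fib E t)"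
  shows "kap (fib E (s + t)) (tens E s t u v) (tens E s t u' v') = kap (fib E t) v v' o\<^sub>L kap (fib E s) u u'"
proof (rule blinfun_eqI)
  fix b
  interpret S: hilbert_bimodule "fib E s" using assms by (intro hilbert_bimodule_fib)
  interpret T: hilbert_bimodule "fib E t" using assms by (intro hilbert_bimodule_fib)
  interpret ST: hilbert_bimodule "fib E (s + t)" using assms by (intro hilbert_bimodule_fib) simp
  show "kap (fib E (s + t)) (tens E s t u v) (tens E s t u' v') b = (kap (fib E t) v v' o\<^sub>L kap (fib E s) u u') b"
    using assms by (simp add: ST.kap_apply S.kap_apply T.kap_apply tens_closed lact_tens ip_tens S.lact_closed)
qed

lemma mod_norm_tens_le:
  assumes "0 \<le> s" "0 \<le> t" "u \<in> carrier (fib E s)" "v \<in> carrier (fib E t)"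
  shows "mod_norm (fib E (s + t)) (tens E s t u v) \<le> mod_norm (fib E s) u * mod_norm (fib E t) v"
proof (rule power2_le_imp_le)
  interpret T: hilbert_bimodule "fib E t" using assms by (intro hilbert_bimodule_fib)
  have "norm (ip (fib E t) v (lact (fib E t) (ip (fib E s) u u) v)) \<le>
      mod_norm (fib E t) v * mod_norm (fib E t) v * norm (ip (fib E s) u u)"
    using assms by (intro T.norm_ip_lact_le)
  then show "(mod_norm (fib E (s + t)) (tens E s t u v))\<^sup>2 \<le> (mod_norm (fib E s) u * mod_norm (fib E t) v)\<^sup>2"
    using assms by (simp add: mod_norm_power2 ip_tens power_mult_distrib) (simp add: power2_eq_square[of "mod_norm _ _"] mod_norm_power2[symmetric] mult_ac)
qed simp

lemma tens_minus_left:
  assumes "0 \<le> s" "0 \<le> t" "u \<in> carrier (fib E s)" "u' \<in> carrier (fib E s)" "v \<in> carrier (fib E t)"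
  shows "tens E s t (u \<ominus>\<^bsub>fib E s\<^esub> u') v = tens E s t u v \<ominus>\<^bsub>fib E (s + t)\<^esub> tens E s t u' v"
proof -
  interpret S: hilbert_bimodule "fib E s" using assms by (intro hilbert_bimodule_fib)
  interpret ST: hilbert_bimodule "fib E (s + t)" using assms by (intro hilbert_bimodule_fib) simp
  have "(u \<ominus>\<^bsub>fib E s\<^esub> u') \<oplus>\<^bsub>fib E s\<^esub> u' = u"
    using assms by (simp add: S.minus_eq S.a_assoc S.l_neg)
  then have eq: "tens E s t (u \<ominus>\<^bsub>fib E s\<^esub> u') v \<oplus>\<^bsub>fib E (s + t)\<^esub> tens E s t u' v = tens E s t u v"
    using tens_add_left[of s t "u \<ominus>\<^bsub>fib E s\<^esub> u'" u' v] assms by simp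
  show ?thesis
    using assms tens_closed[of s t "u \<ominus>\<^bsub>fib E s\<^esub> u'" v] tens_closed[of s t u' v]
    by (simp add: eq[symmetric] ST.minus_eq ST.a_assoc ST.r_neg)
qed

lemma tens_minus_right:
  assumes "0 \<le> s" "0 \<le> t" "u \<in> carrier (fib E s)" "v \<in> carrier (fib E t)" "v' \<in> carrier (fib E t)"
  shows "tens E s t u (v \<ominus>\<^bsub>fib E t\<^esub> v') = tens E s t u v \<ominus>\<^bsub>fib E (s + t)\<^esub> tens E s t u v'"
proof -
  interpret T: hilbert_bimodule "fib E t" using assms by (intro hilbert_bimodule_fib)
  interpret ST: hilbert_bimodule "fib E (s + t)" using assms by (intro hilbert_bimodule_fib) simp
  have "(v \<ominus>\<^bsub>fib E t\<^esub> v') \<oplus>\<^bsub>fib E t\<^esub> v' = v"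
    using assms by (simp add: T.minus_eq T.a_assoc T.l_neg)
  then have eq: "tens E s t u (v \<ominus>\<^bsub>fib E t\<^esub> v') \<oplus>\<^bsub>fib E (s + t)\<^esub> tens E s t u v' = tens E s t u v"
    using tens_add_right[of s t u "v \<ominus>\<^bsub>fib E t\<^esub> v'" v'] assms by simp
  show ?thesis
    using assms tens_closed[of s t u "v \<ominus>\<^bsub>fib E t\<^esub> v'"] tens_closed[of s t u v']
    by (simp add: eq[symmetric] ST.minus_eq ST.a_assoc ST.r_neg)
qed

lemma mod_norm_tens_minus_le:
  assumes "0 \<le> s" "0 \<le> t" "u \<in> carrier (fib E s)" "u' \<in> carrier (fib E s)" "v \<in> carrier (fib E t)" "v' \<in> carrier (fib E t)"
  shows "mod_norm (fib E (s + t)) (tens E s t u v \<ominus>\<^bsub>fib E (s + t)\<^esub> tens E s t u' v') \<le>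
    mod_norm (fib E s) (u \<ominus>\<^bsub>fib E s\<^esub> u') * mod_norm (fib E t) v
    + mod_norm (fib E s) u' * mod_norm (fib E t) (v \<ominus>\<^bsub>fib E t\<^esub> v')"
proof -
  interpret S: hilbert_bimodule "fib E s" using assms by (intro hilbert_bimodule_fib)
  interpret T: hilbert_bimodule "fib E t" using assms by (intro hilbert_bimodule_fib)
  interpret ST: hilbert_bimodule "fib E (s + t)" using assms by (intro hilbert_bimodule_fib) simp
  have "mod_norm (fib E (s + t)) (tens E s t u v \<ominus>\<^bsub>fib E (s + t)\<^esub> tens E s t u' v') \<le>
      mod_norm (fib E (s + t)) (tens E s t u v \<ominus>\<^bsub>fib E (s + t)\<^esub> tens E s t u' v)
      + mod_norm (fib E (s + t)) (tens E s t u' v \<ominus>\<^bsub>fib E (s + t)\<^esub> tens E s t u' v')"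
    using assms by (intro ST.mod_norm_triangle tens_closed)
  also have "\<dots> \<le> mod_norm (fib E s) (u \<ominus>\<^bsub>fib E s\<^esub> u') * mod_norm (fib E t) v
    + mod_norm (fib E s) u' * mod_norm (fib E t) (v \<ominus>\<^bsub>fib E t\<^esub> v')"
    using assms by (auto simp: tens_minus_left[symmetric] tens_minus_right[symmetric] intro!: add_mono mod_norm_tens_le)
  finally show ?thesis .
qed

text \<open>The index type is free because two kinds of lists occur: the entries of a partition, and
  the sublists of a refinement with \<open>d = sum_list\<close>.\<close>

definition blocks :: "('i \<Rightarrow> real) \<Rightarrow> ('i \<Rightarrow> 'e) \<Rightarrow> 'i list \<Rightarrow> bool" where
  "blocks d f is \<longleftrightarrow> (\<forall>i\<in>set is. 0 \<le> d i \<and> f i \<in> carrier (fib E (d i)))"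

lemma blocks_simps [simp]:
  "blocks d f []"
  "blocks d f (i # is) \<longleftrightarrow> 0 \<le> d i \<and> f i \<in> carrier (fib E (d i)) \<and> blocks d f is"
  "blocks d f (is @ js) \<longleftrightarrow> blocks d f is \<and> blocks d f js"
  by (auto simp: blocks_def)

lemma blocks_sum_nonneg: "blocks d f is \<Longrightarrow> 0 \<le> sum_list (map d is)"
  by (induction "is") auto

lemma tens_list_closed: "blocks d f is \<Longrightarrow> tens_list E d f is \<in> carrier (fib E (sum_list (map d is)))"
  using blocks_sum_nonneg
  by (induction "is") (auto simp: unit_iso_closed add.commute[of "d _"] intro!: tens_closed)

lemma tens_list_append:
  assumes "blocks d f (is @ js)"
  shows "tens_list E d f (is @ js) =
    tens E (sum_list (map d js)) (sum_list (map d is)) (tens_list E d f js) (tens_list E d f is)"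
  using assms
proof (induction "is")
  case Nil
  then show ?case using blocks_sum_nonneg[of d f js] tens_list_closed[of d f js] by (simp add: tens_one_right)
next
  case (Cons i "is")
  then have "tens_list E d f ((i # is) @ js) =
    tens E (sum_list (map d js) + sum_list (map d is)) (d i)
      (tens E (sum_list (map d js)) (sum_list (map d is)) (tens_list E d f js) (tens_list E d f is)) (f i)"
    by (simp add: add.commute)
  also have "\<dots> = tens E (sum_list (map d js)) (sum_list (map d is) + d i) (tens_list E d f js)
      (tens E (sum_list (map d is)) (d i) (tens_list E d f is) (f i))"
    using Cons.prems by (intro tens_assoc) (auto simp: blocks_sum_nonneg tens_list_closed)
  finally show ?case by (simp add: add.commute)
qed

lemma tens_list_concat:
  assumes "blocks d f (concat qs)"
  shows "tens_list E d f (concat qs) =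
    tens_list E (\<lambda>q. sum_list (map d q)) (tens_list E d f) qs"
  using assms
proof (induction qs)
  case (Cons q qs)
  have "sum_list (map d (concat qs)) = sum_list (map (\<lambda>q. sum_list (map d q)) qs)"
    by (induction qs) auto
  with Cons show ?case by (simp add: tens_list_append)
qed simp

lemma tens_list_map: "tens_list E d f (map g is) = tens_list E (d \<circ> g) (f \<circ> g) is"
  by (induction "is") (simp_all add: o_def)

text \<open>Each factor is id + t L + R with norm R at most e t, hence within C t of the identity.
  The three bounds involve the remainders of exp(C T) of order 0, 1 and 2; every induction step uses
  exp(C T)(1 + C t) \<open>\<le>\<close> exp(C (T + t)). None depends on the number of
  factors.\<close>

lemma kap_tens_list_expansion:
  assumes "blocks d f is" "blocks d g is" "0 \<le> e"
    and est: "\<And>i. i \<in> set is \<Longrightarrow> norm (kap (fib E (d i)) (f i) (g i) - id_blinfun - d i *\<^sub>R L) \<le> e * d i"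
  defines "C \<equiv> norm L + e"
  shows "norm (kap (fib E (sum_list (map d is))) (tens_list E d f is) (tens_list E d g is)) \<le> exp (C * sum_list (map d is))
    \<and> norm (kap (fib E (sum_list (map d is))) (tens_list E d f is) (tens_list E d g is) - id_blinfun) \<le> exp (C * sum_list (map d is)) - 1
    \<and> norm (kap (fib E (sum_list (map d is))) (tens_list E d f is) (tens_list E d g is) - id_blinfun - sum_list (map d is) *\<^sub>R L)
      \<le> e * sum_list (map d is) + (exp (C * sum_list (map d is)) - 1 - C * sum_list (map d is))"
  using assms(1,2) est
proof (induction "is")
  case Nil
  then show ?case by (simp add: kap_unit_iso norm_blinfun_id_le)
next
  case (Cons i "is")
  define T where "T = sum_list (map d is)"
  define t where "t = d i"
  define X where "X = kap (fib E T) (tens_list E d f is) (tens_list E d g is)"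
  define M where "M = kap (fib E t) (f i) (g i)"
  define G where "G = exp (C * T)"
  have C: "0 \<le> C" using assms(3) by (simp add: C_def)
  have T: "0 \<le> T" unfolding T_def using Cons.prems by (intro blocks_sum_nonneg[of d f]) simp
  have t: "0 \<le> t" unfolding t_def using Cons.prems by simp
  have IH: "norm X \<le> G" "norm (X - id_blinfun) \<le> G - 1" "norm (X - id_blinfun - T *\<^sub>R L) \<le> e * T + (G - 1 - C * T)"
    using Cons by (auto simp: X_def G_def T_def)
  have eq: "kap (fib E (T + t)) (tens_list E d f (i # is)) (tens_list E d g (i # is)) = M o\<^sub>L X"
    unfolding X_def M_def T_def t_def using Cons.prems
    by (simp add: kap_tens blocks_sum_nonneg[of d f] tens_list_closed)
  define R where "R = M - id_blinfun - t *\<^sub>R L"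
  have R: "norm R \<le> e * t" unfolding R_def M_def t_def by (rule Cons.prems) simp
  have M: "norm (M - id_blinfun) \<le> C * t"
  proof -
    have "M - id_blinfun = R + t *\<^sub>R L" by (simp add: R_def)
    also have "norm \<dots> \<le> e * t + t * norm L"
      using R t by (intro norm_triangle_le add_mono) auto
    finally show ?thesis by (simp add: C_def algebra_simps)
  qed
  have nM: "norm M \<le> 1 + C * t"
  proof -
    have "norm M \<le> norm (id_blinfun :: 'b \<Rightarrow>\<^sub>L 'b) + norm (M - id_blinfun)"
      by (rule norm_triangle_sub)
    with M norm_blinfun_id_le[where 'a = 'b] show ?thesis by linarith
  qed
  have G1: "1 \<le> G" using C T by (simp add: G_def)
  have Gt: "G * (1 + C * t) \<le> exp (C * (T + t))"
  proof -
    have "G * (1 + C * t) \<le> G * exp (C * t)"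
      using G1 by (intro mult_left_mono exp_ge_add_one_self) simp
    then show ?thesis by (simp add: G_def distrib_left exp_add)
  qed
  have 1: "norm (M o\<^sub>L X) \<le> exp (C * (T + t))"
  proof -
    have "norm (M o\<^sub>L X) \<le> norm M * norm X" by (rule norm_blinfun_compose)
    also have "\<dots> \<le> (1 + C * t) * G" using C t by (intro mult_mono nM IH) auto
    finally show ?thesis using Gt by (simp add: mult.commute)
  qed
  have 2: "norm ((M o\<^sub>L X) - id_blinfun) \<le> exp (C * (T + t)) - 1"
  proof -
    have "(M o\<^sub>L X) - id_blinfun = ((M - id_blinfun) o\<^sub>L X) + (X - id_blinfun)"
      by (rule blinfun_eqI) (simp add: blinfun.bilinear_simps)
    also have "norm \<dots> \<le> norm (M - id_blinfun) * norm X + norm (X - id_blinfun)"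
      by (intro norm_triangle_le add_mono norm_blinfun_compose) simp
    also have "\<dots> \<le> (C * t) * G + (G - 1)"
      using C t by (intro add_mono mult_mono M IH) auto
    also have "\<dots> = G * (1 + C * t) - 1" by (simp add: algebra_simps)
    finally show ?thesis using Gt by simp
  qed
  have 3: "norm ((M o\<^sub>L X) - id_blinfun - (T + t) *\<^sub>R L) \<le> e * (T + t) + (exp (C * (T + t)) - 1 - C * (T + t))"
  proof -
    have "(M o\<^sub>L X) - id_blinfun - (T + t) *\<^sub>R L =
        (X - id_blinfun - T *\<^sub>R L) + ((M - id_blinfun) o\<^sub>L (X - id_blinfun)) + R"
      by (rule blinfun_eqI) (simp add: R_def blinfun.bilinear_simps algebra_simps)
    also have "norm \<dots> \<le> norm (X - id_blinfun - T *\<^sub>R L) + norm (M - id_blinfun) * norm (X - id_blinfun) + norm R"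
      by (intro norm_triangle_le add_mono norm_blinfun_compose) auto
    also have "\<dots> \<le> (e * T + (G - 1 - C * T)) + (C * t) * (G - 1) + e * t"
      using C t by (intro add_mono mult_mono M IH R) auto
    also have "\<dots> = e * (T + t) + (G * (1 + C * t) - 1 - C * (T + t))"
      by (simp add: algebra_simps)
    finally show ?thesis using Gt by simp
  qed
  have sum: "sum_list (map d (i # is)) = T + t" by (simp add: T_def t_def)
  show ?case unfolding sum eq using 1 2 3 by blast
qed

text \<open>Telescoping: corresponding factors differ by at most 2 e t, and what surrounds them is
  bounded by exponentials. The total is proportional to \<open>e\<close>, independently of the
  number of factors.\<close>

lemma kap_tens_list_diff:
  assumes "blocks d f is" "blocks d g is" "blocks d f' is" "blocks d g' is" "0 \<le> e"
    and est: "\<And>i. i \<in> set is \<Longrightarrow> norm (kap (fib E (d i)) (f i) (g i) - id_blinfun - d i *\<^sub>R L) \<le> e * d i"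
    and est': "\<And>i. i \<in> set is \<Longrightarrow> norm (kap (fib E (d i)) (f' i) (g' i) - id_blinfun - d i *\<^sub>R L) \<le> e * d i"
  defines "C \<equiv> norm L + e"
  shows "norm (kap (fib E (sum_list (map d is))) (tens_list E d f is) (tens_list E d g is)
      - kap (fib E (sum_list (map d is))) (tens_list E d f' is) (tens_list E d g' is))
    \<le> 2 * e * sum_list (map d is) * exp (C * sum_list (map d is))"
  using assms(1-4) est est'
proof (induction "is")
  case Nil
  then show ?case by simp
next
  case (Cons i "is")
  define T where "T = sum_list (map d is)"
  define t where "t = d i"
  define X where "X = kap (fib E T) (tens_list E d f is) (tens_list E d g is)"
  define M where "M = kap (fib E t) (f i) (g i)"
  define X' where "X' = kap (fib E T) (tens_list E d f' is) (tens_list E d g' is)"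
  define M' where "M' = kap (fib E t) (f' i) (g' i)"
  have C: "0 \<le> C" using assms(5) by (simp add: C_def)
  have T: "0 \<le> T" unfolding T_def using Cons.prems by (intro blocks_sum_nonneg[of d f]) simp
  have t: "0 \<le> t" unfolding t_def using Cons.prems by simp
  have IH: "norm (X - X') \<le> 2 * e * T * exp (C * T)"
    using Cons by (auto simp: X_def X'_def T_def)
  have X: "norm X \<le> exp (C * T)"
    unfolding X_def T_def C_def
  proof (rule kap_tens_list_expansion[THEN conjunct1])
    show "norm (kap (fib E (d j)) (f j) (g j) - id_blinfun - d j *\<^sub>R L) \<le> e * d j" if "j \<in> set is" for j
      using that by (intro Cons.prems(5)) simp
  qed (use Cons.prems assms(5) in simp_all)
  have eq: "kap (fib E (T + t)) (tens_list E d f (i # is)) (tens_list E d g (i # is)) = M o\<^sub>L X"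
      "kap (fib E (T + t)) (tens_list E d f' (i # is)) (tens_list E d g' (i # is)) = M' o\<^sub>L X'"
    unfolding X_def M_def X'_def M'_def T_def t_def using Cons.prems
    by (simp_all add: kap_tens blocks_sum_nonneg[of d f] tens_list_closed)
  have M: "norm (M - id_blinfun - t *\<^sub>R L) \<le> e * t" "norm (M' - id_blinfun - t *\<^sub>R L) \<le> e * t"
    unfolding M_def M'_def t_def by (auto intro: Cons.prems)
  have MM: "norm (M - M') \<le> 2 * e * t"
    using norm_triangle_mono[OF M(1) M(2)[folded norm_minus_cancel[of "M' - id_blinfun - t *\<^sub>R L"]]]
    by (simp add: algebra_simps)
  have nM: "norm M' \<le> exp (C * t)"
  proof -
    have "M' = id_blinfun + (t *\<^sub>R L + (M' - id_blinfun - t *\<^sub>R L))" by simp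
    also have "norm \<dots> \<le> 1 + (t * norm L + e * t)"
      using M t by (intro norm_triangle_le add_mono norm_blinfun_id_le) auto
    also have "\<dots> = 1 + C * t" by (simp add: C_def algebra_simps)
    finally show ?thesis using exp_ge_add_one_self[of "C * t"] by linarith
  qed
  have "(M o\<^sub>L X) - (M' o\<^sub>L X') = ((M - M') o\<^sub>L X) + (M' o\<^sub>L (X - X'))"
    by (rule blinfun_eqI) (simp add: blinfun.bilinear_simps)
  also have "norm \<dots> \<le> norm (M - M') * norm X + norm M' * norm (X - X')"
    by (intro norm_triangle_le add_mono norm_blinfun_compose)
  also have "\<dots> \<le> (2 * e * t) * exp (C * T) + exp (C * t) * (2 * e * T * exp (C * T))"
    using t assms(5) by (intro add_mono mult_mono MM X nM IH) auto
  also have "\<dots> \<le> (2 * e * t) * exp (C * (T + t)) + exp (C * t) * (2 * e * T * exp (C * T))"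
    using t T assms(5) C by (intro add_mono mult_left_mono) (auto intro!: mult_left_mono mult_nonneg_nonneg)
  also have "\<dots> = 2 * e * (T + t) * exp (C * (T + t))"
    by (simp add: algebra_simps exp_add)
  finally have "norm ((M o\<^sub>L X) - (M' o\<^sub>L X')) \<le> 2 * e * (T + t) * exp (C * (T + t))" .
  moreover have sum: "sum_list (map d (i # is)) = T + t" by (simp add: T_def t_def)
  ultimately show ?case unfolding sum eq by blast
qed

end

section \<open>Limits of products along partitions\<close>

lemma partition_le:
  assumes "is_partition t p" "x \<in> set p"
  shows "x \<le> t"
proof -
  have "x \<le> sum_list p" if "\<forall>y\<in>set p. 0 \<le> y" "x \<in> set p" for p :: "real list"
    using that by (induction p) (auto intro: sum_list_nonneg add_increasing2 order_trans)
  with assms show ?thesis by (auto simp: is_partition_def)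
qed

text \<open>The index is shifted by one against that of \<open>limit_unit\<close>, whose term for m
  = 0 does not come from a partition of \<open>t\<close>.\<close>

definition equi_partition :: "real \<Rightarrow> nat \<Rightarrow> real list" where
  "equi_partition t n = replicate (Suc n) (t / real (Suc n))"

lemma is_partition_equi_partition: "0 \<le> t \<Longrightarrow> is_partition t (equi_partition t n)"
  unfolding equi_partition_def by (rule is_partition_replicate)

lemma equi_partition_mesh:
  assumes "0 \<le> t" "0 < d"
  shows "\<exists>N. \<forall>n\<ge>N. \<forall>x\<in>set (equi_partition t n). x \<le> d"
proof -
  obtain N where N: "t / d < real N" using reals_Archimedean2 by blast
  have "t / real (Suc n) \<le> d" if "N \<le> n" for n
  proof -
    have "t / d \<le> real (Suc n)" using N that by linarith
    then show ?thesis using assms by (simp add: divide_le_eq mult.commute)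
  qed
  then show ?thesis by (auto simp: equi_partition_def)
qed

lemma (in hilbert_bimodule) mod_norm_minus_self: "x \<in> carrier M \<Longrightarrow> mod_norm M (x \<ominus> x) = 0"
  using minus_eq_zero_iff[of x x] mod_norm_eq_0[of "x \<ominus> x"] by simp

context unital_product_system
begin

abbreviation sec_tens :: "(real \<Rightarrow> 'e) \<Rightarrow> real list \<Rightarrow> 'e" where
  "sec_tens a p \<equiv> tens_list E (\<lambda>x. x) a p"

definition is_section :: "(real \<Rightarrow> 'e) \<Rightarrow> bool" where
  "is_section a \<longleftrightarrow> (\<forall>s\<ge>0. a s \<in> carrier (fib E s))"

abbreviation tangent :: "(real \<Rightarrow> 'e) \<Rightarrow> (real \<Rightarrow> 'e) \<Rightarrow> ('b \<Rightarrow>\<^sub>L 'b) \<Rightarrow> bool" where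
  "tangent a b L \<equiv> expansion L (\<lambda>s X. X = kap (fib E s) (a s) (b s))"

text \<open>A single value is tested against products along arbitrary partitions. This mixed
  operator is what the comparison of a product with a refinement requires besides the operators of
  the two products themselves.\<close>

definition generating :: "(real \<Rightarrow> 'e) \<Rightarrow> ('b \<Rightarrow>\<^sub>L 'b) \<Rightarrow> bool" where
  "generating a L \<longleftrightarrow> is_section a \<and>
     expansion L (\<lambda>s X. \<exists>q. is_partition s q \<and> X = kap (fib E s) (a s) (sec_tens a q))"

lemma blocks_partition: "\<lbrakk>is_section a; is_partition t p\<rbrakk> \<Longrightarrow> blocks (\<lambda>x. x) a p"
  by (auto simp: blocks_def is_section_def is_partition_def)

lemma sec_tens_closed: "\<lbrakk>is_section a; is_partition t p\<rbrakk> \<Longrightarrow> sec_tens a p \<in> carrier (fib E t)"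
  using tens_list_closed[OF blocks_partition, of a t p] by (simp add: is_partition_def)

lemma tangent_of_generating:
  assumes "generating a L"
  shows "tangent a a L"
proof -
  have "expansion L (\<lambda>s X. \<exists>q. is_partition s q \<and> X = kap (fib E s) (a s) (sec_tens a q))"
    using assms by (simp add: generating_def)
  then show ?thesis
  proof (rule expansion_mono)
    fix s X assume "0 \<le> s" "X = kap (fib E s) (a s) (a s)"
    then show "\<exists>q. is_partition s q \<and> X = kap (fib E s) (a s) (sec_tens a q)"
      using assms by (intro exI[of _ "[s]"])
        (simp add: is_partition_def generating_def is_section_def tens_one_left)
  qed
qed

text \<open>For products along one common partition the factors expand alike; what is added is the
  second order remainder of the exponential.\<close>

lemma expansion_sec_tens:
  assumes a: "is_section a" and b: "is_section b" and "tangent a b L"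
  shows "expansion L (\<lambda>s X. \<exists>p. is_partition s p \<and> X = kap (fib E s) (sec_tens a p) (sec_tens b p))"
  unfolding expansion_def
proof (intro allI impI)
  fix e :: real assume e: "0 < e"
  then have e2: "0 < e / 2" by simp
  obtain d0 where d0: "0 < d0"
      "\<And>s X. \<lbrakk>0 \<le> s; s \<le> d0; X = kap (fib E s) (a s) (b s)\<rbrakk> \<Longrightarrow> norm (X - id_blinfun - s *\<^sub>R L) \<le> e / 2 * s"
    using expansionD[OF assms(3) e2] by blast
  define C where "C = norm L + e / 2"
  have C: "0 < C" using e by (simp add: C_def add_nonneg_pos)
  \<comment> \<open>For C s \<open>\<le>\<close> 1 the remainder exp(C s) - 1 - C s is at most (C
    s)^2, and the last entry makes this at most (e / 2) s.\<close>
  define d where "d = min d0 (min (1 / C) (e / 2 / C\<^sup>2))"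
  show "\<exists>d>0. \<forall>s X. 0 \<le> s \<longrightarrow> s \<le> d \<longrightarrow>
      (\<exists>p. is_partition s p \<and> X = kap (fib E s) (sec_tens a p) (sec_tens b p)) \<longrightarrow>
      norm (X - id_blinfun - s *\<^sub>R L) \<le> e * s"
  proof (rule exI[of _ d], intro conjI allI impI)
    show "0 < d" using d0 C e by (simp add: d_def)
    fix s X
    assume s: "0 \<le> s" "s \<le> d" and "\<exists>p. is_partition s p \<and> X = kap (fib E s) (sec_tens a p) (sec_tens b p)"
    then obtain p where p: "is_partition s p" "X = kap (fib E s) (sec_tens a p) (sec_tens b p)" by blast
    have "norm (kap (fib E x) (a x) (b x) - id_blinfun - x *\<^sub>R L) \<le> e / 2 * x" if "x \<in> set p" for x
      using that p s partition_le[OF p(1) that] by (intro d0(2)) (auto simp: is_partition_def d_def)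
    then have "norm (X - id_blinfun - s *\<^sub>R L) \<le> e / 2 * s + (exp (C * s) - 1 - C * s)"
      using kap_tens_list_expansion[OF blocks_partition[OF a p(1)] blocks_partition[OF b p(1)], of "e / 2" L] e p
      by (simp add: is_partition_def C_def)
    moreover have "exp (C * s) - 1 - C * s \<le> e / 2 * s"
    proof -
      have "s \<le> 1 / C" using s by (simp add: d_def)
      then have "C * s \<le> 1" using C by (simp add: field_simps)
      then have "exp (C * s) \<le> 1 + C * s + (C * s)\<^sup>2"
        using C s by (intro exp_bound) auto
      moreover have "s \<le> e / 2 / C\<^sup>2" using s by (simp add: d_def)
      then have "C\<^sup>2 * s \<le> e / 2" using C by (simp add: field_simps)
      then have "(C\<^sup>2 * s) * s \<le> e / 2 * s" using s by (intro mult_right_mono)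
      then have "(C * s)\<^sup>2 \<le> e / 2 * s" by (simp add: power2_eq_square mult_ac)
      ultimately show ?thesis by linarith
    qed
    ultimately show "norm (X - id_blinfun - s *\<^sub>R L) \<le> e * s" by (simp add: field_simps)
  qed
qed

lemma small_error:
  fixes e T l :: real
  assumes "0 < e" "0 \<le> T"
  obtains e' where "0 < e'" "2 * e' * T * exp ((l + e') * T) \<le> e"
proof -
  \<comment> \<open>T + 1 instead of \<open>T\<close> keeps \<open>D\<close> positive for T = 0; l +
    1 anticipates e' \<open>\<le>\<close> 1.\<close>
  define D where "D = 2 * (T + 1) * exp ((l + 1) * T)"
  have D: "0 < D" using assms by (simp add: D_def)
  define e' where "e' = min 1 (e / D)"
  have e': "0 < e'" "e' \<le> 1" using assms D by (auto simp: e'_def)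
  have "2 * e' * T * exp ((l + e') * T) \<le> 2 * e' * (T + 1) * exp ((l + 1) * T)"
    using assms e' by (intro mult_mono) (auto intro!: mult_right_mono)
  also have "\<dots> = e' * D" by (simp add: D_def)
  also have "\<dots> \<le> (e / D) * D" using D by (intro mult_right_mono) (auto simp: e'_def)
  also have "\<dots> = e" using D by simp
  finally show ?thesis using that e'(1) by blast
qed

section \<open>Convergence of products as the mesh tends to 0\<close>

text \<open>Both products are grouped by the blocks in \<open>qs\<close>. Over a block their
  operators, pure and mixed, all expand as id + s L + o(s), so the three operators of the whole
  products are close. Only the lengths of the blocks must be small.\<close>

lemma sec_tens_refinement:
  assumes gen: "generating a L" and T: "0 \<le> T" and e: "0 < e"
  shows "\<exists>d>0. \<forall>qs. (\<forall>q\<in>set qs. is_partition (sum_list q) q \<and> sum_list q \<le> d) \<longrightarrow>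
    sum_list (map sum_list qs) = T \<longrightarrow>
    mod_norm (fib E T) (sec_tens a (map sum_list qs) \<ominus>\<^bsub>fib E T\<^esub> sec_tens a (concat qs)) \<le> e"
proof -
  interpret M: hilbert_bimodule "fib E T" by (rule hilbert_bimodule_fib[OF T])
  have a: "is_section a" using gen by (simp add: generating_def)
  have mixed: "expansion L (\<lambda>s X. \<exists>q. is_partition s q \<and> X = kap (fib E s) (a s) (sec_tens a q))"
    using gen by (simp add: generating_def)
  \<comment> \<open>The squared distance is bounded by two operator differences, each granted half
    of \<open>e\<^sup>2\<close>.\<close>
  have "0 < e\<^sup>2 / 2" using e by simp
  then obtain e' where e': "0 < e'" "2 * e' * T * exp ((norm L + e') * T) \<le> e\<^sup>2 / 2"
    using T by (rule small_error)
  obtain d1 where d1: "0 < d1" "\<And>s X. \<lbrakk>0 \<le> s; s \<le> d1; \<exists>q. is_partition s q \<and> X = kap (fib E s) (a s) (sec_tens a q)\<rbrakk>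
      \<Longrightarrow> norm (X - id_blinfun - s *\<^sub>R L) \<le> e' * s"
    using expansionD[OF mixed e'(1)] by blast
  obtain d2 where d2: "0 < d2" "\<And>s X. \<lbrakk>0 \<le> s; s \<le> d2; X = kap (fib E s) (a s) (a s)\<rbrakk>
      \<Longrightarrow> norm (X - id_blinfun - s *\<^sub>R L) \<le> e' * s"
    using expansionD[OF tangent_of_generating[OF gen] e'(1)] by blast
  obtain d3 where d3: "0 < d3"
      "\<And>s X. \<lbrakk>0 \<le> s; s \<le> d3; \<exists>p. is_partition s p \<and> X = kap (fib E s) (sec_tens a p) (sec_tens a p)\<rbrakk>
      \<Longrightarrow> norm (X - id_blinfun - s *\<^sub>R L) \<le> e' * s"
    using expansionD[OF expansion_sec_tens[OF a a tangent_of_generating[OF gen]] e'(1)] by blast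
  show ?thesis
  proof (rule exI[of _ "min d1 (min d2 d3)"], intro conjI allI impI)
    fix qs
    assume qs: "\<forall>q\<in>set qs. is_partition (sum_list q) q \<and> sum_list q \<le> min d1 (min d2 d3)"
      and sum: "sum_list (map sum_list qs) = T"
    let ?f = "\<lambda>q. a (sum_list q)"
    have nonneg: "0 \<le> sum_list q" if "q \<in> set qs" for q
      using qs that by (auto simp: is_partition_def intro: sum_list_nonneg)
    have f: "blocks sum_list ?f qs" and g: "blocks sum_list (sec_tens a) qs"
      using qs nonneg a sec_tens_closed[OF a] by (auto simp: blocks_def is_section_def)
    have fg: "norm (kap (fib E (sum_list q)) (?f q) (sec_tens a q) - id_blinfun - sum_list q *\<^sub>R L) \<le> e' * sum_list q"
      and ff: "norm (kap (fib E (sum_list q)) (?f q) (?f q) - id_blinfun - sum_list q *\<^sub>R L) \<le> e' * sum_list q"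
      and gg: "norm (kap (fib E (sum_list q)) (sec_tens a q) (sec_tens a q) - id_blinfun - sum_list q *\<^sub>R L) \<le> e' * sum_list q"
      if "q \<in> set qs" for q
    proof -
      have q: "is_partition (sum_list q) q" "0 \<le> sum_list q" "sum_list q \<le> d1" "sum_list q \<le> d2" "sum_list q \<le> d3"
        using that qs nonneg by auto
      show "norm (kap (fib E (sum_list q)) (?f q) (sec_tens a q) - id_blinfun - sum_list q *\<^sub>R L) \<le> e' * sum_list q"
        using q by (intro d1(2)) blast+
      show "norm (kap (fib E (sum_list q)) (?f q) (?f q) - id_blinfun - sum_list q *\<^sub>R L) \<le> e' * sum_list q"
        using q by (intro d2(2)) blast+
      show "norm (kap (fib E (sum_list q)) (sec_tens a q) (sec_tens a q) - id_blinfun - sum_list q *\<^sub>R L) \<le> e' * sum_list q"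
        using q by (intro d3(2)) blast+
    qed
    let ?P = "sec_tens a (map sum_list qs)" and ?Q = "sec_tens a (concat qs)"
    have P: "tens_list E sum_list ?f qs = ?P" by (simp add: tens_list_map o_def)
    have Q: "tens_list E sum_list (sec_tens a) qs = ?Q"
    proof -
      have "blocks (\<lambda>x. x) a (concat qs)"
        using qs a by (auto simp: blocks_def is_section_def is_partition_def)
      then show ?thesis by (simp add: tens_list_concat)
    qed
    have carr: "?P \<in> carrier (fib E T)" "?Q \<in> carrier (fib E T)"
      using tens_list_closed[OF f] tens_list_closed[OF g] by (simp_all add: P Q sum)
    have e'0: "0 \<le> e'" using e' by simp
    have 1: "norm (kap (fib E T) ?P ?P - kap (fib E T) ?P ?Q) \<le> e\<^sup>2 / 2"
      using kap_tens_list_diff[OF f f f g e'0 ff fg] e'(2) by (simp add: P Q sum)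
    have 2: "norm (kap (fib E T) ?Q ?Q - kap (fib E T) ?P ?Q) \<le> e\<^sup>2 / 2"
      using kap_tens_list_diff[OF g g f g e'0 gg fg] e'(2) by (simp add: P Q sum)
    have "(mod_norm (fib E T) (?P \<ominus>\<^bsub>fib E T\<^esub> ?Q))\<^sup>2 \<le> e\<^sup>2 / 2 + e\<^sup>2 / 2"
      by (rule order_trans[OF M.mod_norm_minus_power2_le[OF carr] add_mono[OF 1 2]])
    then have "(mod_norm (fib E T) (?P \<ominus>\<^bsub>fib E T\<^esub> ?Q))\<^sup>2 \<le> e\<^sup>2" by simp
    then show "mod_norm (fib E T) (?P \<ominus>\<^bsub>fib E T\<^esub> ?Q) \<le> e"
      by (rule power2_le_imp_le) (use e in simp)
  qed (use d1 d2 d3 in auto)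
qed

text \<open>Both products are compared with the product along a common refinement.\<close>

lemma sec_tens_Cauchy:
  assumes gen: "generating a L" and t: "0 \<le> t" and e: "0 < e"
  shows "\<exists>d>0. \<forall>p p'. is_partition t p \<longrightarrow> is_partition t p' \<longrightarrow> (\<forall>x\<in>set p. x \<le> d) \<longrightarrow> (\<forall>x\<in>set p'. x \<le> d) \<longrightarrow>
    mod_norm (fib E t) (sec_tens a p \<ominus>\<^bsub>fib E t\<^esub> sec_tens a p') \<le> e"
proof -
  interpret M: hilbert_bimodule "fib E t" by (rule hilbert_bimodule_fib[OF t])
  have a: "is_section a" using gen by (simp add: generating_def)
  from e have "0 < e / 2" by simp
  from sec_tens_refinement[OF gen t this] obtain d where d: "0 < d"
    "\<And>qs. \<lbrakk>\<forall>q\<in>set qs. is_partition (sum_list q) q \<and> sum_list q \<le> d; sum_list (map sum_list qs) = t\<rbrakk> \<Longrightarrow>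
      mod_norm (fib E t) (sec_tens a (map sum_list qs) \<ominus>\<^bsub>fib E t\<^esub> sec_tens a (concat qs)) \<le> e / 2"
    by blast
  show ?thesis
  proof (rule exI[of _ d], intro conjI allI impI)
    fix p p'
    assume p: "is_partition t p" "is_partition t p'" "\<forall>x\<in>set p. x \<le> d" "\<forall>x\<in>set p'. x \<le> d"
    then obtain qs qs' where q: "concat qs = concat qs'" "map sum_list qs = p" "map sum_list qs' = p'"
        "\<forall>x\<in>set (concat qs). 0 \<le> x"
      using common_refinement[of p p'] unfolding is_partition_def by metis
    have 1: "mod_norm (fib E t) (sec_tens a p \<ominus>\<^bsub>fib E t\<^esub> sec_tens a (concat qs)) \<le> e / 2"
      unfolding q(2)[symmetric]
    proof (rule d(2))
      show "\<forall>q\<in>set qs. is_partition (sum_list q) q \<and> sum_list q \<le> d"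
        using p(3) q(2,4) by (auto simp: is_partition_def)
      show "sum_list (map sum_list qs) = t" using p(1) q(2) by (simp add: is_partition_def)
    qed
    have 2: "mod_norm (fib E t) (sec_tens a p' \<ominus>\<^bsub>fib E t\<^esub> sec_tens a (concat qs)) \<le> e / 2"
      unfolding q(3)[symmetric] q(1)
    proof (rule d(2))
      show "\<forall>q\<in>set qs'. is_partition (sum_list q) q \<and> sum_list q \<le> d"
        using p(4) q(3,4) by (auto simp: is_partition_def q(1))
      show "sum_list (map sum_list qs') = t" using p(2) q(3) by (simp add: is_partition_def)
    qed
    have "is_partition t (concat qs)"
    proof -
      have "sum_list (concat qs) = sum_list (map sum_list qs)" by (induction qs) auto
      then show ?thesis using p(1) q(2,4) by (simp add: is_partition_def)
    qed
    then have carr: "sec_tens a p \<in> carrier (fib E t)" "sec_tens a p' \<in> carrier (fib E t)"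
        "sec_tens a (concat qs) \<in> carrier (fib E t)"
      using p(1,2) sec_tens_closed[OF a] by blast+
    show "mod_norm (fib E t) (sec_tens a p \<ominus>\<^bsub>fib E t\<^esub> sec_tens a p') \<le> e"
      using M.mod_norm_triangle[OF carr(1,3,2)] M.mod_norm_minus_commute[OF carr(3,2)] 1 2 by linarith
  qed (rule d)
qed

text \<open>The limit over all partitions of small mesh, not only equidistant ones: joining
  equidistant partitions of s and t need not give one of s + t.\<close>

definition sec_limit :: "(real \<Rightarrow> 'e) \<Rightarrow> real \<Rightarrow> 'e \<Rightarrow> bool" where
  "sec_limit a t x \<longleftrightarrow> x \<in> carrier (fib E t) \<and>
    (\<forall>e>0. \<exists>d>0. \<forall>p. is_partition t p \<longrightarrow> (\<forall>y\<in>set p. y \<le> d) \<longrightarrow>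
      mod_norm (fib E t) (sec_tens a p \<ominus>\<^bsub>fib E t\<^esub> x) \<le> e)"

lemma sec_limit_sequentially:
  assumes "sec_limit a t x" "\<And>n. is_partition t (P n)"
    and mesh: "\<And>d. 0 < d \<Longrightarrow> \<exists>N. \<forall>n\<ge>N. \<forall>y\<in>set (P n). y \<le> d"
  shows "(\<lambda>n. mod_norm (fib E t) (sec_tens a (P n) \<ominus>\<^bsub>fib E t\<^esub> x)) \<longlonglongrightarrow> 0"
proof (rule LIMSEQ_I)
  fix e :: real assume "0 < e"
  then have "0 < e / 2" by simp
  then obtain d where d: "0 < d" "\<And>p. \<lbrakk>is_partition t p; \<forall>y\<in>set p. y \<le> d\<rbrakk> \<Longrightarrow>
      mod_norm (fib E t) (sec_tens a p \<ominus>\<^bsub>fib E t\<^esub> x) \<le> e / 2"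
    using assms(1) unfolding sec_limit_def by meson
  obtain N where "\<forall>n\<ge>N. \<forall>y\<in>set (P n). y \<le> d" using mesh[OF d(1)] by blast
  then have "\<forall>n\<ge>N. norm (mod_norm (fib E t) (sec_tens a (P n) \<ominus>\<^bsub>fib E t\<^esub> x) - 0) < e"
    using d(2)[OF assms(2)] \<open>0 < e\<close> by fastforce
  then show "\<exists>N. \<forall>n\<ge>N. norm (mod_norm (fib E t) (sec_tens a (P n) \<ominus>\<^bsub>fib E t\<^esub> x) - 0) < e"
    by blast
qed

lemmas sec_limit_equi = sec_limit_sequentially[OF _ is_partition_equi_partition equi_partition_mesh]

lemma tens_power_eq_sec_tens: "tens_power E s (a s) m = sec_tens a (replicate m s)"
  by (induction m) (simp_all add: sum_list_replicate)

lemma ex_sec_limit: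
  assumes gen: "generating a L" and t: "0 \<le> t"
  shows "\<exists>x. sec_limit a t x"
proof -
  interpret M: hilbert_bimodule "fib E t" by (rule hilbert_bimodule_fib[OF t])
  have a: "is_section a" using gen by (simp add: generating_def)
  let ?X = "\<lambda>n. sec_tens a (equi_partition t n)"
  have carr: "?X n \<in> carrier (fib E t)" for n
    by (rule sec_tens_closed[OF a is_partition_equi_partition[OF t]])
  obtain x where x: "x \<in> carrier (fib E t)" "(\<lambda>n. mod_norm (fib E t) (?X n \<ominus>\<^bsub>fib E t\<^esub> x)) \<longlonglongrightarrow> 0"
  proof (rule M.mod_norm_complete[of ?X])
    fix e :: real assume "0 < e"
    then have "0 < e / 2" by simp
    from sec_tens_Cauchy[OF gen t this] obtain d where d: "0 < d"
      "\<And>p p'. \<lbrakk>is_partition t p; is_partition t p'; \<forall>x\<in>set p. x \<le> d; \<forall>x\<in>set p'. x \<le> d\<rbrakk> \<Longrightarrow>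
        mod_norm (fib E t) (sec_tens a p \<ominus>\<^bsub>fib E t\<^esub> sec_tens a p') \<le> e / 2" by blast
    obtain N where N: "\<forall>n\<ge>N. \<forall>y\<in>set (equi_partition t n). y \<le> d"
      using equi_partition_mesh[OF t d(1)] by blast
    have "mod_norm (fib E t) (?X m \<ominus>\<^bsub>fib E t\<^esub> ?X n) < e" if "N \<le> m" "N \<le> n" for m n
    proof -
      have "mod_norm (fib E t) (?X m \<ominus>\<^bsub>fib E t\<^esub> ?X n) \<le> e / 2"
        using N that by (intro d(2) is_partition_equi_partition t) auto
      then show ?thesis using \<open>0 < e\<close> by linarith
    qed
    then show "\<exists>N. \<forall>m\<ge>N. \<forall>n\<ge>N. mod_norm (fib E t) (?X m \<ominus>\<^bsub>fib E t\<^esub> ?X n) < e" by blast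
  qed (rule carr)
  have "\<exists>d>0. \<forall>p. is_partition t p \<longrightarrow> (\<forall>y\<in>set p. y \<le> d) \<longrightarrow>
      mod_norm (fib E t) (sec_tens a p \<ominus>\<^bsub>fib E t\<^esub> x) \<le> e" if "0 < e" for e
  proof -
    have "0 < e / 2" using that by simp
    from sec_tens_Cauchy[OF gen t this] obtain d where d: "0 < d"
      "\<And>p p'. \<lbrakk>is_partition t p; is_partition t p'; \<forall>x\<in>set p. x \<le> d; \<forall>x\<in>set p'. x \<le> d\<rbrakk> \<Longrightarrow>
        mod_norm (fib E t) (sec_tens a p \<ominus>\<^bsub>fib E t\<^esub> sec_tens a p') \<le> e / 2" by blast
    obtain N where N: "\<forall>n\<ge>N. \<forall>y\<in>set (equi_partition t n). y \<le> d"
      using equi_partition_mesh[OF t d(1)] by blast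
    obtain N' where N': "\<forall>n\<ge>N'. mod_norm (fib E t) (?X n \<ominus>\<^bsub>fib E t\<^esub> x) < e / 2"
      using order_tendstoD(2)[OF x(2) \<open>0 < e / 2\<close>] by (auto simp: eventually_sequentially)
    define n where "n = max N N'"
    have "mod_norm (fib E t) (sec_tens a p \<ominus>\<^bsub>fib E t\<^esub> x) \<le> e" if p: "is_partition t p" "\<forall>y\<in>set p. y \<le> d" for p
    proof -
      have "mod_norm (fib E t) (sec_tens a p \<ominus>\<^bsub>fib E t\<^esub> ?X n) \<le> e / 2"
      proof (intro d(2) is_partition_equi_partition t)
        show "\<forall>y\<in>set (equi_partition t n). y \<le> d" using N unfolding n_def by (meson max.cobounded1)
      qed (use p in auto)
      moreover have "mod_norm (fib E t) (?X n \<ominus>\<^bsub>fib E t\<^esub> x) < e / 2"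
        using N' by (simp add: n_def)
      ultimately show ?thesis
        using M.mod_norm_triangle[OF sec_tens_closed[OF a p(1)] carr x(1), of n] by linarith
    qed
    then show ?thesis using d(1) by blast
  qed
  with x(1) show ?thesis unfolding sec_limit_def by blast
qed

lemma sec_limit_limit_unit:
  assumes gen: "generating a L" and t: "0 \<le> t"
  shows "sec_limit a t (limit_unit E a t)"
proof -
  interpret M: hilbert_bimodule "fib E t" by (rule hilbert_bimodule_fib[OF t])
  have a: "is_section a" using gen by (simp add: generating_def)
  obtain x where x: "sec_limit a t x" using ex_sec_limit[OF gen t] ..
  have xc: "x \<in> carrier (fib E t)" using x by (simp add: sec_limit_def)
  let ?Y = "\<lambda>m. tens_power E (t / real m) (a (t / real m)) m"
  \<comment> \<open>From m = 1 on, the terms of \<open>limit_unit\<close> are products along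
    equidistant partitions.\<close>
  have Y: "?Y (Suc n) = sec_tens a (equi_partition t n)" for n
    unfolding tens_power_eq_sec_tens equi_partition_def ..
  have "bimod_lim (fib E t) ?Y = x"
  proof (rule M.bimod_lim_eq)
    have "\<forall>\<^sub>F n in sequentially. ?Y (Suc n) \<in> carrier (fib E t)"
      unfolding Y by (simp add: sec_tens_closed[OF a is_partition_equi_partition[OF t]])
    then show "\<forall>\<^sub>F n in sequentially. ?Y n \<in> carrier (fib E t)"
      by (rule eventually_sequentially_Suc[THEN iffD1])
    have "(\<lambda>n. mod_norm (fib E t) (?Y (Suc n) \<ominus>\<^bsub>fib E t\<^esub> x)) \<longlonglongrightarrow> 0"
      unfolding Y by (rule sec_limit_equi[OF x t t])
    then show "(\<lambda>n. mod_norm (fib E t) (?Y n \<ominus>\<^bsub>fib E t\<^esub> x)) \<longlonglongrightarrow> 0"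
      by (rule LIMSEQ_imp_Suc)
  qed (rule xc)
  then show ?thesis using x t by (simp add: limit_unit_def)
qed

lemma mod_norm_limit_unique:
  assumes "0 \<le> t" "x \<in> carrier (fib E t)" "y \<in> carrier (fib E t)" "\<And>n. X n \<in> carrier (fib E t)"
    and "(\<lambda>n. mod_norm (fib E t) (X n \<ominus>\<^bsub>fib E t\<^esub> x)) \<longlonglongrightarrow> 0"
    and "(\<lambda>n. mod_norm (fib E t) (X n \<ominus>\<^bsub>fib E t\<^esub> y)) \<longlonglongrightarrow> 0"
  shows "x = y"
proof -
  interpret M: hilbert_bimodule "fib E t" by (rule hilbert_bimodule_fib[OF assms(1)])
  have "bimod_lim (fib E t) X = x" "bimod_lim (fib E t) X = y"
    using assms by (auto intro!: M.bimod_lim_eq)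
  then show ?thesis by simp
qed

text \<open>Multiplicativity holds exactly for concatenated partitions and passes to the limit,
  since the mesh of the concatenation also tends to 0.\<close>

lemma limit_unit_in_units:
  assumes gen: "generating a L"
  shows "limit_unit E a \<in> units_of_ps E"
proof -
  define z where "z = limit_unit E a"
  have a: "is_section a" using gen by (simp add: generating_def)
  have z: "sec_limit a t (z t)" if "0 \<le> t" for t
    unfolding z_def using gen that by (rule sec_limit_limit_unit)
  have zc: "z t \<in> carrier (fib E t)" if "0 \<le> t" for t
    using z[OF that] by (simp add: sec_limit_def)
  \<comment> \<open>The empty partition of 0 has every mesh, so its product is already the
    limit.\<close>
  have z0: "z 0 = unit_iso E 1"
  proof (rule mod_norm_limit_unique)
    show "(\<lambda>n. mod_norm (fib E 0) (sec_tens a [] \<ominus>\<^bsub>fib E 0\<^esub> z 0)) \<longlonglongrightarrow> 0"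
      by (rule sec_limit_sequentially[OF z]) (auto simp: is_partition_def)
    interpret M: hilbert_bimodule "fib E 0" by (rule hilbert_bimodule_fib) simp
    show "(\<lambda>n. mod_norm (fib E 0) (sec_tens a [] \<ominus>\<^bsub>fib E 0\<^esub> unit_iso E 1)) \<longlonglongrightarrow> 0"
      by (simp add: M.mod_norm_minus_self unit_iso_closed)
  qed (simp_all add: zc unit_iso_closed)
  have mult: "tens E s t (z s) (z t) = z (s + t)" if s: "0 \<le> s" and t: "0 \<le> t" for s t
  proof -
    interpret T: hilbert_bimodule "fib E t" by (rule hilbert_bimodule_fib[OF t])
    interpret ST: hilbert_bimodule "fib E (s + t)" by (rule hilbert_bimodule_fib) (use s t in simp)
    let ?P = "\<lambda>n. sec_tens a (equi_partition s n)" and ?Q = "\<lambda>n. sec_tens a (equi_partition t n)"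
    \<comment> \<open>Lists are multiplied from their end, so the part for \<open>t\<close>, the
      right factor, stands first.\<close>
    let ?R = "\<lambda>n. equi_partition t n @ equi_partition s n"
    have ps: "is_partition s (equi_partition s n)" and pt: "is_partition t (equi_partition t n)" for n
      using s t by (auto intro: is_partition_equi_partition)
    have Pc: "?P n \<in> carrier (fib E s)" and Qc: "?Q n \<in> carrier (fib E t)" for n
      using sec_tens_closed[OF a ps] sec_tens_closed[OF a pt] by auto
    have R: "is_partition (s + t) (?R n)" for n
      using ps[of n] pt[of n] by (auto simp: is_partition_def)
    have Rt: "sec_tens a (?R n) = tens E s t (?P n) (?Q n)" for n
      using tens_list_append[OF blocks_partition[OF a R]] ps[of n] pt[of n] by (simp add: is_partition_def)
    have limP: "(\<lambda>n. mod_norm (fib E s) (?P n \<ominus>\<^bsub>fib E s\<^esub> z s)) \<longlonglongrightarrow> 0"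
      by (rule sec_limit_equi[OF z]) (use s in auto)
    have limQ: "(\<lambda>n. mod_norm (fib E t) (?Q n \<ominus>\<^bsub>fib E t\<^esub> z t)) \<longlonglongrightarrow> 0"
      by (rule sec_limit_equi[OF z]) (use t in auto)
    show ?thesis
    proof (rule mod_norm_limit_unique)
      show "(\<lambda>n. mod_norm (fib E (s + t)) (sec_tens a (?R n) \<ominus>\<^bsub>fib E (s + t)\<^esub> z (s + t))) \<longlonglongrightarrow> 0"
      proof (rule sec_limit_sequentially[OF z R])
        fix d :: real assume "0 < d"
        obtain N where "\<forall>n\<ge>N. \<forall>x\<in>set (equi_partition s n). x \<le> d" using equi_partition_mesh[OF s \<open>0 < d\<close>] ..
        moreover obtain N' where "\<forall>n\<ge>N'. \<forall>x\<in>set (equi_partition t n). x \<le> d" using equi_partition_mesh[OF t \<open>0 < d\<close>] ..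
        ultimately show "\<exists>N. \<forall>n\<ge>N. \<forall>x\<in>set (?R n). x \<le> d"
          by (intro exI[of _ "max N N'"]) auto
      qed (use s t in simp)
      show "(\<lambda>n. mod_norm (fib E (s + t)) (sec_tens a (?R n) \<ominus>\<^bsub>fib E (s + t)\<^esub> tens E s t (z s) (z t))) \<longlonglongrightarrow> 0"
      proof (rule Lim_null_comparison)
        let ?b = "\<lambda>n. mod_norm (fib E s) (?P n \<ominus>\<^bsub>fib E s\<^esub> z s) * (mod_norm (fib E t) (?Q n \<ominus>\<^bsub>fib E t\<^esub> z t) + mod_norm (fib E t) (z t))
          + mod_norm (fib E s) (z s) * mod_norm (fib E t) (?Q n \<ominus>\<^bsub>fib E t\<^esub> z t)"
        have "mod_norm (fib E (s + t)) (sec_tens a (?R n) \<ominus>\<^bsub>fib E (s + t)\<^esub> tens E s t (z s) (z t)) \<le> ?b n" for n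
        proof -
          have "mod_norm (fib E (s + t)) (sec_tens a (?R n) \<ominus>\<^bsub>fib E (s + t)\<^esub> tens E s t (z s) (z t)) \<le>
            mod_norm (fib E s) (?P n \<ominus>\<^bsub>fib E s\<^esub> z s) * mod_norm (fib E t) (?Q n)
            + mod_norm (fib E s) (z s) * mod_norm (fib E t) (?Q n \<ominus>\<^bsub>fib E t\<^esub> z t)"
            unfolding Rt by (rule mod_norm_tens_minus_le) (use s t Pc Qc zc in auto)
          also have "\<dots> \<le> ?b n"
            using Qc zc t by (intro add_right_mono mult_left_mono T.mod_norm_le_minus_add) auto
          finally show ?thesis .
        qed
        then show "\<forall>\<^sub>F n in sequentially. norm (mod_norm (fib E (s + t)) (sec_tens a (?R n) \<ominus>\<^bsub>fib E (s + t)\<^esub> tens E s t (z s) (z t))) \<le> ?b n"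
          by simp
        show "?b \<longlonglongrightarrow> 0" using limP limQ by (auto intro!: tendsto_eq_intros)
      qed
      show "sec_tens a (?R n) \<in> carrier (fib E (s + t))" for n by (rule sec_tens_closed[OF a R])
    qed (use s t zc in \<open>auto intro: tens_closed\<close>)
  qed
  have "z \<in> (\<Pi>\<^sub>E t\<in>{0..}. carrier (fib E t))"
    using zc by (auto simp: z_def limit_unit_def)
  then have "z \<in> units_of_ps E"
    using z0 mult by (simp add: units_of_ps_def)
  then show ?thesis by (simp add: z_def)
qed

section \<open>Generators of limits, and uniqueness of units\<close>

lemma unit_is_section: "u \<in> units_of_ps E \<Longrightarrow> is_section u"
  by (auto simp: units_of_ps_def is_section_def)

lemma unit_sec_tens:
  assumes "u \<in> units_of_ps E" "is_partition t p"
  shows "sec_tens u p = u t"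
  using assms(2)
proof (induction p arbitrary: t)
  case Nil
  then show ?case using assms(1) by (simp add: is_partition_def units_of_ps_def)
next
  case (Cons x p)
  have "is_partition (sum_list p) p" using Cons.prems by (simp add: is_partition_def)
  then have IH: "sec_tens u p = u (sum_list p)" by (rule Cons.IH)
  have "0 \<le> sum_list p" "0 \<le> x"
    using Cons.prems by (auto simp: is_partition_def intro: sum_list_nonneg)
  then show ?case using assms(1) Cons.prems by (simp add: IH units_of_ps_def is_partition_def add.commute)
qed

text \<open>The bound e s is uniform over the partitions of s, hence survives as the mesh tends to 0
  with s fixed.\<close>

lemma tangent_limit:
  assumes ab: "is_section a" "is_section b" "tangent a b L"
    and u: "\<And>s. 0 \<le> s \<Longrightarrow> sec_limit a s (u s)" and v: "\<And>s. 0 \<le> s \<Longrightarrow> sec_limit b s (v s)"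
  shows "tangent u v L"
  unfolding expansion_def
proof (intro allI impI)
  fix e :: real assume e: "0 < e"
  obtain d where d: "0 < d"
    "\<And>s X. \<lbrakk>0 \<le> s; s \<le> d; \<exists>p. is_partition s p \<and> X = kap (fib E s) (sec_tens a p) (sec_tens b p)\<rbrakk> \<Longrightarrow>
      norm (X - id_blinfun - s *\<^sub>R L) \<le> e * s"
    using expansionD[OF expansion_sec_tens[OF ab] e] by blast
  show "\<exists>d>0. \<forall>s X. 0 \<le> s \<longrightarrow> s \<le> d \<longrightarrow> X = kap (fib E s) (u s) (v s) \<longrightarrow> norm (X - id_blinfun - s *\<^sub>R L) \<le> e * s"
  proof (rule exI[of _ d], intro conjI allI impI)
    fix s X assume s: "0 \<le> s" "s \<le> d" and X: "X = kap (fib E s) (u s) (v s)"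
    interpret M: hilbert_bimodule "fib E s" by (rule hilbert_bimodule_fib[OF s(1)])
    let ?X = "\<lambda>n. kap (fib E s) (sec_tens a (equi_partition s n)) (sec_tens b (equi_partition s n))"
    have p: "is_partition s (equi_partition s n)" for n by (rule is_partition_equi_partition[OF s(1)])
    have "?X \<longlonglongrightarrow> X"
      unfolding X using u[OF s(1)] v[OF s(1)]
      by (intro M.tendsto_kap sec_tens_closed[OF ab(1) p] sec_tens_closed[OF ab(2) p]
          sec_limit_equi[OF u s(1) s(1)] sec_limit_equi[OF v s(1) s(1)])
        (auto simp: sec_limit_def s)
    then have lim: "(\<lambda>n. norm (?X n - id_blinfun - s *\<^sub>R L)) \<longlonglongrightarrow> norm (X - id_blinfun - s *\<^sub>R L)"
      by (intro tendsto_intros)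
    show "norm (X - id_blinfun - s *\<^sub>R L) \<le> e * s"
      by (rule LIMSEQ_le_const2[OF lim]) (use d(2)[OF s] p in blast)
  qed (rule d)
qed

lemma sec_limit_unit:
  assumes "u \<in> units_of_ps E" "0 \<le> t"
  shows "sec_limit u t (u t)"
proof -
  interpret M: hilbert_bimodule "fib E t" by (rule hilbert_bimodule_fib[OF assms(2)])
  have c: "u t \<in> carrier (fib E t)" using unit_is_section[OF assms(1)] assms(2) by (simp add: is_section_def)
  then have "mod_norm (fib E t) (u t \<ominus>\<^bsub>fib E t\<^esub> u t) = 0"
    by (rule M.mod_norm_minus_self)
  with c show ?thesis
    unfolding sec_limit_def using unit_sec_tens[OF assms(1)] by (auto intro!: exI[of _ 1])
qed

lemma tangent_limit_unit:
  assumes gen: "generating a L"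
  shows "tangent (limit_unit E a) (limit_unit E a) L"
    and "\<lbrakk>u \<in> units_of_ps E; tangent a u L'\<rbrakk> \<Longrightarrow> tangent (limit_unit E a) u L'"
    and "\<lbrakk>u \<in> units_of_ps E; tangent u a L'\<rbrakk> \<Longrightarrow> tangent u (limit_unit E a) L'"
proof -
  have a: "is_section a" using gen by (simp add: generating_def)
  note lim = sec_limit_limit_unit[OF gen]
  show "tangent (limit_unit E a) (limit_unit E a) L"
    by (rule tangent_limit[OF a a tangent_of_generating[OF gen] lim lim])
  show "tangent (limit_unit E a) u L'" if "u \<in> units_of_ps E" "tangent a u L'"
    by (rule tangent_limit[OF a unit_is_section[OF that(1)] that(2) lim sec_limit_unit[OF that(1)]])
  show "tangent u (limit_unit E a) L'" if "u \<in> units_of_ps E" "tangent u a L'"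
    by (rule tangent_limit[OF unit_is_section[OF that(1)] a that(2) sec_limit_unit[OF that(1)] lim])
qed

text \<open>Uniqueness of the semigroup with a given generator: along a fine partition both sides
  are compositions of operators that agree to first order.\<close>

lemma kap_unit_eq_of_tangent:
  assumes units: "u \<in> units_of_ps E" "v \<in> units_of_ps E" "u' \<in> units_of_ps E" "v' \<in> units_of_ps E"
    and uv: "tangent u v L" and uv': "tangent u' v' L" and t: "0 \<le> t"
  shows "kap (fib E t) (u t) (v t) = kap (fib E t) (u' t) (v' t)"
proof -
  have "norm (kap (fib E t) (u t) (v t) - kap (fib E t) (u' t) (v' t)) \<le> 0"
  proof (rule field_le_epsilon)
    fix e :: real assume "0 < e"
    then obtain e' where e': "0 < e'" "2 * e' * t * exp ((norm L + e') * t) \<le> e"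
      using t by (rule small_error)
    obtain d where d: "0 < d" "\<And>s X. \<lbrakk>0 \<le> s; s \<le> d; X = kap (fib E s) (u s) (v s)\<rbrakk> \<Longrightarrow>
        norm (X - id_blinfun - s *\<^sub>R L) \<le> e' * s"
      using expansionD[OF uv e'(1)] by blast
    obtain d' where d': "0 < d'" "\<And>s X. \<lbrakk>0 \<le> s; s \<le> d'; X = kap (fib E s) (u' s) (v' s)\<rbrakk> \<Longrightarrow>
        norm (X - id_blinfun - s *\<^sub>R L) \<le> e' * s"
      using expansionD[OF uv' e'(1)] by blast
    obtain n where n: "\<forall>x\<in>set (equi_partition t n). x \<le> min d d'"
      using equi_partition_mesh[OF t, of "min d d'"] d d' by auto
    have p: "is_partition t (equi_partition t n)" by (rule is_partition_equi_partition[OF t])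
    have 1: "norm (kap (fib E x) (u x) (v x) - id_blinfun - x *\<^sub>R L) \<le> e' * x"
      and 2: "norm (kap (fib E x) (u' x) (v' x) - id_blinfun - x *\<^sub>R L) \<le> e' * x"
      if "x \<in> set (equi_partition t n)" for x
    proof -
      have x: "0 \<le> x" "x \<le> d" "x \<le> d'" using that n p by (auto simp: is_partition_def)
      show "norm (kap (fib E x) (u x) (v x) - id_blinfun - x *\<^sub>R L) \<le> e' * x"
        by (rule d(2)[OF x(1,2) refl])
      show "norm (kap (fib E x) (u' x) (v' x) - id_blinfun - x *\<^sub>R L) \<le> e' * x"
        by (rule d'(2)[OF x(1,3) refl])
    qed
    have e'0: "0 \<le> e'" using e' by simp
    note b = blocks_partition[OF unit_is_section p]
    show "norm (kap (fib E t) (u t) (v t) - kap (fib E t) (u' t) (v' t)) \<le> 0 + e"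
      using kap_tens_list_diff[OF b b b b e'0 1 2, OF units] p e'(2)
      by (simp add: unit_sec_tens[OF _ p] units is_partition_def)
  qed
  then show ?thesis by simp
qed

text \<open>The operators of (u, u), (u, v) and (v, v) then coincide at all times, so u - v has norm
  0.\<close>

lemma unit_eqI:
  assumes "u \<in> units_of_ps E" "v \<in> units_of_ps E"
    and "tangent u u L" "tangent u v L" "tangent v v L"
  shows "u = v"
proof
  fix t
  show "u t = v t"
  proof (cases "0 \<le> t")
    case t: True
    interpret M: hilbert_bimodule "fib E t" by (rule hilbert_bimodule_fib[OF t])
    have c: "u t \<in> carrier (fib E t)" "v t \<in> carrier (fib E t)"
      using assms(1,2) t unit_is_section by (auto simp: is_section_def)
    have "kap (fib E t) (u t) (u t) = kap (fib E t) (u t) (v t)" "kap (fib E t) (v t) (v t) = kap (fib E t) (u t) (v t)"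
      using assms t by (auto intro: kap_unit_eq_of_tangent)
    then have "mod_norm (fib E t) (u t \<ominus>\<^bsub>fib E t\<^esub> v t) = 0"
      using M.mod_norm_minus_power2_le[OF c] by simp
    then show ?thesis
      using M.mod_norm_eq_0 M.minus_eq_zero_iff c by simp
  next
    case False
    then show ?thesis
      using assms(1,2) PiE_arb[of u "{0..}" _ t] PiE_arb[of v "{0..}" _ t] by (auto simp: units_of_ps_def)
  qed
qed

end

section \<open>Uniformly continuous semigroups\<close>

text \<open>The Neumann series of \<open>A\<close>, obtained as a fixed point of J = id + (id - A)
  J.\<close>

lemma ex_blinfun_right_inverse:
  fixes A :: "'a::banach \<Rightarrow>\<^sub>L 'a"
  assumes "norm (id_blinfun - A) < 1"
  obtains J where "A o\<^sub>L J = id_blinfun"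
proof -
  define f where "f J = id_blinfun + ((id_blinfun - A) o\<^sub>L J)" for J :: "'a \<Rightarrow>\<^sub>L 'a"
  have "dist (f X) (f Y) \<le> norm (id_blinfun - A) * dist X Y" for X Y
  proof -
    have "f X - f Y = (id_blinfun - A) o\<^sub>L (X - Y)"
      by (rule blinfun_eqI) (simp add: f_def blinfun.bilinear_simps)
    then show ?thesis by (simp add: dist_norm norm_blinfun_compose)
  qed
  then have "\<exists>!J. f J = J"
    using assms by (intro banach_fix_type[of "norm (id_blinfun - A)"]) auto
  then obtain J where J: "f J = J" by blast
  have "A o\<^sub>L J = id_blinfun"
  proof (rule blinfun_eqI)
    fix x
    have "f J x = J x" by (simp add: J)
    then show "(A o\<^sub>L J) x = id_blinfun x" by (simp add: f_def blinfun.bilinear_simps)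
  qed
  then show ?thesis by (rule that)
qed

text \<open>
  With \<open>G\<close> the primitive of \<open>K\<close>, \<open>K\<^sub>t G(d) = G(t + d) - G(t)\<close>, and \<open>G(d)\<close> has a right inverse
  for small \<open>d\<close>; so \<open>K\<close> is as smooth as \<open>G\<close>.
\<close>

lemma continuous_semigroup_expansion:
  fixes K :: "real \<Rightarrow> ('a::banach \<Rightarrow>\<^sub>L 'a)"
  assumes K0: "K 0 = id_blinfun"
    and mult: "\<And>s t. \<lbrakk>0 \<le> s; 0 \<le> t\<rbrakk> \<Longrightarrow> K (s + t) = K t o\<^sub>L K s"
    and cont: "continuous_on {0..} K"
  shows "\<exists>L. expansion L (\<lambda>s X. X = K s)"
proof -
  have cont': "continuous_on {a..b} K" if "0 \<le> a" for a b
    by (rule continuous_on_subset[OF cont]) (use that in auto)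
  obtain d0 where d0: "0 < d0" "\<And>s. \<lbrakk>0 \<le> s; s < d0\<rbrakk> \<Longrightarrow> norm (K s - id_blinfun) < 1 / 2"
    using cont[unfolded continuous_on_iff, rule_format, of 0 "1 / 2"] by (auto simp: dist_norm K0)
  \<comment> \<open>d < d0 makes \<open>G d\<close> / d invertible from the right; d
    \<open>\<le>\<close> 1 keeps t + d within [0, 2], where \<open>G\<close> is
    differentiated.\<close>
  define d where "d = min 1 (d0 / 2)"
  have d: "0 < d" "d \<le> 1" "d < d0" using d0 by (auto simp: d_def min_def)
  define G where "G u = integral {0..u} K" for u
  have int: "K integrable_on {a..b}" if "0 \<le> a" for a b
    using cont'[OF that] by (rule integrable_continuous_real)
  have "norm (id_blinfun - (1 / d) *\<^sub>R G d) < 1"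
  proof -
    have "integral {0..d} (\<lambda>s. K s - id_blinfun) = G d - d *\<^sub>R id_blinfun"
      using int[of 0 d] d by (subst integral_diff) (auto simp: G_def)
    moreover have "norm (integral {0..d} (\<lambda>s. K s - id_blinfun)) \<le> 1 / 2 * (d - 0)"
      using d d0(2) by (intro integral_bound continuous_intros cont') (auto intro: less_imp_le)
    ultimately have "norm (G d - d *\<^sub>R id_blinfun) \<le> d / 2" by simp
    moreover have "id_blinfun - (1 / d) *\<^sub>R G d = (1 / d) *\<^sub>R (d *\<^sub>R id_blinfun - G d)"
      using d by (simp add: scaleR_diff_right)
    then have "norm (id_blinfun - (1 / d) *\<^sub>R G d) = norm (G d - d *\<^sub>R id_blinfun) / d"
      using d by (simp only: norm_scaleR norm_minus_commute[of "d *\<^sub>R id_blinfun"]) simp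
    ultimately show ?thesis using d by (simp add: divide_less_eq)
  qed
  then obtain J where J: "(1 / d) *\<^sub>R G d o\<^sub>L J = id_blinfun"
    by (rule ex_blinfun_right_inverse)
  have KG: "K t o\<^sub>L G d = G (t + d) - G t" if "0 \<le> t" for t
  proof -
    have "K t o\<^sub>L G d = integral {0..d} ((\<lambda>X. K t o\<^sub>L X) \<circ> K)"
      unfolding G_def using int[of 0 d]
      by (intro integral_linear[symmetric] bounded_bilinear.bounded_linear_right[OF bounded_bilinear_blinfun_compose]) auto
    also have "\<dots> = integral {0..d} (K \<circ> (+) t)"
      by (intro integral_cong) (use mult that in \<open>simp add: add.commute\<close>)
    also have "\<dots> = integral {t..t + d} K"
      by (simp add: integral_shift_Icc_real add.commute)
    also have "\<dots> = G (t + d) - G t"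
      using Henstock_Kurzweil_Integration.integral_combine[where a = 0 and c = t and b = "t + d" and f = K] int[of 0 "t + d"] that d by (simp add: G_def algebra_simps)
    finally show ?thesis .
  qed
  have K: "K t = (1 / d) *\<^sub>R ((G (t + d) - G t) o\<^sub>L J)" if "0 \<le> t" for t
  proof -
    have "K t = K t o\<^sub>L ((1 / d) *\<^sub>R G d o\<^sub>L J)" by (simp add: J) (rule blinfun_eqI, simp)
    also have "\<dots> = (1 / d) *\<^sub>R ((K t o\<^sub>L G d) o\<^sub>L J)"
      by (rule blinfun_eqI) (simp add: blinfun.bilinear_simps)
    finally show ?thesis by (simp add: KG[OF that])
  qed
  have G': "(G has_vector_derivative K u) (at u within {0..2})" if "u \<in> {0..2}" for u
    unfolding G_def using cont' that by (intro integral_has_vector_derivative) auto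
  have "((G \<circ> (\<lambda>t. t + d)) has_vector_derivative 1 *\<^sub>R K d) (at 0 within {0..1})"
  proof (rule vector_diff_chain_within)
    show "((\<lambda>t. t + d) has_vector_derivative 1) (at 0 within {0..1})"
      by (auto intro!: derivative_eq_intros)
    show "(G has_vector_derivative K d) (at (0 + d) within (\<lambda>t. t + d) ` {0..1})"
      unfolding add_0 by (rule has_vector_derivative_within_subset[OF G']) (use d in auto)
  qed
  then have 1: "((\<lambda>t. G (t + d)) has_vector_derivative K d) (at 0 within {0..1})"
    by (simp add: o_def)
  have 2: "(G has_vector_derivative K 0) (at 0 within {0..1})"
    by (rule has_vector_derivative_within_subset[OF G'[of 0]]) auto
  have "bounded_linear (\<lambda>X. (1 / d) *\<^sub>R (X o\<^sub>L J))"
    by (intro bounded_linear_compose[OF bounded_linear_scaleR_right]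
        bounded_bilinear.bounded_linear_left[OF bounded_bilinear_blinfun_compose])
  then have "((\<lambda>t. (1 / d) *\<^sub>R ((G (t + d) - G t) o\<^sub>L J)) has_vector_derivative (1 / d) *\<^sub>R ((K d - K 0) o\<^sub>L J))
      (at 0 within {0..1})"
    by (rule bounded_linear.has_vector_derivative) (intro has_vector_derivative_diff 1 2)
  then have "(K has_vector_derivative (1 / d) *\<^sub>R ((K d - K 0) o\<^sub>L J)) (at 0 within {0..1})"
    by (rule has_vector_derivative_transform[rotated 2]) (auto intro: K)
  moreover have "at (0::real) within {0..1} = at 0 within {0..}"
    by (rule at_within_nhd[of _ "{..<1}"]) auto
  ultimately have "(K has_vector_derivative (1 / d) *\<^sub>R ((K d - K 0) o\<^sub>L J)) (at 0 within {0..})"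
    by simp
  then show ?thesis
    unfolding expansion_iff_has_vector_derivative[where K = K, OF K0, symmetric] by blast
qed

text \<open>Continuity at 0 bounds \<open>K\<close> by 2 near 0, hence on every bounded interval.
  Then K (t + h) - K t = (K h - id) K t, with \<open>t\<close> the smaller of the two times, covers
  both sides of a point.\<close>

lemma semigroup_continuous_on:
  fixes K :: "real \<Rightarrow> ('a::real_normed_vector \<Rightarrow>\<^sub>L 'a)"
  assumes mult: "\<And>s t. \<lbrakk>0 \<le> s; 0 \<le> t\<rbrakk> \<Longrightarrow> K (s + t) = K t o\<^sub>L K s"
    and lim: "\<And>e. 0 < e \<Longrightarrow> \<exists>d>0. \<forall>s. 0 \<le> s \<longrightarrow> s \<le> d \<longrightarrow> norm (K s - id_blinfun) \<le> e"
  shows "continuous_on {0..} K"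
proof -
  obtain d1 where d1: "0 < d1" "\<And>s. \<lbrakk>0 \<le> s; s \<le> d1\<rbrakk> \<Longrightarrow> norm (K s - id_blinfun) \<le> 1"
    using lim[of 1] by auto
  have K2: "norm (K s) \<le> 2" if "0 \<le> s" "s \<le> d1" for s
  proof -
    have "norm (K s) \<le> norm (id_blinfun :: 'a \<Rightarrow>\<^sub>L 'a) + norm (K s - id_blinfun)" by (rule norm_triangle_sub)
    with d1(2)[OF that] norm_blinfun_id_le[where 'a = 'a] show ?thesis by linarith
  qed
  have bound: "norm (K t) \<le> 2 ^ Suc n" if "0 \<le> t" "t \<le> real (Suc n) * d1" for n t
    using that
  proof (induction n arbitrary: t)
    case 0
    then show ?case using K2 by simp
  next
    case (Suc n)
    show ?case
    proof (cases "t \<le> d1")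
      case True
      have "(2::real) * 1 \<le> 2 * (2 * 2 ^ n)" using one_le_power[of "2::real" n] by linarith
      then have "(2::real) \<le> 2 ^ Suc (Suc n)" by simp
      with K2[OF Suc.prems(1) True] show ?thesis by linarith
    next
      case False
      then have "K t = K (t - d1) o\<^sub>L K d1" using mult[of d1 "t - d1"] d1 by simp
      then have "norm (K t) \<le> norm (K (t - d1)) * norm (K d1)" by (simp add: norm_blinfun_compose)
      also have "\<dots> \<le> 2 ^ Suc n * 2"
        using False Suc.prems d1 by (intro mult_mono Suc.IH K2) (auto simp: algebra_simps)
      finally show ?thesis by simp
    qed
  qed
  show ?thesis
    unfolding continuous_on_iff
  proof (intro ballI allI impI)
    fix t0 e :: real assume t0: "t0 \<in> {0..}" and e: "0 < e"
    obtain n where n: "t0 / d1 < real n" using reals_Archimedean2 by blast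
    define B where "B = (2::real) ^ Suc n"
    have B: "0 < B" by (simp add: B_def)
    have "t0 \<le> real n * d1" using n d1(1) by (simp add: divide_less_eq)
    also have "\<dots> \<le> real (Suc n) * d1" using d1(1) by (intro mult_right_mono) auto
    finally have B_bound: "norm (K t) \<le> B" if "0 \<le> t" "t \<le> t0" for t
      unfolding B_def using that by (intro bound) auto
    obtain d where d: "0 < d" "\<And>s. \<lbrakk>0 \<le> s; s \<le> d\<rbrakk> \<Longrightarrow> norm (K s - id_blinfun) \<le> e / (2 * B)"
      using lim[of "e / (2 * B)"] e B by auto
    have main: "norm (K (t + h) - K t) < e" if "0 \<le> t" "t \<le> t0" "0 \<le> h" "h \<le> d" for t h
    proof -
      have "K (t + h) - K t = (K h - id_blinfun) o\<^sub>L K t"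
        unfolding mult[OF that(1,3)] by (rule blinfun_eqI) (simp add: blinfun.bilinear_simps)
      then have "norm (K (t + h) - K t) \<le> norm (K h - id_blinfun) * norm (K t)"
        by (simp add: norm_blinfun_compose)
      also have "\<dots> \<le> e / (2 * B) * B"
        using that e B by (intro mult_mono d B_bound) auto
      also have "\<dots> < e" using e B by simp
      finally show ?thesis .
    qed
    show "\<exists>d>0. \<forall>t\<in>{0..}. dist t t0 < d \<longrightarrow> dist (K t) (K t0) < e"
    proof (rule exI[of _ d], intro conjI ballI impI)
      fix t :: real assume t: "t \<in> {0..}" "dist t t0 < d"
      show "dist (K t) (K t0) < e"
      proof (cases "t \<le> t0")
        case True
        then show ?thesis using main[of t "t0 - t"] t by (simp add: dist_norm norm_minus_commute)
      next
        case False
        then show ?thesis using main[of t0 "t - t0"] t t0 by (simp add: dist_norm)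
      qed
    qed (rule d)
  qed
qed

lemma expansion_near_id:
  assumes "expansion L (\<lambda>s X. X = K s)" "0 < e"
  shows "\<exists>d>0. \<forall>s. 0 \<le> s \<longrightarrow> s \<le> d \<longrightarrow> norm (K s - id_blinfun) \<le> e"
proof -
  obtain d where d: "0 < d" "\<And>s X. \<lbrakk>0 \<le> s; s \<le> d; X = K s\<rbrakk> \<Longrightarrow> norm (X - id_blinfun - s *\<^sub>R L) \<le> 1 * s"
    using expansionD[OF assms(1) zero_less_one] by blast
  define c where "c = norm L + 1"
  have c: "0 < c" by (simp add: c_def add_nonneg_pos)
  show ?thesis
  proof (rule exI[of _ "min d (e / c)"], intro conjI allI impI)
    fix s assume s: "0 \<le> s" "s \<le> min d (e / c)"
    have "K s - id_blinfun = (K s - id_blinfun - s *\<^sub>R L) + s *\<^sub>R L" by simp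
    also have "norm \<dots> \<le> 1 * s + s * norm L"
      using d(2)[of s "K s"] s by (intro norm_triangle_le add_mono) auto
    also have "\<dots> = s * c" by (simp add: c_def algebra_simps)
    also have "\<dots> \<le> (e / c) * c" using s c by (intro mult_right_mono) auto
    finally show "norm (K s - id_blinfun) \<le> e" using c by simp
  qed (use d assms c in auto)
qed

lemma expansion_tendsto:
  assumes "expansion L (\<lambda>s X. X = K s)"
  shows "((\<lambda>s. (1 / s) *\<^sub>R (K s - id_blinfun)) \<longlongrightarrow> L) (at_right 0)"
proof (rule tendstoI)
  fix e :: real assume "0 < e"
  then have "0 < e / 2" by simp
  then obtain d where d: "0 < d" "\<And>s X. \<lbrakk>0 \<le> s; s \<le> d; X = K s\<rbrakk> \<Longrightarrow> norm (X - id_blinfun - s *\<^sub>R L) \<le> e / 2 * s"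
    using expansionD[OF assms] by blast
  have "dist ((1 / s) *\<^sub>R (K s - id_blinfun)) L < e" if "0 < s" "s < d" for s
  proof -
    have "(1 / s) *\<^sub>R (K s - id_blinfun) - L = (1 / s) *\<^sub>R (K s - id_blinfun - s *\<^sub>R L)"
      using that by (simp add: scaleR_diff_right)
    then have "dist ((1 / s) *\<^sub>R (K s - id_blinfun)) L = norm (K s - id_blinfun - s *\<^sub>R L) / s"
      using that by (simp add: dist_norm)
    also have "\<dots> \<le> e / 2" using d(2)[of s "K s"] that by (simp add: divide_le_eq)
    finally show ?thesis using \<open>0 < e\<close> by simp
  qed
  then show "\<forall>\<^sub>F s in at_right 0. dist ((1 / s) *\<^sub>R (K s - id_blinfun)) L < e"
    using eventually_at_right_real[OF d(1)] by (auto elim!: eventually_mono)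
qed

context unital_product_system
begin

lemma K_eq_kap: "\<K> E u v t = kap (fib E t) (u t) (v t)"
  by (simp add: \<K>_def kap_def)

lemma unit_closed: "\<lbrakk>u \<in> units_of_ps E; 0 \<le> t\<rbrakk> \<Longrightarrow> u t \<in> carrier (fib E t)"
  using unit_is_section by (simp add: is_section_def)

lemma kap_unit_0: "\<lbrakk>u \<in> units_of_ps E; v \<in> units_of_ps E\<rbrakk> \<Longrightarrow> kap (fib E 0) (u 0) (v 0) = id_blinfun"
  by (simp add: units_of_ps_def kap_unit_iso)

lemma kap_unit_mult:
  assumes "u \<in> units_of_ps E" "v \<in> units_of_ps E" "0 \<le> s" "0 \<le> t"
  shows "kap (fib E (s + t)) (u (s + t)) (v (s + t)) = kap (fib E t) (u t) (v t) o\<^sub>L kap (fib E s) (u s) (v s)"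
proof -
  have "u (s + t) = tens E s t (u s) (u t)" "v (s + t) = tens E s t (v s) (v t)"
    using assms by (auto simp: units_of_ps_def)
  then show ?thesis using assms by (simp add: kap_tens unit_closed)
qed

text \<open>Norm continuity of the semigroup is differentiability at 0. From here on units are
  handled through \<open>tangent\<close> alone.\<close>

lemma continuous_on_K_iff:
  assumes "u \<in> units_of_ps E" "v \<in> units_of_ps E"
  shows "continuous_on {0..} (\<K> E u v) \<longleftrightarrow> (\<exists>L. tangent u v L)"
proof
  show "continuous_on {0..} (\<K> E u v) \<Longrightarrow> \<exists>L. tangent u v L"
    using continuous_semigroup_expansion[of "\<K> E u v"] kap_unit_0[OF assms] kap_unit_mult[OF assms]
    unfolding K_eq_kap by blast
  assume "\<exists>L. tangent u v L"
  then show "continuous_on {0..} (\<K> E u v)"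
    using semigroup_continuous_on[of "\<K> E u v"] kap_unit_mult[OF assms] expansion_near_id[of _ "\<K> E u v"]
    unfolding K_eq_kap by blast
qed

lemma L_eqI:
  assumes "u \<in> units_of_ps E" "v \<in> units_of_ps E" "tangent u v L"
  shows "\<L> E u v = L"
proof -
  have "(\<K> E u v has_vector_derivative L) (at 0 within {0..})"
    using expansion_iff_has_vector_derivative[of "\<K> E u v" L] assms kap_unit_0 by (simp add: K_eq_kap)
  moreover have "at (0::real) within {0..} \<noteq> bot"
    using at_le[of "{0<..}" "{0..}" "0::real"] trivial_limit_at_right_real[of "0::real"]
    by (auto simp: Ioi_le_Ico bot_unique)
  ultimately show ?thesis
    unfolding \<L>_def by (intro vector_derivative_within)
qed

lemma U_iff:
  "x \<in> \<U> E \<omega> \<longleftrightarrow> x \<in> units_of_ps E \<and> \<omega> \<in> units_of_ps E \<and>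
    (\<exists>L. tangent x x L) \<and> (\<exists>L. tangent x \<omega> L) \<and> (\<exists>L. tangent \<omega> x L) \<and> (\<exists>L. tangent \<omega> \<omega> L)"
proof -
  have "x \<in> \<U> E \<omega> \<longleftrightarrow> x \<in> units_of_ps E \<and> \<omega> \<in> units_of_ps E \<and>
    continuous_on {0..} (\<K> E x x) \<and> continuous_on {0..} (\<K> E x \<omega>) \<and>
    continuous_on {0..} (\<K> E \<omega> x) \<and> continuous_on {0..} (\<K> E \<omega> \<omega>)"
    by (auto simp: \<U>_def continuous_unit_def continuous_set_def)
  then show ?thesis using continuous_on_K_iff by auto
qed

text \<open>
  The expansions of \<open>\<K>\<^sup>x\<^sup>x\<close>, \<open>\<K>\<^sup>x\<^sup>\<omega>\<close> and \<open>\<K>\<^sup>\<omega>\<^sup>\<omega>\<close> give \<open>x\<^sub>s - \<omega>\<^sub>s \<rightarrow> 0\<close> in norm, so that \<open>\<K>\<^sup>x\<^sup>y\<close> is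
  as continuous at \<open>0\<close> as \<open>\<K>\<^sup>\<omega>\<^sup>y\<close>.
\<close>

lemma tangent_U:
  assumes x: "x \<in> \<U> E \<omega>" and y: "y \<in> \<U> E \<omega>"
  shows "tangent x y (\<L> E x y)"
proof -
  have units: "x \<in> units_of_ps E" "y \<in> units_of_ps E" "\<omega> \<in> units_of_ps E"
    using x y by (auto simp: U_iff)
  obtain Lxx Lxw Lww Lwy Lyy where L: "tangent x x Lxx" "tangent x \<omega> Lxw" "tangent \<omega> \<omega> Lww" "tangent \<omega> y Lwy" "tangent y y Lyy"
    using x y by (auto simp: U_iff)
  have "continuous_on {0..} (\<K> E x y)"
  proof (rule semigroup_continuous_on)
    show "\<K> E x y (s + t) = \<K> E x y t o\<^sub>L \<K> E x y s" if "0 \<le> s" "0 \<le> t" for s t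
      unfolding K_eq_kap using units that by (intro kap_unit_mult)
    fix e :: real assume e: "0 < e"
    \<comment> \<open>The bounds below are norm (x - \<omega>) \<open>\<le>\<close> 2c and norm y
      \<open>\<le>\<close> 2, so the total error is 5c.\<close>
    define c where "c = min (1 / 2) (e / 6)"
    have c: "0 < c" "c \<le> 1 / 2" "c \<le> e / 6" using e by (auto simp: c_def)
    have c2: "0 < c\<^sup>2" using c by simp
    obtain d1 where d1: "0 < d1" "\<And>s. \<lbrakk>0 \<le> s; s \<le> d1\<rbrakk> \<Longrightarrow> norm (kap (fib E s) (x s) (x s) - id_blinfun) \<le> c\<^sup>2"
      using expansion_near_id[OF L(1) c2] by blast
    obtain d2 where d2: "0 < d2" "\<And>s. \<lbrakk>0 \<le> s; s \<le> d2\<rbrakk> \<Longrightarrow> norm (kap (fib E s) (x s) (\<omega> s) - id_blinfun) \<le> c\<^sup>2"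
      using expansion_near_id[OF L(2) c2] by blast
    obtain d3 where d3: "0 < d3" "\<And>s. \<lbrakk>0 \<le> s; s \<le> d3\<rbrakk> \<Longrightarrow> norm (kap (fib E s) (\<omega> s) (\<omega> s) - id_blinfun) \<le> c\<^sup>2"
      using expansion_near_id[OF L(3) c2] by blast
    obtain d4 where d4: "0 < d4" "\<And>s. \<lbrakk>0 \<le> s; s \<le> d4\<rbrakk> \<Longrightarrow> norm (kap (fib E s) (\<omega> s) (y s) - id_blinfun) \<le> c"
      using expansion_near_id[OF L(4) c(1)] by blast
    obtain d5 where d5: "0 < d5" "\<And>s. \<lbrakk>0 \<le> s; s \<le> d5\<rbrakk> \<Longrightarrow> norm (kap (fib E s) (y s) (y s) - id_blinfun) \<le> 1"
      using expansion_near_id[OF L(5) zero_less_one] by blast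
    show "\<exists>d>0. \<forall>s. 0 \<le> s \<longrightarrow> s \<le> d \<longrightarrow> norm (\<K> E x y s - id_blinfun) \<le> e"
    proof (rule exI[of _ "min d1 (min d2 (min d3 (min d4 d5)))"], intro conjI allI impI)
      fix s :: real assume s: "0 \<le> s" "s \<le> min d1 (min d2 (min d3 (min d4 d5)))"
      interpret M: hilbert_bimodule "fib E s" by (rule hilbert_bimodule_fib[OF s(1)])
      have carr: "x s \<in> carrier (fib E s)" "y s \<in> carrier (fib E s)" "\<omega> s \<in> carrier (fib E s)"
        using units s by (auto intro: unit_closed)
      let ?k = "\<lambda>u v. kap (fib E s) (u s) (v s)"
      have tri: "norm (X - Y) \<le> a + b" if "norm (X - id_blinfun) \<le> a" "norm (Y - id_blinfun) \<le> b"
        for X Y :: "'b \<Rightarrow>\<^sub>L 'b" and a b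
        using norm_triangle_ineq4[of "X - id_blinfun" "Y - id_blinfun"] that by simp
      have 1: "norm (?k x x - ?k x \<omega>) \<le> c\<^sup>2 + c\<^sup>2"
        by (rule tri[OF d1(2) d2(2)]) (use s in simp_all)
      have 2: "norm (?k \<omega> \<omega> - ?k x \<omega>) \<le> c\<^sup>2 + c\<^sup>2"
        by (rule tri[OF d3(2) d2(2)]) (use s in simp_all)
      from order_trans[OF M.mod_norm_minus_power2_le[OF carr(1,3)] add_mono[OF 1 2]]
      have "(mod_norm (fib E s) (x s \<ominus>\<^bsub>fib E s\<^esub> \<omega> s))\<^sup>2 \<le> (2 * c)\<^sup>2"
        by (simp add: power2_eq_square)
      then have xw: "mod_norm (fib E s) (x s \<ominus>\<^bsub>fib E s\<^esub> \<omega> s) \<le> 2 * c"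
        by (rule power2_le_imp_le) (use c in simp)
      have "(mod_norm (fib E s) (y s))\<^sup>2 \<le> 2\<^sup>2"
      proof -
        have "(mod_norm (fib E s) (y s))\<^sup>2 = norm (?k y y 1)"
          using carr by (simp add: mod_norm_power2 M.kap_apply_one)
        also have "\<dots> \<le> norm (?k y y) * norm (1::'b)" by (rule norm_blinfun)
        also have "norm (?k y y) \<le> norm (id_blinfun :: 'b \<Rightarrow>\<^sub>L 'b) + norm (?k y y - id_blinfun)"
          by (rule norm_triangle_sub)
        also have "\<dots> \<le> 1 + 1"
          using s by (intro add_mono norm_blinfun_id_le d5) auto
        finally show ?thesis by simp
      qed
      then have yn: "mod_norm (fib E s) (y s) \<le> 2"
        by (rule power2_le_imp_le) simp
      have "?k x y - id_blinfun = kap (fib E s) (x s \<ominus>\<^bsub>fib E s\<^esub> \<omega> s) (y s) + (?k \<omega> y - id_blinfun)"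
        using carr by (simp add: M.kap_diff_left)
      also have "norm \<dots> \<le> mod_norm (fib E s) (x s \<ominus>\<^bsub>fib E s\<^esub> \<omega> s) * mod_norm (fib E s) (y s) + c"
        using s carr by (intro norm_triangle_le add_mono M.norm_kap_le d4) auto
      also have "\<dots> \<le> (2 * c) * 2 + c"
        using c by (intro add_right_mono mult_mono xw yn) auto
      also have "\<dots> \<le> e" using c e by simp
      finally show "norm (\<K> E x y s - id_blinfun) \<le> e" by (simp add: K_eq_kap)
    qed (use d1 d2 d3 d4 d5 in simp)
  qed
  then obtain L where "tangent x y L" using continuous_on_K_iff units by blast
  then show ?thesis using L_eqI units by blast
qed

lemma U_eqI:
  assumes "x \<in> \<U> E \<omega>" "y \<in> \<U> E \<omega>" "\<L> E x x = \<L> E x y" "\<L> E y y = \<L> E x y"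
  shows "x = y"
  using assms tangent_U[of x \<omega> x] tangent_U[of x \<omega> y] tangent_U[of y \<omega> y]
  by (intro unit_eqI[of x y "\<L> E x y"]) (auto simp: U_iff)

section \<open>Affine combinations of units\<close>

text \<open>Covers sum and negative in the module of units: the coefficients are 1, 1, -1 on x, y,
  \<omega> and -1, 1, 1 on y, \<omega>, \<omega>.\<close>

definition affine3 :: "real \<Rightarrow> (real \<Rightarrow> 'e) \<Rightarrow> real \<Rightarrow> (real \<Rightarrow> 'e) \<Rightarrow> real \<Rightarrow> (real \<Rightarrow> 'e) \<Rightarrow> real \<Rightarrow> 'e" where
  "affine3 r1 x1 r2 x2 r3 x3 s = lact (fib E s) (of_real r1) (x1 s)
     \<oplus>\<^bsub>fib E s\<^esub> (lact (fib E s) (of_real r2) (x2 s) \<oplus>\<^bsub>fib E s\<^esub> lact (fib E s) (of_real r3) (x3 s))"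

lemma limit_unit_cong:
  assumes "\<And>s. 0 \<le> s \<Longrightarrow> a s = b s"
  shows "limit_unit E a = limit_unit E b"
  unfolding limit_unit_def using assms by (intro restrict_ext) (auto intro!: arg_cong[of _ _ "bimod_lim _"])

lemma box_left_eq_affine3:
  assumes "is_section x1" "is_section x2" "is_section x3"
  shows "box_left E [(of_real r1, x1), (of_real r2, x2), (of_real r3, x3)] = limit_unit E (affine3 r1 x1 r2 x2 r3 x3)"
  unfolding box_left_def
proof (rule limit_unit_cong)
  fix s :: real assume s: "0 \<le> s"
  interpret M: hilbert_bimodule "fib E s" by (rule hilbert_bimodule_fib[OF s])
  have carr: "x1 s \<in> carrier (fib E s)" "x2 s \<in> carrier (fib E s)" "x3 s \<in> carrier (fib E s)"
    using assms s by (auto simp: is_section_def)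
  let ?ps = "[(of_real r1, x1), (of_real r2, x2), (of_real r3, x3)] :: ('b \<times> (real \<Rightarrow> 'e)) list"
  have "{..<length ?ps} = {0, 1, 2}" by auto
  then show "(\<Oplus>\<^bsub>fib E s\<^esub>j\<in>{..<length ?ps}. lact (fib E s) (fst (?ps ! j)) (snd (?ps ! j) s)) =
      affine3 r1 x1 r2 x2 r3 x3 s"
    using carr by (simp only:) (simp add: M.finsum_insert Pi_def M.lact_closed affine3_def)
qed

lemma kap_affine3:
  assumes "0 \<le> s" "is_section x1" "is_section x2" "is_section x3" "v \<in> carrier (fib E s)"
  shows "kap (fib E s) (affine3 r1 x1 r2 x2 r3 x3 s) v =
      r1 *\<^sub>R kap (fib E s) (x1 s) v + r2 *\<^sub>R kap (fib E s) (x2 s) v + r3 *\<^sub>R kap (fib E s) (x3 s) v"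
    and "kap (fib E s) v (affine3 r1 x1 r2 x2 r3 x3 s) =
      r1 *\<^sub>R kap (fib E s) v (x1 s) + r2 *\<^sub>R kap (fib E s) v (x2 s) + r3 *\<^sub>R kap (fib E s) v (x3 s)"
proof -
  interpret M: hilbert_bimodule "fib E s" by (rule hilbert_bimodule_fib[OF assms(1)])
  have carr: "x1 s \<in> carrier (fib E s)" "x2 s \<in> carrier (fib E s)" "x3 s \<in> carrier (fib E s)"
    using assms by (auto simp: is_section_def)
  show "kap (fib E s) (affine3 r1 x1 r2 x2 r3 x3 s) v =
      r1 *\<^sub>R kap (fib E s) (x1 s) v + r2 *\<^sub>R kap (fib E s) (x2 s) v + r3 *\<^sub>R kap (fib E s) (x3 s) v"
    "kap (fib E s) v (affine3 r1 x1 r2 x2 r3 x3 s) =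
      r1 *\<^sub>R kap (fib E s) v (x1 s) + r2 *\<^sub>R kap (fib E s) v (x2 s) + r3 *\<^sub>R kap (fib E s) v (x3 s)"
    using carr assms(5)
    by (simp_all add: affine3_def M.kap_add_left M.kap_add_right M.lact_closed
        M.kap_lact_of_real_left M.kap_lact_of_real_right)
qed

lemma affine3_is_section:
  assumes "is_section x1" "is_section x2" "is_section x3"
  shows "is_section (affine3 r1 x1 r2 x2 r3 x3)"
  unfolding is_section_def
proof (intro allI impI)
  fix s :: real assume s: "0 \<le> s"
  interpret M: hilbert_bimodule "fib E s" by (rule hilbert_bimodule_fib[OF s])
  show "affine3 r1 x1 r2 x2 r3 x3 s \<in> carrier (fib E s)"
    using assms s by (simp add: affine3_def is_section_def M.lact_closed)
qed

lemma tangent_affine3: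
  assumes r: "r1 + r2 + r3 = 1" and sec: "is_section x1" "is_section x2" "is_section x3" "is_section v"
  shows "\<lbrakk>tangent x1 v L1; tangent x2 v L2; tangent x3 v L3\<rbrakk> \<Longrightarrow>
      tangent (affine3 r1 x1 r2 x2 r3 x3) v (r1 *\<^sub>R L1 + r2 *\<^sub>R L2 + r3 *\<^sub>R L3)"
    and "\<lbrakk>tangent v x1 L1; tangent v x2 L2; tangent v x3 L3\<rbrakk> \<Longrightarrow>
      tangent v (affine3 r1 x1 r2 x2 r3 x3) (r1 *\<^sub>R L1 + r2 *\<^sub>R L2 + r3 *\<^sub>R L3)"
proof -
  have v: "v s \<in> carrier (fib E s)" if "0 \<le> s" for s using sec(4) that by (simp add: is_section_def)
  show "tangent (affine3 r1 x1 r2 x2 r3 x3) v (r1 *\<^sub>R L1 + r2 *\<^sub>R L2 + r3 *\<^sub>R L3)"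
    if "tangent x1 v L1" "tangent x2 v L2" "tangent x3 v L3"
    by (rule expansion_mono[OF expansion_linear3[OF that r]]) (simp add: kap_affine3 sec v)
  show "tangent v (affine3 r1 x1 r2 x2 r3 x3) (r1 *\<^sub>R L1 + r2 *\<^sub>R L2 + r3 *\<^sub>R L3)"
    if "tangent v x1 L1" "tangent v x2 L2" "tangent v x3 L3"
    by (rule expansion_mono[OF expansion_linear3[OF that r]]) (simp add: kap_affine3 sec v)
qed

text \<open>
  A member \<open>u\<^sub>s\<close> of a unit is itself the product of the \<open>u\<^sub>q\<close> along any partition \<open>q\<close> of \<open>s\<close>;
  this is what makes combinations of units generating.
\<close>

lemma expansion_unit_sec_tens:
  assumes "u \<in> units_of_ps E" "is_section a" "tangent u a L"
  shows "expansion L (\<lambda>s X. \<exists>q. is_partition s q \<and> X = kap (fib E s) (u s) (sec_tens a q))"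
  by (rule expansion_mono[OF expansion_sec_tens[OF unit_is_section[OF assms(1)] assms(2,3)]])
    (use unit_sec_tens[OF assms(1)] in metis)

lemma generating_affine3:
  assumes r: "r1 + r2 + r3 = 1" and units: "x1 \<in> units_of_ps E" "x2 \<in> units_of_ps E" "x3 \<in> units_of_ps E"
  defines "a \<equiv> affine3 r1 x1 r2 x2 r3 x3"
  assumes L: "tangent x1 a L1" "tangent x2 a L2" "tangent x3 a L3"
  shows "generating a (r1 *\<^sub>R L1 + r2 *\<^sub>R L2 + r3 *\<^sub>R L3)"
proof -
  note sec = units[THEN unit_is_section]
  have a: "is_section a" unfolding a_def using sec by (rule affine3_is_section)
  have "expansion (r1 *\<^sub>R L1 + r2 *\<^sub>R L2 + r3 *\<^sub>R L3)
    (\<lambda>s X. \<exists>p. is_partition s p \<and> X = kap (fib E s) (a s) (sec_tens a p))"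
  proof (rule expansion_mono[OF expansion_linear3[OF units(1)[THEN expansion_unit_sec_tens, OF a L(1)]
        units(2)[THEN expansion_unit_sec_tens, OF a L(2)] units(3)[THEN expansion_unit_sec_tens, OF a L(3)] r]])
    fix s X assume s: "0 \<le> s" and "\<exists>p. is_partition s p \<and> X = kap (fib E s) (a s) (sec_tens a p)"
    then obtain p where p: "is_partition s p" "X = kap (fib E s) (a s) (sec_tens a p)" by blast
    then have "X = r1 *\<^sub>R kap (fib E s) (x1 s) (sec_tens a p) + r2 *\<^sub>R kap (fib E s) (x2 s) (sec_tens a p)
        + r3 *\<^sub>R kap (fib E s) (x3 s) (sec_tens a p)"
      using kap_affine3(1)[OF s sec sec_tens_closed[OF a p(1)]] by (simp add: a_def)
    with p(1) show "\<exists>X1 X2 X3. (\<exists>q. is_partition s q \<and> X1 = kap (fib E s) (x1 s) (sec_tens a q)) \<and>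
       (\<exists>q. is_partition s q \<and> X2 = kap (fib E s) (x2 s) (sec_tens a q)) \<and>
       (\<exists>q. is_partition s q \<and> X3 = kap (fib E s) (x3 s) (sec_tens a q)) \<and> X = r1 *\<^sub>R X1 + r2 *\<^sub>R X2 + r3 *\<^sub>R X3"
      by blast
  qed
  with a show ?thesis by (simp add: generating_def)
qed

text \<open>The formulas hold for the affine section before the limit, by linearity, and tangency
  passes to the limit unit. Tangency of units to the section comes first, because it makes the
  section generating.\<close>

lemma limit_unit_affine3:
  assumes r: "r1 + r2 + r3 = 1" and x: "x1 \<in> \<U> E \<omega>" "x2 \<in> \<U> E \<omega>" "x3 \<in> \<U> E \<omega>" "\<omega> \<in> \<U> E \<omega>"
  defines "w \<equiv> limit_unit E (affine3 r1 x1 r2 x2 r3 x3)"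
  shows "w \<in> \<U> E \<omega>"
    and "\<xi> \<in> \<U> E \<omega> \<Longrightarrow> \<L> E w \<xi> = r1 *\<^sub>R \<L> E x1 \<xi> + r2 *\<^sub>R \<L> E x2 \<xi> + r3 *\<^sub>R \<L> E x3 \<xi>"
    and "\<xi> \<in> \<U> E \<omega> \<Longrightarrow> \<L> E \<xi> w = r1 *\<^sub>R \<L> E \<xi> x1 + r2 *\<^sub>R \<L> E \<xi> x2 + r3 *\<^sub>R \<L> E \<xi> x3"
proof -
  let ?a = "affine3 r1 x1 r2 x2 r3 x3"
  have unit: "\<xi> \<in> units_of_ps E" if "\<xi> \<in> \<U> E \<omega>" for \<xi> using that by (simp add: U_iff)
  note sec = unit[THEN unit_is_section]
  have left: "tangent ?a \<xi> (r1 *\<^sub>R \<L> E x1 \<xi> + r2 *\<^sub>R \<L> E x2 \<xi> + r3 *\<^sub>R \<L> E x3 \<xi>)"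
    and right: "tangent \<xi> ?a (r1 *\<^sub>R \<L> E \<xi> x1 + r2 *\<^sub>R \<L> E \<xi> x2 + r3 *\<^sub>R \<L> E \<xi> x3)" if "\<xi> \<in> \<U> E \<omega>" for \<xi>
    using x that by (auto intro!: tangent_affine3[OF r] sec tangent_U)
  have gen: "\<exists>L. generating ?a L"
    using generating_affine3[OF r unit unit unit right right right] x by blast
  then obtain L where gen: "generating ?a L" ..
  have w: "w \<in> units_of_ps E" unfolding w_def using gen by (rule limit_unit_in_units)
  have left': "tangent w \<xi> (r1 *\<^sub>R \<L> E x1 \<xi> + r2 *\<^sub>R \<L> E x2 \<xi> + r3 *\<^sub>R \<L> E x3 \<xi>)"
    and right': "tangent \<xi> w (r1 *\<^sub>R \<L> E \<xi> x1 + r2 *\<^sub>R \<L> E \<xi> x2 + r3 *\<^sub>R \<L> E \<xi> x3)" if "\<xi> \<in> \<U> E \<omega>" for \<xi>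
    unfolding w_def using tangent_limit_unit(2,3)[OF gen unit[OF that]] left[OF that] right[OF that] by blast+
  show "w \<in> \<U> E \<omega>"
    unfolding U_iff using w left'[OF x(4)] right'[OF x(4)] tangent_limit_unit(1)[OF gen] x(4)
    by (auto simp: w_def U_iff)
  show "\<L> E w \<xi> = r1 *\<^sub>R \<L> E x1 \<xi> + r2 *\<^sub>R \<L> E x2 \<xi> + r3 *\<^sub>R \<L> E x3 \<xi>" if "\<xi> \<in> \<U> E \<omega>"
    using left'[OF that] w unit[OF that] by (intro L_eqI)
  show "\<L> E \<xi> w = r1 *\<^sub>R \<L> E \<xi> x1 + r2 *\<^sub>R \<L> E \<xi> x2 + r3 *\<^sub>R \<L> E \<xi> x3" if "\<xi> \<in> \<U> E \<omega>"
    using right'[OF that] w unit[OF that] by (intro L_eqI)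
qed

text \<open>In each argument the generator of x - y is that of x minus that of y plus that of
  \<omega>; the terms with \<omega> cancel in the semi-inner product.\<close>

lemma ip_unit_bimodule_minus:
  assumes x: "x \<in> \<U> E \<omega>" and y: "y \<in> \<U> E \<omega>" and \<omega>: "\<omega> \<in> \<U> E \<omega>"
  shows "ip (unit_bimodule E \<omega>) (x \<ominus>\<^bsub>unit_bimodule E \<omega>\<^esub> y) (x \<ominus>\<^bsub>unit_bimodule E \<omega>\<^esub> y) =
    (\<L> E x x - \<L> E x y - \<L> E y x + \<L> E y y) 1"
proof -
  let ?M = "unit_bimodule E \<omega>"
  have unit: "\<xi> \<in> units_of_ps E" if "\<xi> \<in> \<U> E \<omega>" for \<xi> using that by (simp add: U_iff)
  note sec = unit[THEN unit_is_section]
  have add: "u \<oplus>\<^bsub>?M\<^esub> v = limit_unit E (affine3 1 u 1 v (-1) \<omega>)" if "u \<in> \<U> E \<omega>" "v \<in> \<U> E \<omega>" for u v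
    using box_left_eq_affine3[OF sec[OF that(1)] sec[OF that(2)] sec[OF \<omega>], of 1 1 "-1"]
    by (simp add: unit_bimodule_def)
  have add_U: "u \<oplus>\<^bsub>?M\<^esub> v \<in> \<U> E \<omega>"
    and L_add_left: "\<xi> \<in> \<U> E \<omega> \<Longrightarrow> \<L> E (u \<oplus>\<^bsub>?M\<^esub> v) \<xi> = \<L> E u \<xi> + \<L> E v \<xi> - \<L> E \<omega> \<xi>"
    and L_add_right: "\<xi> \<in> \<U> E \<omega> \<Longrightarrow> \<L> E \<xi> (u \<oplus>\<^bsub>?M\<^esub> v) = \<L> E \<xi> u + \<L> E \<xi> v - \<L> E \<xi> \<omega>"
    if "u \<in> \<U> E \<omega>" "v \<in> \<U> E \<omega>" for u v \<xi>
    unfolding add[OF that] using limit_unit_affine3[of 1 1 "-1" u \<omega> v \<omega>] that \<omega> by simp_all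
  \<comment> \<open>The candidate for -y; its generators are twice those of \<omega> minus those of
    y.\<close>
  define z where "z = limit_unit E (affine3 (-1) y 1 \<omega> 1 \<omega>)"
  have z: "z \<in> \<U> E \<omega>"
    and L_z_left: "\<And>\<xi>. \<xi> \<in> \<U> E \<omega> \<Longrightarrow> \<L> E z \<xi> = \<L> E \<omega> \<xi> + \<L> E \<omega> \<xi> - \<L> E y \<xi>"
    and L_z_right: "\<And>\<xi>. \<xi> \<in> \<U> E \<omega> \<Longrightarrow> \<L> E \<xi> z = \<L> E \<xi> \<omega> + \<L> E \<xi> \<omega> - \<L> E \<xi> y"
    unfolding z_def using limit_unit_affine3[of "-1" 1 1 y \<omega> \<omega> \<omega>] y \<omega> by simp_all
  have zero: "w = \<omega>" if w: "w \<in> \<U> E \<omega>" and wl: "\<And>\<xi>. \<xi> \<in> \<U> E \<omega> \<Longrightarrow> \<L> E w \<xi> = \<L> E \<omega> \<xi>"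
    and wr: "\<L> E \<omega> w = \<L> E \<omega> \<omega>" for w
    using wl[OF w] wl[OF \<omega>] wr by (intro U_eqI[OF w \<omega>]) simp_all
  have yz: "y \<oplus>\<^bsub>?M\<^esub> z = \<omega>"
    by (rule zero) (simp_all add: add_U y z L_add_left L_add_right L_z_left L_z_right \<omega>)
  have zy: "z \<oplus>\<^bsub>?M\<^esub> y = \<omega>"
    by (rule zero) (simp_all add: add_U y z L_add_left L_add_right L_z_left L_z_right \<omega>)
  \<comment> \<open>The negative is a definite description, so uniqueness is needed too: y + z' =
    \<omega> fixes the generators of z', and these determine a unit.\<close>
  have "\<ominus>\<^bsub>?M\<^esub> y = z"
    unfolding a_inv_def m_inv_def
  proof (rule the_equality)
    show "z \<in> carrier (add_monoid ?M) \<and> y \<otimes>\<^bsub>add_monoid ?M\<^esub> z = \<one>\<^bsub>add_monoid ?M\<^esub> \<and>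
        z \<otimes>\<^bsub>add_monoid ?M\<^esub> y = \<one>\<^bsub>add_monoid ?M\<^esub>"
      using yz zy z by (simp add: unit_bimodule_def)
    fix z' assume "z' \<in> carrier (add_monoid ?M) \<and> y \<otimes>\<^bsub>add_monoid ?M\<^esub> z' = \<one>\<^bsub>add_monoid ?M\<^esub> \<and>
        z' \<otimes>\<^bsub>add_monoid ?M\<^esub> y = \<one>\<^bsub>add_monoid ?M\<^esub>"
    then have z': "z' \<in> \<U> E \<omega>" "y \<oplus>\<^bsub>?M\<^esub> z' = \<omega>"
      by (simp_all add: unit_bimodule_def)
    have "\<L> E z' \<xi> = \<L> E z \<xi>" "\<L> E \<xi> z' = \<L> E \<xi> z" if "\<xi> \<in> \<U> E \<omega>" for \<xi>
      using L_add_left[OF y z'(1) that] L_add_right[OF y z'(1) that] that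
      by (simp_all add: z'(2) L_z_left L_z_right algebra_simps)
    then show "z' = z"
      using z z' by (intro U_eqI[OF z'(1) z]) simp_all
  qed
  then have minus: "x \<ominus>\<^bsub>?M\<^esub> y = x \<oplus>\<^bsub>?M\<^esub> z" by (simp add: a_minus_def)
  have "ip ?M w w = (\<L> E w w - \<L> E w \<omega> - \<L> E \<omega> w + \<L> E \<omega> \<omega>) 1" for w
    by (simp add: unit_bimodule_def)
  then show ?thesis
    unfolding minus using x y z \<omega>
    by (simp add: L_add_left L_add_right add_U L_z_left L_z_right algebra_simps)
qed

end

section \<open>Units that differ by an exponential\<close>

lemma expansion_of_has_vector_derivative:
  assumes "bounded_linear F" "(f has_vector_derivative f') (at 0 within {0..})" "F (f 0) = id_blinfun"
  shows "expansion (F f') (\<lambda>s X. X = F (f s))"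
  using bounded_linear.has_vector_derivative[OF assms(1,2)] assms(3)
  by (simp add: expansion_iff_has_vector_derivative)

lemma exp_has_vector_derivative_0:
  "((\<lambda>s. exp (s *\<^sub>R \<beta>)) has_vector_derivative (\<beta> :: 'a::{real_normed_algebra_1, banach})) (at 0 within S)"
  using exp_scaleR_has_vector_derivative_right[of \<beta> 0 S] by simp

text \<open>\<open>blinfun_mult_left c\<close> is b -> b c and \<open>blinfun_mult_right c\<close>
  is b -> c b. They arise when an exponential sits in the second and in the first argument of the
  inner product.\<close>

lemma expansion_mult_exp:
  fixes \<beta> :: "'b::cstar_algebra"
  shows "expansion (blinfun_mult_left \<beta>) (\<lambda>s X. X = blinfun_mult_left (exp (s *\<^sub>R \<beta>)))"
    and "expansion (blinfun_mult_right (adj \<beta>)) (\<lambda>s X. X = blinfun_mult_right (adj (exp (s *\<^sub>R \<beta>))))"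
proof -
  show "expansion (blinfun_mult_left \<beta>) (\<lambda>s X. X = blinfun_mult_left (exp (s *\<^sub>R \<beta>)))"
    by (rule expansion_of_has_vector_derivative[OF bounded_linear_blinfun_mult_left exp_has_vector_derivative_0])
      (rule blinfun_eqI, simp)
  show "expansion (blinfun_mult_right (adj \<beta>)) (\<lambda>s X. X = blinfun_mult_right (adj (exp (s *\<^sub>R \<beta>))))"
    by (rule expansion_of_has_vector_derivative[OF bounded_linear_blinfun_mult_right
          bounded_linear.has_vector_derivative[OF bounded_linear_adj exp_has_vector_derivative_0]])
      (rule blinfun_eqI, simp)
qed

context unital_product_system
begin

text \<open><y, b x> is the adjoint of <x, adj b y>; difference quotients carry this to the
  generators.\<close>

lemma L_adj:
  assumes x: "x \<in> \<U> E \<omega>" and y: "y \<in> \<U> E \<omega>"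
  shows "\<L> E y x b = adj (\<L> E x y (adj b))"
proof (rule tendsto_unique[OF trivial_limit_at_right_real])
  have units: "x \<in> units_of_ps E" "y \<in> units_of_ps E" using x y by (auto simp: U_iff)
  let ?K = "\<lambda>u v s. (1 / s) *\<^sub>R (kap (fib E s) (u s) (v s) - id_blinfun)"
  show "((\<lambda>s. ?K y x s b) \<longlongrightarrow> \<L> E y x b) (at_right 0)"
    by (intro tendsto_intros expansion_tendsto tangent_U[where \<omega> = \<omega>] x y)
  have "((\<lambda>s. adj (?K x y s (adj b))) \<longlongrightarrow> adj (\<L> E x y (adj b))) (at_right 0)"
    by (intro tendsto_intros expansion_tendsto tangent_U[where \<omega> = \<omega>] x y)
  moreover have "\<forall>\<^sub>F s in at_right 0. adj (?K x y s (adj b)) = ?K y x s b"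
  proof (rule eventually_mono[OF eventually_at_right_less[of 0]])
    fix s :: real assume s: "0 < s"
    interpret M: hilbert_bimodule "fib E s" by (rule hilbert_bimodule_fib) (use s in simp)
    have "x s \<in> carrier (fib E s)" "y s \<in> carrier (fib E s)" using units s by (auto intro: unit_closed)
    then show "adj (?K x y s (adj b)) = ?K y x s b"
      by (simp add: blinfun.bilinear_simps adj_scaleR adj_diff adj_adj M.kap_apply M.ip_adj M.lact_closed M.ip_lact_left)
  qed
  ultimately show "((\<lambda>s. ?K y x s b) \<longlongrightarrow> adj (\<L> E x y (adj b))) (at_right 0)"
    by (rule Lim_transform_eventually)
qed

text \<open>
  Cauchy-Schwarz for \<open>d\<^sub>t = x\<^sub>t - y\<^sub>t\<close> and \<open>w\<^sub>t = a u\<^sub>t - u\<^sub>t a\<close>: to first order in \<open>t\<close> the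
  inner product \<open>\<langle>d\<^sub>t, d\<^sub>t\<rangle>\<close> vanishes while \<open>\<langle>w\<^sub>t, w\<^sub>t\<rangle>\<close> is \<open>O(t)\<close>, hence \<open>\<langle>d\<^sub>t, w\<^sub>t\<rangle> = o(t)\<close>.
\<close>

lemma L_diff_eq_mult:
  assumes x: "x \<in> \<U> E \<omega>" and y: "y \<in> \<U> E \<omega>" and u: "u \<in> \<U> E \<omega>"
    and D: "(\<L> E x x - \<L> E x y - \<L> E y x + \<L> E y y) 1 = 0"
  shows "\<L> E x u a - \<L> E y u a = (\<L> E x u 1 - \<L> E y u 1) * a"
proof -
  have units: "x \<in> units_of_ps E" "y \<in> units_of_ps E" "u \<in> units_of_ps E" using x y u by (auto simp: U_iff)
  define k where "k = (\<lambda>u v s. (1 / s) *\<^sub>R (kap (fib E s) (u s) (v s) - id_blinfun))"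
  have lim: "((\<lambda>s. k v v' s) \<longlongrightarrow> \<L> E v v') (at_right 0)" if "v \<in> \<U> E \<omega>" "v' \<in> \<U> E \<omega>" for v v'
    unfolding k_def by (intro expansion_tendsto tangent_U[where \<omega> = \<omega>] that)
  define X where "X = \<L> E x u a - \<L> E x u 1 * a - (\<L> E y u a - \<L> E y u 1 * a)"
  define W where "W = \<L> E u u (adj a * a) - \<L> E u u (adj a) * a - (adj a * \<L> E u u a - adj a * \<L> E u u 1 * a)"
  \<comment> \<open>In each of the three quotients the contributions of \<open>id_blinfun\<close>
    cancel. What remains is 1/s times an inner product of d and w; of \<open>W\<close> only its
    finiteness matters.\<close>
  define dw where "dw s = k x u s a - k x u s 1 * a - (k y u s a - k y u s 1 * a)" for s
  define dd where "dd s = k x x s 1 - k x y s 1 - (k y x s 1 - k y y s 1)" for s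
  define ww where "ww s = k u u s (adj a * a) - k u u s (adj a) * a - (adj a * k u u s a - adj a * k u u s 1 * a)" for s
  have "(dw \<longlongrightarrow> X) (at_right 0)"
    unfolding dw_def X_def by (intro tendsto_intros lim x y u)
  moreover have "(dd \<longlongrightarrow> (\<L> E x x 1 - \<L> E x y 1 - (\<L> E y x 1 - \<L> E y y 1))) (at_right 0)"
    unfolding dd_def by (intro tendsto_intros lim x y u)
  then have "(dd \<longlongrightarrow> 0) (at_right 0)"
    using D by (simp add: blinfun.bilinear_simps algebra_simps)
  moreover have "(ww \<longlongrightarrow> W) (at_right 0)"
    unfolding ww_def W_def by (intro tendsto_intros lim x y u)
  ultimately have "((\<lambda>s. (norm (dw s))\<^sup>2) \<longlongrightarrow> (norm X)\<^sup>2) (at_right 0)"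
    and "((\<lambda>s. norm (dd s) * norm (ww s)) \<longlongrightarrow> norm (0::'b) * norm W) (at_right 0)"
    by (auto intro!: tendsto_intros simp del: norm_zero mult_zero_left)
  moreover have "\<forall>\<^sub>F s in at_right 0. (norm (dw s))\<^sup>2 \<le> norm (dd s) * norm (ww s)"
  proof (rule eventually_mono[OF eventually_at_right_less[of 0]])
    fix s :: real assume s: "0 < s"
    interpret M: hilbert_bimodule "fib E s" by (rule hilbert_bimodule_fib) (use s in simp)
    have c: "x s \<in> carrier (fib E s)" "y s \<in> carrier (fib E s)" "u s \<in> carrier (fib E s)"
      using units s by (auto intro: unit_closed)
    let ?d = "x s \<ominus>\<^bsub>fib E s\<^esub> y s"
    let ?w = "lact (fib E s) a (u s) \<ominus>\<^bsub>fib E s\<^esub> ract (fib E s) (u s) a"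
    have dc: "?d \<in> carrier (fib E s)" "?w \<in> carrier (fib E s)"
      using c by (auto intro!: M.minus_closed M.lact_closed M.ract_closed)
    note ips = M.ip_diff_left M.ip_diff_right M.ip_ract_left M.ip_ract_right M.lact_closed M.ract_closed
      M.kap_apply k_def blinfun.bilinear_simps M.lact_one
    have dw: "dw s = (1 / s) *\<^sub>R ip (fib E s) ?d ?w"
      using c s by (simp add: ips dw_def) (simp add: algebra_simps)
    have dd: "dd s = (1 / s) *\<^sub>R ip (fib E s) ?d ?d"
      using c s by (simp add: ips dd_def) (simp add: algebra_simps)
    have ww: "ww s = (1 / s) *\<^sub>R ip (fib E s) ?w ?w"
      using c s by (simp add: ips ww_def M.ip_lact_left M.lact_mult[symmetric] M.lact_ract mult.assoc)
        (simp add: algebra_simps)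
    have "(norm (ip (fib E s) ?d ?w))\<^sup>2 \<le> (mod_norm (fib E s) ?d * mod_norm (fib E s) ?w)\<^sup>2"
      by (intro power_mono M.norm_ip_le dc) simp
    then have "(norm (ip (fib E s) ?d ?w))\<^sup>2 \<le> norm (ip (fib E s) ?d ?d) * norm (ip (fib E s) ?w ?w)"
      by (simp add: power_mult_distrib mod_norm_power2)
    then have "(1 / s)\<^sup>2 * (norm (ip (fib E s) ?d ?w))\<^sup>2 \<le> (1 / s)\<^sup>2 * (norm (ip (fib E s) ?d ?d) * norm (ip (fib E s) ?w ?w))"
      by (intro mult_left_mono) auto
    then show "(norm (dw s))\<^sup>2 \<le> norm (dd s) * norm (ww s)"
      unfolding dw dd ww using s by (simp add: power2_eq_square mult_ac)
  qed
  ultimately have "(norm X)\<^sup>2 \<le> norm (0::'b) * norm W"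
    using tendsto_le[OF trivial_limit_at_right_real] by blast
  then have "X = 0" by simp
  then show ?thesis by (simp add: X_def algebra_simps)
qed

text \<open>The exponential factor comes out of the inner product as a multiplication operator and
  adds its own derivative. What it leaves of the mixed operator is <y, b (a (x) ... (x) a)>, which
  expands because y is a unit.\<close>

lemma exp_unit_tangent:
  fixes \<beta> :: 'b
  assumes y: "y \<in> \<U> E \<omega>"
  defines "a \<equiv> \<lambda>s. ract (fib E s) (y s) (exp (s *\<^sub>R \<beta>))"
  shows "generating a (\<L> E y y + blinfun_mult_left \<beta> + blinfun_mult_right (adj \<beta>))"
    and "\<xi> \<in> \<U> E \<omega> \<Longrightarrow> tangent a \<xi> (\<L> E y \<xi> + blinfun_mult_right (adj \<beta>))"
    and "\<xi> \<in> \<U> E \<omega> \<Longrightarrow> tangent \<xi> a (\<L> E \<xi> y + blinfun_mult_left \<beta>)"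
proof -
  have yu: "y \<in> units_of_ps E" using y by (simp add: U_iff)
  have unit: "\<xi> \<in> units_of_ps E" if "\<xi> \<in> \<U> E \<omega>" for \<xi> using that by (simp add: U_iff)
  have a: "is_section a"
    unfolding is_section_def a_def
  proof (intro allI impI)
    fix s :: real assume s: "0 \<le> s"
    interpret M: hilbert_bimodule "fib E s" by (rule hilbert_bimodule_fib[OF s])
    show "ract (fib E s) (y s) (exp (s *\<^sub>R \<beta>)) \<in> carrier (fib E s)"
      by (intro M.ract_closed unit_closed yu s)
  qed
  have left: "kap (fib E s) (a s) v = blinfun_mult_right (adj (exp (s *\<^sub>R \<beta>))) o\<^sub>L kap (fib E s) (y s) v"
    and right: "kap (fib E s) v (a s) = blinfun_mult_left (exp (s *\<^sub>R \<beta>)) o\<^sub>L kap (fib E s) v (y s)"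
    if "0 \<le> s" "v \<in> carrier (fib E s)" for s v
  proof -
    interpret M: hilbert_bimodule "fib E s" by (rule hilbert_bimodule_fib[OF that(1)])
    show "kap (fib E s) (a s) v = blinfun_mult_right (adj (exp (s *\<^sub>R \<beta>))) o\<^sub>L kap (fib E s) (y s) v"
      unfolding a_def by (intro M.kap_ract_left unit_closed yu that)
    show "kap (fib E s) v (a s) = blinfun_mult_left (exp (s *\<^sub>R \<beta>)) o\<^sub>L kap (fib E s) v (y s)"
      unfolding a_def by (intro M.kap_ract_right unit_closed yu that)
  qed
  show "tangent a \<xi> (\<L> E y \<xi> + blinfun_mult_right (adj \<beta>))" if "\<xi> \<in> \<U> E \<omega>"
    by (rule expansion_mono[OF expansion_compose[OF tangent_U[OF y that] expansion_mult_exp(2)]])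
      (simp add: left unit_closed unit[OF that])
  show right': "tangent \<xi> a (\<L> E \<xi> y + blinfun_mult_left \<beta>)" if "\<xi> \<in> \<U> E \<omega>" for \<xi>
    by (rule expansion_mono[OF expansion_compose[OF tangent_U[OF that y] expansion_mult_exp(1)]])
      (simp add: right unit_closed unit[OF that])
  have "expansion (\<L> E y y + blinfun_mult_left \<beta> + blinfun_mult_right (adj \<beta>))
      (\<lambda>s X. \<exists>q. is_partition s q \<and> X = kap (fib E s) (a s) (sec_tens a q))"
    by (rule expansion_mono[OF expansion_compose[OF
          expansion_unit_sec_tens[OF yu a right'[OF y]] expansion_mult_exp(2)]])
      (use left sec_tens_closed[OF a] in blast)
  with a show "generating a (\<L> E y y + blinfun_mult_left \<beta> + blinfun_mult_right (adj \<beta>))"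
    by (simp add: generating_def)
qed

lemma exp_unit_in_units:
  assumes y: "y \<in> \<U> E \<omega>"
  shows "exp_unit E y \<beta> \<in> units_of_ps E"
    and "tangent (exp_unit E y \<beta>) (exp_unit E y \<beta>) (\<L> E y y + blinfun_mult_left \<beta> + blinfun_mult_right (adj \<beta>))"
    and "\<xi> \<in> \<U> E \<omega> \<Longrightarrow> tangent (exp_unit E y \<beta>) \<xi> (\<L> E y \<xi> + blinfun_mult_right (adj \<beta>))"
    and "\<xi> \<in> \<U> E \<omega> \<Longrightarrow> tangent \<xi> (exp_unit E y \<beta>) (\<L> E \<xi> y + blinfun_mult_left \<beta>)"
  unfolding exp_unit_def using limit_unit_in_units[OF exp_unit_tangent(1)[OF y]]
    tangent_limit_unit[OF exp_unit_tangent(1)[OF y]] exp_unit_tangent(2,3)[OF y]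
  by (simp_all add: U_iff)

lemma ex_exp_unit_iff:
  assumes x: "x \<in> \<U> E \<omega>" and y: "y \<in> \<U> E \<omega>"
  shows "(\<L> E x x - \<L> E x y - \<L> E y x + \<L> E y y) 1 = 0 \<longleftrightarrow> (\<exists>\<beta>. x = exp_unit E y \<beta>)"
proof
  assume D: "(\<L> E x x - \<L> E x y - \<L> E y x + \<L> E y y) 1 = 0"
  \<comment> \<open>The value at 1 of two differences: of \<open>\<L> E x y - \<L> E y y\<close> by
    definition and of \<open>\<L> E x x - \<L> E y x\<close> by \<open>D\<close>.\<close>
  define \<gamma> where "\<gamma> = \<L> E x y 1 - \<L> E y y 1"
  have "\<L> E x x 1 - \<L> E y x 1 = \<gamma>"
    using D by (simp add: \<gamma>_def blinfun.bilinear_simps algebra_simps)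
  then have xx: "\<L> E x x b = \<L> E y x b + \<gamma> * b" for b
    using L_diff_eq_mult[OF x y x D, of b] by (simp add: algebra_simps)
  have xy: "\<L> E x y b = \<L> E y y b + \<gamma> * b" for b
    using L_diff_eq_mult[OF x y y D, of b] by (simp add: \<gamma>_def algebra_simps)
  have yx: "\<L> E y x b = \<L> E y y b + b * adj \<gamma>" for b
    using L_adj[OF x y, of b] L_adj[OF y y, of b] by (simp add: xy adj_add adj_mult adj_adj)
  \<comment> \<open>An exponent enters through its adjoint in the first argument, hence
    \<open>adj \<gamma>\<close>, which is (\<open>\<L> E y x - \<L> E y y\<close>) 1.\<close>
  let ?z = "exp_unit E y (adj \<gamma>)"
  have 1: "\<L> E y y + blinfun_mult_left (adj \<gamma>) + blinfun_mult_right (adj (adj \<gamma>)) = \<L> E x x"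
    by (rule blinfun_eqI) (simp add: xx yx blinfun.bilinear_simps adj_adj)
  have 2: "\<L> E y x + blinfun_mult_right (adj (adj \<gamma>)) = \<L> E x x"
    by (rule blinfun_eqI) (simp add: xx blinfun.bilinear_simps adj_adj)
  have "?z = x"
  proof (rule unit_eqI)
    show "tangent ?z ?z (\<L> E x x)" using exp_unit_in_units(2)[OF y, of "adj \<gamma>"] unfolding 1 .
    show "tangent ?z x (\<L> E x x)" using exp_unit_in_units(3)[OF y x, of "adj \<gamma>"] unfolding 2 .
  qed (use x exp_unit_in_units(1)[OF y] tangent_U[OF x x] in \<open>auto simp: U_iff\<close>)
  then show "\<exists>\<beta>. x = exp_unit E y \<beta>" by metis
next
  assume "\<exists>\<beta>. x = exp_unit E y \<beta>"
  then obtain \<beta> where \<beta>: "x = exp_unit E y \<beta>" ..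
  have units: "x \<in> units_of_ps E" "y \<in> units_of_ps E" using x y by (auto simp: U_iff)
  \<comment> \<open>Each of the two multiplication operators occurs once with either sign in the
    alternating sum.\<close>
  have "\<L> E x x = \<L> E y y + blinfun_mult_left \<beta> + blinfun_mult_right (adj \<beta>)"
      "\<L> E x y = \<L> E y y + blinfun_mult_right (adj \<beta>)" "\<L> E y x = \<L> E y y + blinfun_mult_left \<beta>"
    using exp_unit_in_units(2,3,4)[OF y, where \<beta> = \<beta>] y units by (auto intro!: L_eqI simp: \<beta>[symmetric])
  then show "(\<L> E x x - \<L> E x y - \<L> E y x + \<L> E y y) 1 = 0" by simp
qed

end

theorem proposition5p5:
  fixes E :: "('e, 'b::cstar_algebra) psystem"
    and \<omega> x y :: "real \<Rightarrow> 'e"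
  assumes "product_system E"
    and "subspatial TYPE('f) E"
    and "continuous_unit E \<omega>"
    and "spatial E \<Longrightarrow> central_unit E \<omega>"
    and "x \<in> \<U> E \<omega>"
    and "y \<in> \<U> E \<omega>"
  shows "unit_equiv E \<omega> x y \<longleftrightarrow> (\<exists>\<beta>. x = exp_unit E y \<beta>)"
proof -
  have \<omega>: "\<omega> \<in> units_of_ps E"
    using assms(3) by (simp add: continuous_unit_def continuous_set_def)
  then have "\<omega> 0 = unit_iso E 1" "tens E 0 0 (\<omega> 0) (\<omega> 0) = \<omega> (0 + 0)"
    unfolding units_of_ps_def by blast+
  then interpret unital_product_system E
    using assms(1) by unfold_locales simp_all
  have \<omega>_U: "\<omega> \<in> \<U> E \<omega>"
    using assms(3) by (simp add: \<U>_def continuous_unit_def)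
  show ?thesis
    unfolding unit_equiv_def ip_unit_bimodule_minus[OF assms(5,6) \<omega>_U]
    by (rule ex_exp_unit_iff[OF assms(5,6)])
qed

end
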